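(* For $R\in(0,\pi]$ consider the Hegselmann--Krause interaction $W_R(\theta)=(R-2\pi|\theta|)_+^2$ on $\mathbb T$, and let $R_*\in(0,\pi)$ be the unique solution in $(0,\pi)$ of $R=(\sin R)(2-\cos R)$. Then: (1) if $R<R_*$, the phase transition of $\mathcal F_K$ (with $W=W_R$) is discontinuous and $K_c(R)<K_\#(R)$; (2) if $R\ge R_*$, the phase transition is continuous and occurs at $K_c(R)=K_\#(R)$.
   Context: $\mathbb T=[-\frac12,\frac12)$ with periodic boundary conditions; $x_+=\max(x,0)$; $\mathcal P(\mathbb T)$ denotes Borel probability measures, identified with densities when absolutely continuous; $q_u\equiv1$ is the uniform distribution. Fourier coefficients: $\widehat f(k)=\int_{\mathbb T}f(\theta)e^{-2\pi ik\theta}d\theta$. Free energy: for $K\ge0$, $\mathcal F_K(q)=\int_{\mathbb T}\log q\,dq-K\iint W(\theta-\theta')\,dq(\theta)dq(\theta')$ ($+\infty$ if $q$ is not absolutely continuous). A number $K_c\ge0$ is the critical coupling if for $K<K_c$, $q_u$ is the unique global minimizer of $\mathcal F_K$; at $K=K_c$, $q_u$ is a global minimizer; for $K>K_c$ there is a global minimizer $q\ne q_u$. The phase transition is continuous if at $K=K_c$ the global minimizer is unique and for every family $\{q_K:K>K_c\}$ of global minimizers, $\limsup_{K\to K_c^+}\|q_K-q_u\|_{L^1}=0$; otherwise discontinuous. The linear stability threshold is $K_\#=\big(2\max_{k\ge1,\widehat W(k)>0}\widehat W(k)\big)^{-1}$; $K_c(R),K_\#(R)$ denote these quantities for $W=W_R$.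 *)

theory Defs
  imports "HOL-Analysis.Analysis"
begin

definition torus :: "real set" where
  "torus = {-1/2..<1/2}"

abbreviation torus_measure :: "real measure" where
  "torus_measure \<equiv> lebesgue_on torus"

text \<open>Distance to the nearest integer: equals abs theta on T; used for periodic extension.\<close>
definition dist_T :: "real \<Rightarrow> real" where
  "dist_T x = min (frac x) (1 - frac x)"

definition W_HK :: "real \<Rightarrow> real \<Rightarrow> real" where
  "W_HK R \<theta> = (max (R - 2 * pi * dist_T \<theta>) 0) ^ 2"

definition fourier_coeff :: "(real \<Rightarrow> real) \<Rightarrow> int \<Rightarrow> complex" where
  "fourier_coeff f k =
     integral\<^sup>L torus_measure (\<lambda>\<theta>. complex_of_real (f \<theta>) * exp (- 2 * pi * \<i> * of_int k * of_real \<theta>))"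

definition densities :: "(real \<Rightarrow> real) set" where
  "densities = {q. q \<in> borel_measurable torus_measure \<and> (\<forall>x\<in>torus. 0 \<le> q x)
                 \<and> integrable torus_measure q \<and> integral\<^sup>L torus_measure q = 1}"

definition q_unif :: "real \<Rightarrow> real" where
  "q_unif = (\<lambda>_. 1)"

definition same_measure :: "(real \<Rightarrow> real) \<Rightarrow> (real \<Rightarrow> real) \<Rightarrow> bool" where
  "same_measure p q \<longleftrightarrow> (AE x in torus_measure. p x = q x)"

text \<open>Entropy int q log q, valued in (-infinity, +infinity]; it is +infinity exactly when
  q log q is not integrable (its negative part is always bounded).\<close>
definition entropy :: "(real \<Rightarrow> real) \<Rightarrow> ereal" where
  "entropy q = (if integrable torus_measure (\<lambda>x. q x * ln (q x))
                then ereal (integral\<^sup>L torus_measure (\<lambda>x. q x * ln (q x))) else \<infinity>)"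

definition interaction :: "(real \<Rightarrow> real) \<Rightarrow> (real \<Rightarrow> real) \<Rightarrow> real" where
  "interaction W q = integral\<^sup>L torus_measure (\<lambda>\<theta>.
       integral\<^sup>L torus_measure (\<lambda>\<theta>'. W (\<theta> - \<theta>') * q \<theta> * q \<theta>'))"

text \<open>Free energy on densities (on non-absolutely-continuous measures it is +infinity,
  so those never matter for global minimization).\<close>
definition free_energy :: "(real \<Rightarrow> real) \<Rightarrow> real \<Rightarrow> (real \<Rightarrow> real) \<Rightarrow> ereal" where
  "free_energy W K q = entropy q - ereal (K * interaction W q)"

definition global_minimizer :: "(real \<Rightarrow> real) \<Rightarrow> real \<Rightarrow> (real \<Rightarrow> real) \<Rightarrow> bool" where
  "global_minimizer W K q \<longleftrightarrow> q \<in> densities \<and> (\<forall>p\<in>densities. free_energy W K q \<le> free_energy W K p)"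

definition critical_coupling :: "(real \<Rightarrow> real) \<Rightarrow> real \<Rightarrow> bool" where
  "critical_coupling W Kc \<longleftrightarrow> 0 \<le> Kc
     \<and> (\<forall>K. 0 \<le> K \<and> K < Kc \<longrightarrow> global_minimizer W K q_unif
            \<and> (\<forall>q. global_minimizer W K q \<longrightarrow> same_measure q q_unif))
     \<and> global_minimizer W Kc q_unif
     \<and> (\<forall>K>Kc. \<exists>q. global_minimizer W K q \<and> \<not> same_measure q q_unif)"

definition continuous_transition :: "(real \<Rightarrow> real) \<Rightarrow> real \<Rightarrow> bool" where
  "continuous_transition W Kc \<longleftrightarrow>
     (\<forall>q. global_minimizer W Kc q \<longrightarrow> same_measure q q_unif)
     \<and> (\<forall>qf :: real \<Rightarrow> real \<Rightarrow> real. (\<forall>K>Kc. global_minimizer W K (qf K)) \<longrightarrow>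
          ((\<lambda>K. integral\<^sup>L torus_measure (\<lambda>x. \<bar>qf K x - q_unif x\<bar>)) \<longlongrightarrow> 0) (at_right Kc))"

text \<open>Linear stability threshold (W even, so its Fourier coefficients are real).\<close>
definition K_sharp :: "(real \<Rightarrow> real) \<Rightarrow> real" where
  "K_sharp W = 1 / (2 * Sup {Re (fourier_coeff W k) | k. k \<ge> 1 \<and> Re (fourier_coeff W k) > 0})"

end

theory Submission
  imports Defs "HOL-Complex_Analysis.Complex_Analysis"
begin

text \<open>All Fourier coefficients of \<open>W_R\<close> are positive, with \<open>W_k\<close> proportional to \<open>(kR - sin kR) / k^3\<close>.
  At \<open>K_#\<close> the excess free energy of \<open>q\<close> is the entropy minus the sum of \<open>(W_k / W_1) |q_k|^2\<close> over \<open>k \<ge> 1\<close>.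
  By the sharp logarithmic Hardy-Littlewood-Sobolev inequality the entropy dominates the sum of \<open>|q_k|^2 / k\<close>, so the
  uniform state is the unique minimiser at \<open>K_#\<close> as soon as \<open>W_k / W_1 \<le> 1 / k\<close>, which holds for all \<open>k\<close>
  exactly when it holds for \<open>k = 2\<close>, that is for \<open>R \<ge> R_*\<close>. If it fails for \<open>k = 2\<close>, truncated Poisson kernels of small radius beat the
  uniform state already at \<open>K_#\<close>, so \<open>K_c < K_#\<close>; below \<open>K_#\<close> the uniform state is isolated among
  minimisers, so minimisers above \<open>K_c\<close> cannot converge to it. Minimisers exist, and minimisers at nearby couplings are
  precompact, because the map \<open>q \<mapsto> exp (2K W*q) / Z\<close> is compact and decreases the free energy.\<close>

section \<open>Integration on the torus\<close>

text \<open>The case \<open>R = R_*\<close> shapes the proof: there \<open>W_2 / W_1\<close> ties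
  with \<open>1 / 2\<close>, so comparing terms excludes only the modes \<open>k \<ge> 3\<close>. To
  exclude the other two, the equality case of the Lebedev-Milin inequality is needed. Its nontrivial
  extremals have \<open>a_k = r^k / k\<close> and involve every mode, so a nonzero polynomial of
  degree two cannot be one; only that degree is analysed. Polynomials are also enough for the
  inequality itself, because the entropy bound is used through partial sums. The same extremals
  explain the trial states: at \<open>K_#\<close> the terms of second order in the radius cancel,
  and the first two Poisson modes give an entropy that saturates the logarithmic inequality up to
  fourth order, so that order compares \<open>W_2 / W_1\<close> with \<open>1 / 2\<close>. Entropy
  is not continuous in \<open>L^1\<close>. Passing to images of the self-consistency map avoids weak
  compactness and semicontinuity: they are Gibbs densities with uniformly bounded exponents, along
  which entropy, interaction and \<open>L^1\<close> distance converge together.\<close>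

lemma torus_lebesgue [measurable, simp]: "torus \<in> sets lebesgue"
  by (simp add: torus_def)

lemma space_torus [simp]: "space torus_measure = torus"
  by simp

lemma emeasure_torus: "emeasure torus_measure torus = 1"
  by (simp add: emeasure_restrict_space) (simp add: torus_def)

interpretation torus: finite_measure torus_measure
  by (rule finite_measureI) (simp add: emeasure_torus)

lemma measure_torus [simp]: "measure torus_measure torus = 1"
  by (simp add: measure_def emeasure_torus)

lemma integral_const_torus [simp]: "integral\<^sup>L torus_measure (\<lambda>x. c) = (c::'b::{banach,second_countable_topology})"
  by (simp add: measure_torus)

lemma torus_measurable_cont:
  fixes f :: "real \<Rightarrow> 'b::euclidean_space"
  assumes "continuous_on torus f"
  shows "f \<in> borel_measurable torus_measure"
  using assms by (rule continuous_imp_measurable_on_sets_lebesgue) simp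

lemma integrable_torus_bounded:
  fixes f :: "real \<Rightarrow> 'b::{banach,second_countable_topology}"
  assumes "f \<in> borel_measurable torus_measure" "\<And>x. x \<in> torus \<Longrightarrow> norm (f x) \<le> C"
  shows "integrable torus_measure f"
  using assms by (intro torus.integrable_const_bound[of _ C] AE_I2) auto

lemma integrable_torus_mult:
  fixes f q :: "real \<Rightarrow> real"
  assumes "f \<in> borel_measurable torus_measure" "\<And>x. x \<in> torus \<Longrightarrow> \<bar>f x\<bar> \<le> C"
    and "integrable torus_measure q"
  shows "integrable torus_measure (\<lambda>x. f x * q x)"
proof (rule Bochner_Integration.integrable_bound)
  show "integrable torus_measure (\<lambda>x. C * q x)" using assms(3) by simp
  show "(\<lambda>x. f x * q x) \<in> borel_measurable torus_measure"
    using assms(1) borel_measurable_integrable[OF assms(3)] by (rule borel_measurable_times)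
  show "AE x in torus_measure. norm (f x * q x) \<le> norm (C * q x)"
  proof (rule AE_I2)
    fix x assume "x \<in> space torus_measure"
    then have "\<bar>f x\<bar> \<le> C" using assms(2) by simp
    then have "\<bar>f x\<bar> \<le> \<bar>C\<bar>" by linarith
    then show "norm (f x * q x) \<le> norm (C * q x)"
      by (simp add: abs_mult mult_right_mono)
  qed
qed

lemma cont_imp_integrable_torus:
  fixes f :: "real \<Rightarrow> 'b::euclidean_space"
  assumes "continuous_on {-1/2..1/2} f"
  shows "integrable torus_measure f"
proof -
  have "compact (f ` {-1/2..1/2})" using assms by (intro compact_continuous_image) auto
  then obtain C where C: "\<forall>x \<in> {-1/2..1/2}. norm (f x) \<le> C"
    by (auto dest!: compact_imp_bounded simp: bounded_iff)
  show ?thesis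
  proof (rule integrable_torus_bounded)
    show "f \<in> borel_measurable torus_measure"
      by (rule torus_measurable_cont[OF continuous_on_subset[OF assms]]) (auto simp: torus_def)
    show "norm (f x) \<le> C" if "x \<in> torus" for x using that C by (auto simp: torus_def)
  qed
qed

text \<open>The half-open torus and the closed interval differ by the negligible point
  \<open>1/2\<close>, so gauge integrals and the fundamental theorem compute Lebesgue integrals over
  \<open>torus\<close>.\<close>

lemma integral_torus_eqI:
  fixes f :: "real \<Rightarrow> 'b::euclidean_space"
  assumes "continuous_on {-1/2..1/2} f" and "(f has_integral I) {-1/2..1/2}"
  shows "integral\<^sup>L torus_measure f = I"
proof -
  have "(f has_integral y) {-1/2..1/2} \<longleftrightarrow> (f has_integral y) torus" for y
  proof (rule has_integral_spike_set_eq)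
    show "negligible {x \<in> {- 1 / 2..1 / 2} - torus. f x \<noteq> 0}"
      by (rule negligible_subset[of "{1/2}"]) (auto simp: torus_def)
    show "negligible {x \<in> torus - {- 1 / 2..1 / 2}. f x \<noteq> 0}"
      by (rule negligible_subset[of "{1/2}"]) (auto simp: torus_def)
  qed
  moreover have "(f has_integral (integral\<^sup>L torus_measure f)) torus"
    by (rule has_integral_integral_lebesgue_on[OF cont_imp_integrable_torus[OF assms(1)]]) simp
  ultimately show ?thesis using assms(2) by (metis has_integral_unique)
qed

lemma integral_torus_FTC:
  fixes f :: "real \<Rightarrow> 'b::euclidean_space"
  assumes "continuous_on {-1/2..1/2} f"
    and "\<And>x. x \<in> {-1/2..1/2} \<Longrightarrow> (F has_vector_derivative f x) (at x within {-1/2..1/2})"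
  shows "integral\<^sup>L torus_measure f = F (1/2) - F (-1/2)"
  using assms by (intro integral_torus_eqI fundamental_theorem_of_calculus) auto

lemma integral_cis_torus:
  "integral\<^sup>L torus_measure (\<lambda>x. cis (2 * pi * of_int j * x)) = (if j = 0 then 1 else 0)"
proof (cases "j = 0")
  case False
  let ?F = "\<lambda>x::real. cis (2 * pi * of_int j * x) / (2 * pi * of_int j * \<i>)"
  have "integral\<^sup>L torus_measure (\<lambda>x. cis (2 * pi * of_int j * x)) = ?F (1/2) - ?F (-1/2)"
  proof (rule integral_torus_FTC)
    fix x :: real
    have "((\<lambda>z. exp (2 * pi * of_int j * \<i> * z) / (2 * pi * of_int j * \<i>)) has_field_derivative
        exp (2 * pi * of_int j * \<i> * of_real x)) (at (of_real x))"
      using False by (auto intro!: derivative_eq_intros)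
    from has_vector_derivative_real_field[OF this]
    show "(?F has_vector_derivative cis (2 * pi * of_int j * x)) (at x within {-1/2..1/2})"
      by (simp only: cis_conv_exp of_real_mult of_real_of_int_eq of_real_numeral mult_ac)
  next
    show "continuous_on {-1/2..1/2} (\<lambda>x. cis (2 * pi * of_int j * x))"
      by (intro continuous_intros)
  qed
  also have "cis (2 * pi * of_int j * (1/2)) = cis (2 * pi * of_int j * (-1/2))"
  proof -
    have "cis (2 * pi * of_int j * (1/2)) = cis (2 * pi * of_int j * (-1/2)) * cis (2 * pi * of_int j)"
      by (subst cis_mult) (rule arg_cong[of _ _ cis], simp)
    also have "cis (2 * pi * of_int j) = 1"
      by (rule cis_multiple_2pi) simp
    finally show ?thesis by simp
  qed
  finally show ?thesis using False by simp
qed simp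

lemma integrable_cis_torus: "integrable torus_measure (\<lambda>x. cis (a * x))"
  by (intro cont_imp_integrable_torus continuous_intros)

lemma integral_cos_int: "integral\<^sup>L torus_measure (\<lambda>x. cos (2 * pi * of_int j * x)) = (if j = 0 then 1 else 0)"
  and integral_sin_int: "integral\<^sup>L torus_measure (\<lambda>x. sin (2 * pi * of_int j * x)) = 0"
proof -
  have "integral\<^sup>L torus_measure (\<lambda>x. Re (cis (2 * pi * of_int j * x))) = (if j = 0 then 1 else 0)"
    by (subst integral_Re[OF integrable_cis_torus]) (simp only: integral_cis_torus, simp)
  then show "integral\<^sup>L torus_measure (\<lambda>x. cos (2 * pi * of_int j * x)) = (if j = 0 then 1 else 0)" by simp
  have "integral\<^sup>L torus_measure (\<lambda>x. Im (cis (2 * pi * of_int j * x))) = 0"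
    by (subst integral_Im[OF integrable_cis_torus]) (simp only: integral_cis_torus, simp)
  then show "integral\<^sup>L torus_measure (\<lambda>x. sin (2 * pi * of_int j * x)) = 0" by simp
qed

lemma integral_cos_torus:
  "integral\<^sup>L torus_measure (\<lambda>x. cos (2 * pi * real k * x)) = (if k = 0 then 1 else 0)"
  using integral_cos_int[of "int k"] by simp

lemma integral_sin_torus:
  "integral\<^sup>L torus_measure (\<lambda>x. sin (2 * pi * real k * x)) = 0"
  using integral_sin_int[of "int k"] by simp

section \<open>The Lebedev-Milin inequality\<close>

text \<open>Termwise integration under a majorant \<open>g\<close> scaled by summable constants.
  Trigonometric series take \<open>g = 1\<close>; series multiplied by an integrable function take a
  multiple of its absolute value.\<close>

lemma sums_integral_torus:
  fixes \<phi> :: "nat \<Rightarrow> real \<Rightarrow> 'b::{banach,second_countable_topology}"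
  assumes meas: "\<And>n. \<phi> n \<in> borel_measurable torus_measure"
    and bound: "\<And>n x. x \<in> torus \<Longrightarrow> norm (\<phi> n x) \<le> B n * g x"
    and g: "integrable torus_measure g" and B: "summable B"
  shows "(\<lambda>n. integral\<^sup>L torus_measure (\<phi> n)) sums (integral\<^sup>L torus_measure (\<lambda>x. \<Sum>n. \<phi> n x))"
    and "integrable torus_measure (\<lambda>x. \<Sum>n. \<phi> n x)"
proof -
  have int: "integrable torus_measure (\<phi> n)" for n
  proof (rule Bochner_Integration.integrable_bound)
    show "integrable torus_measure (\<lambda>x. B n * g x)" using g by simp
    show "AE x in torus_measure. norm (\<phi> n x) \<le> norm (B n * g x)"
      using bound[of _ n] by (intro AE_I2) (force intro: order_trans)
  qed (rule meas)
  have 1: "AE x in torus_measure. summable (\<lambda>n. norm (\<phi> n x))"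
  proof (rule AE_I2)
    fix x assume "x \<in> space torus_measure"
    then show "summable (\<lambda>n. norm (\<phi> n x))"
      using bound[of x] by (intro summable_comparison_test'[OF summable_mult2[OF B, of "g x"], of 0]) auto
  qed
  have 2: "summable (\<lambda>n. integral\<^sup>L torus_measure (\<lambda>x. norm (\<phi> n x)))"
  proof (rule summable_comparison_test'[OF summable_mult2[OF B, of "integral\<^sup>L torus_measure g"], of 0])
    fix n
    have "integral\<^sup>L torus_measure (\<lambda>x. norm (\<phi> n x)) \<le> integral\<^sup>L torus_measure (\<lambda>x. B n * g x)"
      by (rule integral_mono) (use g int[of n] bound in auto)
    then show "norm (integral\<^sup>L torus_measure (\<lambda>x. norm (\<phi> n x))) \<le> B n * integral\<^sup>L torus_measure g"
      by simp
  qed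
  show "(\<lambda>n. integral\<^sup>L torus_measure (\<phi> n)) sums (integral\<^sup>L torus_measure (\<lambda>x. \<Sum>n. \<phi> n x))"
    by (rule sums_integral[OF int 1 2])
  show "integrable torus_measure (\<lambda>x. \<Sum>n. \<phi> n x)"
    by (rule integrable_suminf[OF int 1 2])
qed

text \<open>The exponential of a polynomial is entire, and comparing coefficients in
  \<open>deriv G = deriv g * G\<close> yields the recurrence. The recurrence is all that the
  coefficient comparison uses.\<close>

lemma exp_polynomial_series:
  fixes a :: "nat \<Rightarrow> complex"
  assumes a: "\<And>k. N < k \<Longrightarrow> a k = 0"
  shows "\<exists>b. b 0 = 1
    \<and> (\<forall>n. of_nat (Suc n) * b (Suc n) = (\<Sum>i\<le>n. of_nat (Suc i) * a (Suc i) * b (n - i)))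
    \<and> (\<forall>z. (\<lambda>n. b n * z ^ n) sums exp (\<Sum>k=1..N. a k * z ^ k))
    \<and> summable (\<lambda>n. norm (b n))"
proof -
  define g where "g = (\<lambda>z. \<Sum>k\<in>{1..N}. a k * z ^ k)"
  define G where "G = (\<lambda>z. exp (g z))"
  define P where "P = (\<Sum>k\<in>{1..N}. fps_const (a k) * fps_X ^ k)"
  define F where "F = fps_expansion G 0"
  have holg: "g holomorphic_on UNIV" unfolding g_def by (intro holomorphic_intros)
  have holG: "G holomorphic_on UNIV" unfolding G_def by (intro holomorphic_intros holg)
  have F: "G has_fps_expansion F"
    unfolding F_def by (rule has_fps_expansion_fps_expansion[OF _ _ holG]) auto
  have P: "g has_fps_expansion P"
    unfolding g_def P_def
    by (intro has_fps_expansion_sum has_fps_expansion_cmult_left has_fps_expansion_fps_X_power)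
  have "deriv G = (\<lambda>z. deriv g z * G z)"
  proof
    fix z
    have "(g has_field_derivative deriv g z) (at z)"
      using holg holomorphic_derivI by blast
    then have "(G has_field_derivative (deriv g z * G z)) (at z)"
      unfolding G_def by (auto intro!: derivative_eq_intros)
    then show "deriv G z = deriv g z * G z" by (rule DERIV_imp_deriv)
  qed
  then have "(\<lambda>z. deriv g z * G z) has_fps_expansion fps_deriv F"
    using has_fps_expansion_deriv[OF F] by simp
  moreover have "(\<lambda>z. deriv g z * G z) has_fps_expansion fps_deriv P * F"
    by (intro has_fps_expansion_mult has_fps_expansion_deriv P F)
  ultimately have FP: "fps_deriv F = fps_deriv P * F"
    by (rule fps_expansion_unique_complex)
  have Pnth: "fps_nth P (Suc i) = a (Suc i)" for i
    using a[of "Suc i"] unfolding P_def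
    by (auto simp: fps_sum_nth fps_X_power_nth if_distrib[where f="\<lambda>x. _ * x"] cong: if_cong)
  have sums: "(\<lambda>n. fps_nth F n * z ^ n) sums G z" for z
    by (rule has_fps_expansion_imp_sums_complex[OF F, where r=\<infinity>]) (use holG in \<open>auto intro: holomorphic_on_subset\<close>)
  show ?thesis
  proof (intro exI[of _ "fps_nth F"] conjI allI)
    have "fps_nth F 0 = G 0"
      using sums[of 0] by (simp add: powser_sums_zero_iff)
    also have "g 0 = 0" unfolding g_def by (intro sum.neutral) auto
    then have "G 0 = 1" by (simp add: G_def)
    finally show "fps_nth F 0 = 1" .
    show "of_nat (Suc n) * fps_nth F (Suc n) = (\<Sum>i\<le>n. of_nat (Suc i) * a (Suc i) * fps_nth F (n - i))" for n
      using arg_cong[OF FP, of "\<lambda>f. fps_nth f n"]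
      by (simp add: fps_mult_nth Pnth atLeast0AtMost del: of_nat_Suc)
    show "(\<lambda>n. fps_nth F n * z ^ n) sums exp (\<Sum>k=1..N. a k * z ^ k)" for z
      using sums[of z] by (simp add: G_def g_def)
    \<comment> \<open>Convergence at \<open>2\<close> puts \<open>1\<close> strictly inside the
      disc, hence absolute convergence there.\<close>
    show "summable (\<lambda>n. norm (fps_nth F n))"
      using powser_insidea[of "fps_nth F" 2 1] sums[of 2] by (simp add: sums_iff)
  qed
qed

text \<open>Absolute summability justifies two termwise integrations: one recovers
  \<open>b m\<close> as a Fourier coefficient of the sum, the other expands the conjugate factor of
  the squared modulus.\<close>

lemma parseval_torus:
  fixes b :: "nat \<Rightarrow> complex"
  assumes b: "summable (\<lambda>n. norm (b n))"
  shows "(\<lambda>n. (norm (b n))\<^sup>2) sums integral\<^sup>L torus_measure (\<lambda>x. (norm (\<Sum>n. b n * cis (2 * pi * real n * x)))\<^sup>2)"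
proof -
  define G where "G x = (\<Sum>n. b n * cis (2 * pi * real n * x))" for x
  define C where "C = (\<Sum>n. norm (b n))"
  have cism: "(\<lambda>x. cis (c * x)) \<in> borel_measurable torus_measure" for c
    using integrable_cis_torus by (rule borel_measurable_integrable)
  have Gint: "integrable torus_measure G"
    unfolding G_def
    by (rule sums_integral_torus(2)[where B="\<lambda>n. norm (b n)" and g="\<lambda>_. 1"])
       (auto simp: norm_mult b intro!: borel_measurable_times cism)
  have GC: "norm (G x) \<le> C" for x
    unfolding G_def C_def
    using b by (intro order_trans[OF summable_norm]) (auto simp: norm_mult)
  have coeff: "integral\<^sup>L torus_measure (\<lambda>x. G x * cnj (cis (2 * pi * real m * x))) = b m" for m
  proof -
    have eq: "G x * cnj (cis (2 * pi * real m * x)) = (\<Sum>n. b n * cis (2 * pi * of_int (int n - int m) * x))" for x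
    proof -
      have "G x * cnj (cis (2 * pi * real m * x)) = (\<Sum>n. b n * cis (2 * pi * real n * x) * cis (- (2 * pi * real m * x)))"
        unfolding G_def cis_cnj
        by (rule suminf_mult2) (rule summable_norm_cancel, use b in \<open>simp add: norm_mult\<close>)
      then show ?thesis by (simp add: mult.assoc cis_mult algebra_simps)
    qed
    have "(\<lambda>n. integral\<^sup>L torus_measure (\<lambda>x. b n * cis (2 * pi * of_int (int n - int m) * x))) sums
       (integral\<^sup>L torus_measure (\<lambda>x. \<Sum>n. b n * cis (2 * pi * of_int (int n - int m) * x)))"
      by (rule sums_integral_torus(1)[where B="\<lambda>n. norm (b n)" and g="\<lambda>_. 1"])
         (auto simp: norm_mult b intro!: borel_measurable_times cism)
    moreover have "integral\<^sup>L torus_measure (\<lambda>x. b n * cis (2 * pi * of_int (int n - int m) * x)) = (if n = m then b m else 0)" for n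
      by (subst integral_mult_right_zero, subst integral_cis_torus) auto
    ultimately have "(\<lambda>n. if n = m then b m else 0) sums (integral\<^sup>L torus_measure (\<lambda>x. G x * cnj (cis (2 * pi * real m * x))))"
      by (simp only: eq)
    then show ?thesis
      using sums_single[of m "\<lambda>_. b m"] by (metis (mono_tags, lifting) sums_cong sums_unique2)
  qed
  have "(\<lambda>n. integral\<^sup>L torus_measure (\<lambda>x. cnj (b n) * (G x * cnj (cis (2 * pi * real n * x))))) sums
      (integral\<^sup>L torus_measure (\<lambda>x. \<Sum>n. cnj (b n) * (G x * cnj (cis (2 * pi * real n * x)))))"
  proof (rule sums_integral_torus(1)[where B="\<lambda>n. norm (b n)" and g="\<lambda>_. C"])
    show "(\<lambda>x. cnj (b n) * (G x * cnj (cis (2 * pi * real n * x)))) \<in> borel_measurable torus_measure" for n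
      unfolding cis_cnj using borel_measurable_integrable[OF Gint] cism[of "- (2 * pi * real n)"]
      by (intro borel_measurable_times) auto
  qed (auto simp: norm_mult b GC mult_left_mono)
  moreover have "integral\<^sup>L torus_measure (\<lambda>x. cnj (b n) * (G x * cnj (cis (2 * pi * real n * x)))) = of_real ((norm (b n))\<^sup>2)" for n
    by (subst integral_mult_right_zero, subst coeff) (simp only: complex_norm_square mult.commute)
  ultimately have "(\<lambda>n. of_real ((norm (b n))\<^sup>2)) sums
      (integral\<^sup>L torus_measure (\<lambda>x. \<Sum>n. cnj (b n) * (G x * cnj (cis (2 * pi * real n * x)))))"
    by (simp only:)
  also have "(\<lambda>x. \<Sum>n. cnj (b n) * (G x * cnj (cis (2 * pi * real n * x)))) = (\<lambda>x. of_real ((norm (G x))\<^sup>2))"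
  proof
    fix x
    have s: "(\<lambda>n. b n * cis (2 * pi * real n * x)) sums G x"
      unfolding G_def by (rule summable_sums, rule summable_norm_cancel) (use b in \<open>simp add: norm_mult\<close>)
    have "(\<lambda>n. G x * cnj (b n * cis (2 * pi * real n * x))) sums (G x * cnj (G x))"
      by (intro sums_mult) (use s in \<open>simp only: sums_cnj\<close>)
    from sums_unique[OF this]
    have "(\<Sum>n. G x * cnj (b n * cis (2 * pi * real n * x))) = of_real ((norm (G x))\<^sup>2)"
      by (simp only: complex_norm_square)
    then show "(\<Sum>n. cnj (b n) * (G x * cnj (cis (2 * pi * real n * x)))) = of_real ((norm (G x))\<^sup>2)"
      by (simp only: complex_cnj_mult mult.left_commute)
  qed
  finally show ?thesis
    unfolding G_def integral_complex_of_real sums_of_real_iff .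
qed

text \<open>\<open>D\<close> is the coefficient sequence of the exponential of the series with terms
  \<open>k * |a_k|^2 * z^k\<close>. Cauchy-Schwarz on the \<open>m + 1\<close> terms of the
  recurrence costs a factor \<open>m + 1\<close>, which is one of the two such factors on the
  squared left side; what remains is the recurrence of \<open>D\<close>.\<close>

lemma lebedev_milin_coefficient_le:
  fixes a b :: "nat \<Rightarrow> complex" and D :: "nat \<Rightarrow> real"
  assumes b0: "b 0 = 1" and D0: "D 0 = 1"
    and b: "\<And>n. of_nat (Suc n) * b (Suc n) = (\<Sum>i\<le>n. of_nat (Suc i) * a (Suc i) * b (n - i))"
    and D: "\<And>n. real (Suc n) * D (Suc n) = (\<Sum>i\<le>n. (real (Suc i) * norm (a (Suc i)))\<^sup>2 * D (n - i))"
  shows "(norm (b n))\<^sup>2 \<le> D n"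
proof (induction n rule: less_induct)
  case (less n)
  show ?case
  proof (cases n)
    case 0
    then show ?thesis by (simp add: b0 D0)
  next
    case (Suc m)
    have "real (Suc m) * norm (b (Suc m)) = norm (of_nat (Suc m) * b (Suc m))"
      by (simp only: norm_mult norm_of_nat)
    also have "\<dots> \<le> (\<Sum>i\<le>m. real (Suc i) * norm (a (Suc i)) * norm (b (m - i)))"
      unfolding b by (rule order_trans[OF norm_sum]) (simp only: norm_mult norm_of_nat order_refl)
    finally have "(real (Suc m) * norm (b (Suc m)))\<^sup>2 \<le> (\<Sum>i\<le>m. real (Suc i) * norm (a (Suc i)) * norm (b (m - i)))\<^sup>2"
      by (intro power_mono) auto
    also have "\<dots> \<le> (\<Sum>i\<le>m. (real (Suc i) * norm (a (Suc i)) * norm (b (m - i)))\<^sup>2) * real (card {..m})"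
      by (rule sum_squared_le_sum_of_squares)
    also have "\<dots> \<le> (\<Sum>i\<le>m. (real (Suc i) * norm (a (Suc i)))\<^sup>2 * D (m - i)) * real (card {..m})"
      using less.IH Suc
      by (intro mult_right_mono sum_mono) (auto simp: power_mult_distrib intro!: mult_left_mono)
    also have "\<dots> = (real (Suc m))\<^sup>2 * D (Suc m)"
      unfolding D[symmetric] by (simp add: power2_eq_square)
    finally have "(real (Suc m))\<^sup>2 * (norm (b (Suc m)))\<^sup>2 \<le> (real (Suc m))\<^sup>2 * D (Suc m)"
      by (simp only: power_mult_distrib)
    then show ?thesis
      using Suc by (simp only: mult_le_cancel_left_pos zero_less_power of_nat_0_less_iff zero_less_Suc)
  qed
qed

text \<open>With \<open>a 3 = 0\<close> the recurrence for \<open>3 * b 3\<close> has only two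
  terms, so Cauchy-Schwarz costs a factor 2 where equality would require 3. This forces
  \<open>D 3 = 0\<close>.\<close>

lemma lebedev_milin_equality_degree_two:
  fixes a b :: "nat \<Rightarrow> complex" and D :: "nat \<Rightarrow> real"
  assumes b0: "b 0 = 1" and D0: "D 0 = 1"
    and b: "\<And>n. of_nat (Suc n) * b (Suc n) = (\<Sum>i\<le>n. of_nat (Suc i) * a (Suc i) * b (n - i))"
    and D: "\<And>n. real (Suc n) * D (Suc n) = (\<Sum>i\<le>n. (real (Suc i) * norm (a (Suc i)))\<^sup>2 * D (n - i))"
    and eq: "\<And>n. (norm (b n))\<^sup>2 = D n" and a3: "a 3 = 0"
  shows "a 1 = 0 \<and> a 2 = 0"
proof -
  have b1: "b 1 = a 1" using b[of 0] by (simp add: b0)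
  have D1: "D 1 = (norm (a 1))\<^sup>2" using D[of 0] by (simp add: D0)
  have b2: "2 * b 2 = a 1 * a 1 + 2 * a 2"
    using b[of 1] b1 by (simp add: b0 numeral_2_eq_2)
  have D2: "2 * D 2 = (norm (a 1))\<^sup>2 * (norm (a 1))\<^sup>2 + 4 * (norm (a 2))\<^sup>2"
    using D[of 1] D1 by (simp add: D0 numeral_2_eq_2 power_mult_distrib)
  have b3: "3 * b 3 = a 1 * b 2 + 2 * a 2 * b 1"
    using b[of 2] a3 by (simp add: b0 eval_nat_numeral)
  have D3: "3 * D 3 = (norm (a 1))\<^sup>2 * D 2 + 4 * (norm (a 2))\<^sup>2 * D 1"
    using D[of 2] a3 by (simp add: D0 eval_nat_numeral power_mult_distrib)
  have "3 * norm (b 3) = norm (3 * b 3)" by (simp add: norm_mult)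
  also have "\<dots> \<le> norm (a 1) * norm (b 2) + 2 * norm (a 2) * norm (b 1)"
    unfolding b3 by (rule order_trans[OF norm_triangle_ineq]) (simp add: norm_mult)
  finally have "(3 * norm (b 3))\<^sup>2 \<le> (norm (a 1) * norm (b 2) + 2 * norm (a 2) * norm (b 1))\<^sup>2"
    by (intro power_mono) auto
  also have "\<dots> \<le> 2 * ((norm (a 1) * norm (b 2))\<^sup>2 + (2 * norm (a 2) * norm (b 1))\<^sup>2)"
    using sum_squares_bound[of "norm (a 1) * norm (b 2)" "2 * norm (a 2) * norm (b 1)"]
    by (simp add: power2_sum)
  also have "\<dots> = 2 * (3 * D 3)"
    unfolding D3 power_mult_distrib eq by simp
  finally have "9 * D 3 \<le> 6 * D 3"
    by (simp add: power_mult_distrib eq)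
  then have "D 3 = 0" using eq[of 3] zero_le_power2[of "norm (b 3)"] by linarith
  moreover have "0 \<le> 4 * (norm (a 2))\<^sup>2 * D 1" unfolding D1 by simp
  \<comment> \<open>\<open>3 * D 3\<close> dominates half the sixth power of
    \<open>norm (a 1)\<close>, so \<open>a 1\<close> vanishes.\<close>
  moreover have "(norm (a 1))\<^sup>2 * (norm (a 1))\<^sup>2 * (norm (a 1))\<^sup>2 \<le> 2 * ((norm (a 1))\<^sup>2 * D 2)"
  proof -
    have "(norm (a 1))\<^sup>2 * (norm (a 1))\<^sup>2 \<le> 2 * D 2" unfolding D2 by simp
    from mult_left_mono[OF this, of "(norm (a 1))\<^sup>2"] show ?thesis
      by (simp only: mult_ac) simp
  qed
  ultimately have "(norm (a 1))\<^sup>2 * (norm (a 1))\<^sup>2 * (norm (a 1))\<^sup>2 \<le> 0" using D3 by linarith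
  then have a1: "a 1 = 0"
    by (metis mult_eq_0_iff norm_eq_zero power2_eq_square zero_le_mult_iff zero_le_power2 antisym)
  then have "b 2 = a 2" using b2 by simp
  \<comment> \<open>Now \<open>D 2\<close> is twice the square of \<open>norm (a 2)\<close> while
    \<open>b 2 = a 2\<close>, so equality leaves only zero.\<close>
  then have "a 2 = 0" using D2 a1 eq[of 2] by simp
  then show ?thesis using a1 by simp
qed

text \<open>At \<open>z = cis (2 * pi * x)\<close> the integrand is the squared modulus of the
  exponential of the polynomial. Parseval turns \<open>L\<close> into a sum of squared coefficients,
  and the comparison series at \<open>z = 1\<close> sums to the right side. Equality of the two sums
  forces equality of every pair of terms.\<close>

lemma lebedev_milin:
  fixes a :: "nat \<Rightarrow> complex"
  assumes a: "\<And>k. N < k \<Longrightarrow> a k = 0"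
  defines "L \<equiv> integral\<^sup>L torus_measure (\<lambda>x. exp (2 * Re (\<Sum>k=1..N. a k * cis (2 * pi * real k * x))))"
  shows "L \<le> exp (\<Sum>k=1..N. real k * (norm (a k))\<^sup>2)"
    and "N \<le> 2 \<Longrightarrow> L = exp (\<Sum>k=1..N. real k * (norm (a k))\<^sup>2) \<Longrightarrow> a 1 = 0 \<and> a 2 = 0"
proof -
  obtain b where b0: "b 0 = 1"
    and b: "\<And>n. of_nat (Suc n) * b (Suc n) = (\<Sum>i\<le>n. of_nat (Suc i) * a (Suc i) * b (n - i))"
    and bs: "\<And>z. (\<lambda>n. b n * z ^ n) sums exp (\<Sum>k=1..N. a k * z ^ k)"
    and bn: "summable (\<lambda>n. norm (b n))"
    using exp_polynomial_series[of N a, OF a] by blast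
  \<comment> \<open>Exponent of the comparison series. The power series lemma is complex, so
    \<open>D\<close> is obtained as a real part.\<close>
  define \<alpha> :: "nat \<Rightarrow> complex" where "\<alpha> k = of_real (real k * (norm (a k))\<^sup>2)" for k
  have \<alpha>: "\<alpha> k = 0" if "N < k" for k using a[OF that] by (simp add: \<alpha>_def)
  obtain d where d0: "d 0 = 1"
    and d: "\<And>n. of_nat (Suc n) * d (Suc n) = (\<Sum>i\<le>n. of_nat (Suc i) * \<alpha> (Suc i) * d (n - i))"
    and ds: "\<And>z. (\<lambda>n. d n * z ^ n) sums exp (\<Sum>k=1..N. \<alpha> k * z ^ k)"
    using exp_polynomial_series[of N \<alpha>, OF \<alpha>] by blast
  define D where "D n = Re (d n)" for n
  have D0: "D 0 = 1" by (simp add: D_def d0)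
  have D: "real (Suc n) * D (Suc n) = (\<Sum>i\<le>n. (real (Suc i) * norm (a (Suc i)))\<^sup>2 * D (n - i))" for n
  proof -
    have "real (Suc n) * D (Suc n) = Re (of_nat (Suc n) * d (Suc n))"
      by (simp add: D_def del: of_nat_Suc)
    also have "\<dots> = (\<Sum>i\<le>n. Re (of_real ((real (Suc i) * norm (a (Suc i)))\<^sup>2) * d (n - i)))"
      unfolding d Re_sum
      by (intro sum.cong refl arg_cong[of _ _ Re]) (simp add: \<alpha>_def power2_eq_square algebra_simps)
    also have "\<dots> = (\<Sum>i\<le>n. (real (Suc i) * norm (a (Suc i)))\<^sup>2 * D (n - i))"
      unfolding D_def by (intro sum.cong refl) (simp del: of_nat_Suc of_real_power)
    finally show ?thesis .
  qed
  have "(\<lambda>n. Re (d n)) sums Re (exp (\<Sum>k=1..N. \<alpha> k))"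
    using ds[of 1] by (intro sums_Re) simp
  also have "(\<Sum>k=1..N. \<alpha> k) = of_real (\<Sum>k=1..N. real k * (norm (a k))\<^sup>2)"
    by (simp add: \<alpha>_def)
  finally have Ds: "D sums exp (\<Sum>k=1..N. real k * (norm (a k))\<^sup>2)"
    unfolding D_def[symmetric] by (simp only: exp_of_real Re_complex_of_real)
  have "(norm (\<Sum>n. b n * cis (2 * pi * real n * x)))\<^sup>2 = exp (2 * Re (\<Sum>k=1..N. a k * cis (2 * pi * real k * x)))" for x
  proof -
    have cis: "cis (2 * pi * real n * x) = cis (2 * pi * x) ^ n" for n
      by (subst Complex.DeMoivre) (simp add: mult_ac)
    have "(\<Sum>n. b n * cis (2 * pi * real n * x)) = exp (\<Sum>k=1..N. a k * cis (2 * pi * real k * x))"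
      using bs[of "cis (2 * pi * x)"] by (simp only: sums_iff cis)
    then show ?thesis by (simp add: exp_double)
  qed
  then have L: "(\<lambda>n. (norm (b n))\<^sup>2) sums L"
    using parseval_torus[OF bn] by (simp add: L_def)
  have le: "(norm (b n))\<^sup>2 \<le> D n" for n
    by (rule lebedev_milin_coefficient_le[OF b0 D0 b D])
  show "L \<le> exp (\<Sum>k=1..N. real k * (norm (a k))\<^sup>2)"
    by (rule sums_le[OF le L Ds])
  assume N: "N \<le> 2" and eq: "L = exp (\<Sum>k=1..N. real k * (norm (a k))\<^sup>2)"
  have "(\<lambda>n. D n - (norm (b n))\<^sup>2) sums 0"
    using sums_diff[OF Ds L] eq by simp
  then have "(norm (b n))\<^sup>2 = D n" for n
    using le suminf_eq_zero_iff[of "\<lambda>n. D n - (norm (b n))\<^sup>2"] by (simp add: sums_iff)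
  then show "a 1 = 0 \<and> a 2 = 0"
    by (intro lebedev_milin_equality_degree_two[OF b0 D0 b D] a) (use N in auto)
qed

section \<open>Entropy and Fourier coefficients\<close>

definition ent :: "(real \<Rightarrow> real) \<Rightarrow> real" where
  "ent q = integral\<^sup>L torus_measure (\<lambda>x. q x * ln (q x))"

text \<open>\<open>ent\<close> takes the default value \<open>0\<close> when its integrand is not
  integrable; \<open>fin_ent\<close> singles out the densities on which it is the true
  entropy.\<close>

definition fin_ent :: "(real \<Rightarrow> real) \<Rightarrow> bool" where
  "fin_ent q \<longleftrightarrow> q \<in> densities \<and> integrable torus_measure (\<lambda>x. q x * ln (q x))"

lemma fin_entD:
  assumes "fin_ent q"
  shows "q \<in> densities" "integrable torus_measure q" "integral\<^sup>L torus_measure q = 1"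
    "integrable torus_measure (\<lambda>x. q x * ln (q x))" "\<And>x. x \<in> torus \<Longrightarrow> 0 \<le> q x"
  using assms by (auto simp: fin_ent_def densities_def)

text \<open>From \<open>ln t \<le> t - 1\<close> at \<open>t = y / x\<close>. The value
  \<open>x = 0\<close> is included because densities may vanish.\<close>

lemma mult_ln_diff_ge:
  fixes x y :: real
  assumes "0 \<le> x" "0 < y"
  shows "x - y \<le> x * ln x - x * ln y" and "x * ln x - x * ln y = x - y \<Longrightarrow> x = y"
proof -
  have *: "x - y \<le> x * ln x - x * ln y \<and> (x * ln x - x * ln y = x - y \<longrightarrow> x = y)"
  proof (cases "x = 0")
    case True then show ?thesis using assms by simp
  next
    case False
    then have x: "0 < x" using assms by simp
    have e: "x * ln x - x * ln y = - x * ln (y / x)" 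
      using x assms by (simp add: ln_div algebra_simps)
    have "ln (y / x) \<le> y / x - 1" using x assms by (intro ln_le_minus_one) auto
    from mult_left_mono[OF this, of x] have 1: "x * ln (y / x) \<le> y - x"
      using x by (simp add: algebra_simps)
    moreover have "y = x" if "x * ln (y / x) = y - x"
    proof -
      have "ln (y / x) = y / x - 1" using that x by (simp add: field_simps)
      then have "y / x = 1" using x assms by (intro ln_eq_minus_one) auto
      then show ?thesis using x by simp
    qed
    ultimately show ?thesis unfolding e by auto
  qed
  show "x - y \<le> x * ln x - x * ln y" and "x * ln x - x * ln y = x - y \<Longrightarrow> x = y"
    using * by auto
qed

text \<open>Gibbs variational principle: the gap in the inequality is the relative entropy of
  \<open>q\<close> with respect to the density \<open>exp (f x) / Z\<close>, which is nonnegative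
  and vanishes only at that density.\<close>

lemma gibbs:
  fixes f q :: "real \<Rightarrow> real"
  assumes q: "fin_ent q" and f: "f \<in> borel_measurable torus_measure" and C: "\<And>x. x \<in> torus \<Longrightarrow> \<bar>f x\<bar> \<le> C"
  defines "Z \<equiv> integral\<^sup>L torus_measure (\<lambda>x. exp (f x))"
  shows "0 < Z"
    and "integral\<^sup>L torus_measure (\<lambda>x. f x * q x) - ln Z \<le> ent q"
    and "ent q = integral\<^sup>L torus_measure (\<lambda>x. f x * q x) - ln Z \<Longrightarrow> AE x in torus_measure. q x = exp (f x) / Z"
proof -
  note q' = fin_entD[OF q]
  have expm: "(\<lambda>x. exp (f x)) \<in> borel_measurable torus_measure" using f by simp
  have expi: "integrable torus_measure (\<lambda>x. exp (f x))"
    using expm C by (intro integrable_torus_bounded[where C="exp C"]) (force simp: abs_le_iff)+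
  have "integral\<^sup>L torus_measure (\<lambda>x. exp (- C)) \<le> Z" unfolding Z_def
    using C expi by (intro integral_mono) (force simp: abs_le_iff)+
  then show Z: "0 < Z" using exp_gt_zero[of "-C"] by (simp del: exp_gt_zero)
  have fq: "integrable torus_measure (\<lambda>x. f x * q x)"
    by (rule integrable_torus_mult[OF f C]) (auto simp: q')
  \<comment> \<open>The last bracket integrates to zero; subtracting it makes the relative entropy
    integrand nonnegative pointwise.\<close>
  define g where "g x = q x * ln (q x) - (f x * q x - ln Z * q x) - (q x - exp (f x) / Z)" for x
  have gi: "integrable torus_measure g"
    unfolding g_def using q' fq expi by (intro Bochner_Integration.integrable_diff integrable_divide integrable_mult_right) auto
  have gI: "integral\<^sup>L torus_measure g = ent q - (integral\<^sup>L torus_measure (\<lambda>x. f x * q x) - ln Z)"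
    unfolding g_def ent_def using q' fq expi Z by (simp add: Z_def[symmetric])
  have g: "0 \<le> g x" "g x = 0 \<Longrightarrow> q x = exp (f x) / Z" if "x \<in> torus" for x
  proof -
    have e: "q x * ln (exp (f x) / Z) = f x * q x - ln Z * q x"
      using Z by (simp add: ln_div algebra_simps)
    note m = mult_ln_diff_ge[OF q'(5)[OF that], of "exp (f x) / Z", unfolded e]
    show "0 \<le> g x" using m(1) Z unfolding g_def by simp
    show "q x = exp (f x) / Z" if "g x = 0"
      using m(2) Z that unfolding g_def by simp
  qed
  have "0 \<le> integral\<^sup>L torus_measure g" by (rule integral_nonneg_AE, rule AE_I2) (simp add: g)
  then show "integral\<^sup>L torus_measure (\<lambda>x. f x * q x) - ln Z \<le> ent q" using gI by simp
  assume "ent q = integral\<^sup>L torus_measure (\<lambda>x. f x * q x) - ln Z"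
  then have "integral\<^sup>L torus_measure g = 0" using gI by simp
  then have "AE x in torus_measure. g x = 0"
    using integral_nonneg_eq_0_iff_AE[OF gi AE_I2] g(1) by simp
  moreover have "AE x in torus_measure. x \<in> torus" by (rule AE_I2) simp
  ultimately show "AE x in torus_measure. q x = exp (f x) / Z"
    by eventually_elim (use g in auto)
qed

lemma q_unif_fin_ent: "fin_ent q_unif" and ent_q_unif: "ent q_unif = 0"
  by (auto simp: fin_ent_def densities_def q_unif_def ent_def)

text \<open>The Gibbs principle with zero exponent, where \<open>Z = 1\<close>: entropy is relative
  entropy with respect to the uniform density.\<close>

lemma ent_nonneg: "fin_ent q \<Longrightarrow> 0 \<le> ent q"
  and ent_eq_0: "fin_ent q \<Longrightarrow> ent q = 0 \<Longrightarrow> same_measure q q_unif"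
  using gibbs[of q "\<lambda>_. 0" 0] by (auto simp: same_measure_def q_unif_def)

text \<open>\<open>cosc q k - \<i> * sinc q k\<close> is the \<open>k\<close>-th Fourier
  coefficient; splitting it keeps the later sums real.\<close>

definition cosc :: "(real \<Rightarrow> real) \<Rightarrow> nat \<Rightarrow> real" where
  "cosc q k = integral\<^sup>L torus_measure (\<lambda>x. cos (2 * pi * real k * x) * q x)"
definition sinc :: "(real \<Rightarrow> real) \<Rightarrow> nat \<Rightarrow> real" where
  "sinc q k = integral\<^sup>L torus_measure (\<lambda>x. sin (2 * pi * real k * x) * q x)"

lemma cos_measurable [measurable]: "(\<lambda>x. cos (c * x)) \<in> borel_measurable torus_measure"
  by (rule torus_measurable_cont) (intro continuous_intros)
lemma sin_measurable [measurable]: "(\<lambda>x. sin (c * x)) \<in> borel_measurable torus_measure"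
  by (rule torus_measurable_cont) (intro continuous_intros)

lemma integrable_cos_mult: "integrable torus_measure q \<Longrightarrow> integrable torus_measure (\<lambda>x. cos (c * x) * q x)"
  by (rule integrable_torus_mult[where C=1]) auto
lemma integrable_sin_mult: "integrable torus_measure q \<Longrightarrow> integrable torus_measure (\<lambda>x. sin (c * x) * q x)"
  by (rule integrable_torus_mult[where C=1]) auto

lemma abs_cosc_le: "integrable torus_measure q \<Longrightarrow> \<bar>cosc q k\<bar> \<le> integral\<^sup>L torus_measure (\<lambda>x. \<bar>q x\<bar>)"
  unfolding cosc_def
  by (rule order_trans[OF integral_abs_bound])
     (intro integral_mono integrable_abs integrable_cos_mult; simp add: abs_mult mult_left_le_one_le)

lemma abs_sinc_le: "integrable torus_measure q \<Longrightarrow> \<bar>sinc q k\<bar> \<le> integral\<^sup>L torus_measure (\<lambda>x. \<bar>q x\<bar>)"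
  unfolding sinc_def
  by (rule order_trans[OF integral_abs_bound])
     (intro integral_mono integrable_abs integrable_sin_mult; simp add: abs_mult mult_left_le_one_le)

lemma cosc_0: "q \<in> densities \<Longrightarrow> cosc q 0 = 1" and sinc_0: "sinc q 0 = 0"
  by (auto simp: cosc_def sinc_def densities_def)

lemma cosc_q_unif: "cosc q_unif k = (if k = 0 then 1 else 0)" and sinc_q_unif: "sinc q_unif k = 0"
  by (simp_all add: cosc_def sinc_def q_unif_def integral_cos_torus integral_sin_torus)

text \<open>This is the sharp logarithmic Hardy-Littlewood-Sobolev inequality on the circle; it is
  Legendre dual to the Lebedev-Milin inequality.\<close>
lemma entropy_ge_sum_fourier:
  assumes q: "fin_ent q"
  shows "(\<Sum>k=1..N. ((cosc q k)\<^sup>2 + (sinc q k)\<^sup>2) / real k) \<le> ent q"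
    and "N = 2 \<Longrightarrow> ent q = (\<Sum>k=1..N. ((cosc q k)\<^sup>2 + (sinc q k)\<^sup>2) / real k) \<Longrightarrow>
      cosc q 1 = 0 \<and> sinc q 1 = 0 \<and> cosc q 2 = 0 \<and> sinc q 2 = 0"
proof -
  note q' = fin_entD[OF q]
  \<comment> \<open>Legendre duality: the Fourier coefficient divided by \<open>k\<close> is the
    choice of \<open>a k\<close> that maximises the linear pairing with \<open>q\<close> minus the
    Lebedev-Milin bound. The pairing is then \<open>2 * S\<close>, and
    \<open>ln Z \<le> S\<close>.\<close>
  define a where "a k = (if k \<in> {1..N} then Complex (cosc q k) (- sinc q k) / of_nat k else 0)" for k
  define f where "f x = 2 * Re (\<Sum>k=1..N. a k * cis (2 * pi * real k * x))" for x
  have na: "(norm (a k))\<^sup>2 = ((cosc q k)\<^sup>2 + (sinc q k)\<^sup>2) / (real k)\<^sup>2" if "k \<in> {1..N}" for k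
    using that by (simp add: a_def norm_divide power_divide cmod_def add_divide_distrib)
  define S where "S = (\<Sum>k=1..N. ((cosc q k)\<^sup>2 + (sinc q k)\<^sup>2) / real k)"
  have S: "(\<Sum>k=1..N. real k * (norm (a k))\<^sup>2) = S"
    unfolding S_def by (intro sum.cong refl, subst na) (auto simp: power2_eq_square field_simps)
  have f: "f x = (\<Sum>k=1..N. 2 / real k * (cosc q k * cos (2 * pi * real k * x) + sinc q k * sin (2 * pi * real k * x)))" for x
    unfolding f_def Re_sum sum_distrib_left
    by (intro sum.cong refl) (simp add: a_def Re_divide_of_nat field_simps)
  have fm: "f \<in> borel_measurable torus_measure"
    unfolding f by measurable
  have "\<bar>f x\<bar> \<le> (\<Sum>k=1..N. 2 / real k * (\<bar>cosc q k\<bar> + \<bar>sinc q k\<bar>))" for x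
    unfolding f
  proof (intro order_trans[OF sum_abs] sum_mono)
    fix k
    have "\<bar>cosc q k * cos (2 * pi * real k * x) + sinc q k * sin (2 * pi * real k * x)\<bar>
      \<le> \<bar>cosc q k\<bar> * \<bar>cos (2 * pi * real k * x)\<bar> + \<bar>sinc q k\<bar> * \<bar>sin (2 * pi * real k * x)\<bar>"
      by (rule order_trans[OF abs_triangle_ineq]) (simp add: abs_mult)
    also have "\<dots> \<le> \<bar>cosc q k\<bar> + \<bar>sinc q k\<bar>"
      by (intro add_mono mult_left_le) auto
    finally show "\<bar>2 / real k * (cosc q k * cos (2 * pi * real k * x) + sinc q k * sin (2 * pi * real k * x))\<bar>
       \<le> 2 / real k * (\<bar>cosc q k\<bar> + \<bar>sinc q k\<bar>)"
      unfolding abs_mult by (intro mult_mono) auto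
  qed
  note G = gibbs[OF q fm this]
  have "integral\<^sup>L torus_measure (\<lambda>x. f x * q x)
      = integral\<^sup>L torus_measure (\<lambda>x. \<Sum>k=1..N. 2 / real k * (cosc q k * (cos (2 * pi * real k * x) * q x) + sinc q k * (sin (2 * pi * real k * x) * q x)))"
    unfolding f sum_distrib_right by (intro Bochner_Integration.integral_cong sum.cong refl) (simp add: algebra_simps)
  also have "\<dots> = (\<Sum>k=1..N. 2 / real k * (cosc q k * cosc q k + sinc q k * sinc q k))"
    using q' by (simp add: integrable_cos_mult integrable_sin_mult cosc_def sinc_def)
  also have "\<dots> = 2 * S"
    unfolding S_def sum_distrib_left by (intro sum.cong refl) (simp add: power2_eq_square)
  finally have fq: "integral\<^sup>L torus_measure (\<lambda>x. f x * q x) = 2 * S" .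
  have a0: "a k = 0" if "N < k" for k using that by (simp add: a_def)
  define Z where "Z = integral\<^sup>L torus_measure (\<lambda>x. exp (f x))"
  note LM = lebedev_milin[where N=N and a=a, OF a0, folded f_def, unfolded S, folded Z_def]
  note G = G[folded Z_def, unfolded fq]
  have "ln Z \<le> S" using LM(1) G(1) ln_le_cancel_iff[of Z "exp S"] by simp
  then show "S \<le> ent q" using G(2) by simp
  assume N: "N = 2" and "ent q = S"
  \<comment> \<open>Equality in the entropy bound squeezes \<open>ln Z\<close> up to
    \<open>S\<close>, which is equality in the Lebedev-Milin inequality of degree two.\<close>
  then have "ln Z = S" using G(2) \<open>ln Z \<le> S\<close> by simp
  then have "Z = exp S" using exp_ln[OF G(1)] by simp
  then have "a 1 = 0 \<and> a 2 = 0" using LM(2) N by simp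
  then show "cosc q 1 = 0 \<and> sinc q 1 = 0 \<and> cosc q 2 = 0 \<and> sinc q 2 = 0"
    using N by (simp add: a_def complex_eq_iff Re_divide_of_nat Im_divide_of_nat)
qed

section \<open>Positive definite interactions\<close>

lemma densitiesD:
  assumes "q \<in> densities"
  shows "integrable torus_measure q" "integral\<^sup>L torus_measure q = 1" "\<And>x. x \<in> torus \<Longrightarrow> 0 \<le> q x"
    "q \<in> borel_measurable torus_measure" "integral\<^sup>L torus_measure (\<lambda>x. \<bar>q x\<bar>) = 1"
proof -
  show *: "integrable torus_measure q" "integral\<^sup>L torus_measure q = 1" "\<And>x. x \<in> torus \<Longrightarrow> 0 \<le> q x"
    "q \<in> borel_measurable torus_measure"
    using assms by (auto simp: densities_def)
  have "integral\<^sup>L torus_measure (\<lambda>x. \<bar>q x\<bar>) = integral\<^sup>L torus_measure q"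
    by (rule Bochner_Integration.integral_cong) (use *(3) in auto)
  then show "integral\<^sup>L torus_measure (\<lambda>x. \<bar>q x\<bar>) = 1" using * by simp
qed

text \<open>With \<open>w 0\<close> the mean of \<open>W\<close> and \<open>w k\<close> twice its \<open>k\<close>-th Fourier coefficient
  for \<open>k \<ge> 1\<close>.\<close>
locale cosine_kernel =
  fixes W :: "real \<Rightarrow> real" and w :: "nat \<Rightarrow> real"
  assumes w_nonneg: "\<And>k. 0 \<le> w k" and w_summable: "summable w"
    and W_eq: "\<And>x. W x = (\<Sum>k. w k * cos (2 * pi * real k * x))"
begin

definition conv :: "(real \<Rightarrow> real) \<Rightarrow> real \<Rightarrow> real" where
  "conv q x = integral\<^sup>L torus_measure (\<lambda>y. W (x - y) * q y)"

text \<open>The double integral of \<open>W (x - y) * p x * q y\<close> in Fourier form, as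
  \<open>integral_conv\<close> confirms.\<close>

definition bil :: "(real \<Rightarrow> real) \<Rightarrow> (real \<Rightarrow> real) \<Rightarrow> real" where
  "bil p q = (\<Sum>k. w k * (cosc p k * cosc q k + sinc p k * sinc q k))"

definition w_sum :: real where "w_sum = (\<Sum>k. w k)"

lemma W_summable: "summable (\<lambda>k. w k * cos (2 * pi * real k * x))"
proof (rule summable_comparison_test'[OF w_summable, of 0])
  fix k show "norm (w k * cos (2 * pi * real k * x)) \<le> w k"
    using w_nonneg[of k] by (simp add: abs_mult mult_left_le)
qed

lemma W_continuous: "continuous_on UNIV W"
proof -
  have "uniform_limit UNIV (\<lambda>n x. \<Sum>k<n. w k * cos (2 * pi * real k * x)) (\<lambda>x. \<Sum>k. w k * cos (2 * pi * real k * x)) sequentially"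
  proof (rule Weierstrass_m_test[OF _ w_summable])
    fix k :: nat and x :: real show "norm (w k * cos (2 * pi * real k * x)) \<le> w k"
      using w_nonneg[of k] by (simp add: abs_mult mult_left_le)
  qed
  then have "continuous_on UNIV (\<lambda>x. \<Sum>k. w k * cos (2 * pi * real k * x))"
    by (rule uniform_limit_theorem[rotated]) (auto intro!: always_eventually continuous_intros)
  then show ?thesis by (simp add: W_eq[abs_def])
qed

lemma abs_W_le: "\<bar>W x\<bar> \<le> w_sum"
proof -
  have *: "norm (w k * cos (2 * pi * real k * x)) \<le> w k" for k
    using w_nonneg[of k] by (simp add: abs_mult mult_left_le)
  show ?thesis
    using suminf_le[OF * summable_comparison_test'[OF w_summable, of 0] w_summable]
      summable_norm[OF summable_comparison_test'[OF w_summable, of 0], of "\<lambda>k. w k * cos (2 * pi * real k * x)"] *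
    unfolding W_eq w_sum_def by force
qed

lemma W_shift_measurable: "(\<lambda>y. W (x - y)) \<in> borel_measurable torus_measure"
  by (rule torus_measurable_cont)
     (rule continuous_on_compose2[OF W_continuous], auto intro!: continuous_intros)

lemma conv_integrable: "integrable torus_measure q \<Longrightarrow> integrable torus_measure (\<lambda>y. W (x - y) * q y)"
  by (rule integrable_torus_mult[OF W_shift_measurable, of _ w_sum]) (auto simp: abs_W_le)

lemma conv_sums:
  assumes q: "integrable torus_measure q"
  shows "(\<lambda>k. w k * (cos (2 * pi * real k * x) * cosc q k + sin (2 * pi * real k * x) * sinc q k)) sums conv q x"
proof -
  let ?\<phi> = "\<lambda>k y. w k * cos (2 * pi * real k * (x - y)) * q y"
  have "(\<lambda>k. integral\<^sup>L torus_measure (?\<phi> k)) sums (integral\<^sup>L torus_measure (\<lambda>y. \<Sum>k. ?\<phi> k y))"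
  proof (rule sums_integral_torus(1)[where B=w and g="\<lambda>y. \<bar>q y\<bar>"])
    show "?\<phi> k \<in> borel_measurable torus_measure" for k
      by (rule borel_measurable_times[OF torus_measurable_cont borel_measurable_integrable[OF q]])
         (intro continuous_intros)
    show "norm (?\<phi> k y) \<le> w k * \<bar>q y\<bar>" for k y
      using w_nonneg[of k] by (simp add: abs_mult mult_left_le mult_right_mono)
  qed (use q w_summable in auto)
  also have "(\<lambda>y. \<Sum>k. ?\<phi> k y) = (\<lambda>y. W (x - y) * q y)"
    unfolding W_eq using W_summable by (simp add: suminf_mult2)
  also have "(\<lambda>k. integral\<^sup>L torus_measure (?\<phi> k)) = (\<lambda>k. w k * (cos (2 * pi * real k * x) * cosc q k + sin (2 * pi * real k * x) * sinc q k))"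
  proof
    fix k
    have "integral\<^sup>L torus_measure (?\<phi> k) = integral\<^sup>L torus_measure (\<lambda>y. w k * (cos (2 * pi * real k * x) * (cos (2 * pi * real k * y) * q y) + sin (2 * pi * real k * x) * (sin (2 * pi * real k * y) * q y)))"
      by (intro Bochner_Integration.integral_cong refl) (simp add: right_diff_distrib cos_diff algebra_simps)
    also have "\<dots> = w k * (cos (2 * pi * real k * x) * cosc q k + sin (2 * pi * real k * x) * sinc q k)"
      using q by (simp add: integrable_cos_mult integrable_sin_mult cosc_def sinc_def)
    finally show "integral\<^sup>L torus_measure (?\<phi> k) = w k * (cos (2 * pi * real k * x) * cosc q k + sin (2 * pi * real k * x) * sinc q k)" .
  qed
  finally show ?thesis unfolding conv_def .
qed

lemma abs_conv_le:
  assumes q: "integrable torus_measure q"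
  shows "\<bar>conv q x\<bar> \<le> w_sum * integral\<^sup>L torus_measure (\<lambda>y. \<bar>q y\<bar>)"
proof -
  have "\<bar>conv q x\<bar> \<le> integral\<^sup>L torus_measure (\<lambda>y. \<bar>W (x - y) * q y\<bar>)"
    unfolding conv_def by (rule integral_abs_bound)
  also have "\<dots> \<le> integral\<^sup>L torus_measure (\<lambda>y. w_sum * \<bar>q y\<bar>)"
    using q by (intro integral_mono integrable_abs conv_integrable)
      (auto simp: abs_mult intro!: mult_right_mono abs_W_le)
  finally show ?thesis by simp
qed

lemma abs_conv_density: "q \<in> densities \<Longrightarrow> \<bar>conv q x\<bar> \<le> w_sum"
  using abs_conv_le[of q x] densitiesD[of q] by simp

text \<open>Uniform in the density: this is the equicontinuity behind the compactness of the self-consistency map.\<close>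
lemma conv_equicontinuous:
  assumes "0 < e"
  obtains d where "0 < d"
    "\<And>q x y. q \<in> densities \<Longrightarrow> x \<in> {-1..1} \<Longrightarrow> y \<in> {-1..1} \<Longrightarrow> \<bar>x - y\<bar> < d \<Longrightarrow> \<bar>conv q x - conv q y\<bar> \<le> e"
proof -
  \<comment> \<open>Points of \<open>{-1..1}\<close> minus points of \<open>torus\<close> stay in
    \<open>{-2..2}\<close>, so one modulus of continuity of \<open>W\<close> serves all
    densities.\<close>
  have "uniformly_continuous_on {-2..2} W"
    by (intro compact_uniformly_continuous continuous_on_subset[OF W_continuous]) auto
  then obtain d where d: "0 < d" "\<And>x y. x \<in> {-2..2} \<Longrightarrow> y \<in> {-2..2} \<Longrightarrow> dist y x < d \<Longrightarrow> dist (W y) (W x) < e"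
    using assms unfolding uniformly_continuous_on_def by metis
  show ?thesis
  proof (rule that[OF d(1)])
    fix q x y assume q: "q \<in> densities" and x: "x \<in> {-1..1}" and y: "y \<in> {-1..1}" and xy: "\<bar>x - y\<bar> < d"
    note q' = densitiesD[OF q]
    have "conv q x - conv q y = integral\<^sup>L torus_measure (\<lambda>z. (W (x - z) - W (y - z)) * q z)"
      unfolding conv_def left_diff_distrib
      by (rule Bochner_Integration.integral_diff[symmetric]) (auto intro: conv_integrable q')
    also have "\<bar>\<dots>\<bar> \<le> integral\<^sup>L torus_measure (\<lambda>z. \<bar>(W (x - z) - W (y - z)) * q z\<bar>)"
      by (rule integral_abs_bound)
    also have "\<dots> \<le> integral\<^sup>L torus_measure (\<lambda>z. e * q z)"
    proof (rule integral_mono)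
      show "integrable torus_measure (\<lambda>z. \<bar>(W (x - z) - W (y - z)) * q z\<bar>)"
        unfolding left_diff_distrib
        by (intro integrable_abs Bochner_Integration.integrable_diff conv_integrable q')
      fix z assume "z \<in> space torus_measure"
      then have z: "z \<in> torus" by simp
      then have "\<bar>W (x - z) - W (y - z)\<bar> < e"
        using d(2)[of "y - z" "x - z"] x y xy by (auto simp: dist_real_def torus_def)
      then show "\<bar>(W (x - z) - W (y - z)) * q z\<bar> \<le> e * q z"
        using q'(3)[OF z] by (simp add: abs_mult mult_right_mono)
    qed (use q' in auto)
    also have "\<dots> = e" using q' by simp
    finally show "\<bar>conv q x - conv q y\<bar> \<le> e" .
  qed
qed

lemma conv_measurable: "q \<in> densities \<Longrightarrow> conv q \<in> borel_measurable torus_measure"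
proof (rule torus_measurable_cont)
  assume q: "q \<in> densities"
  show "continuous_on torus (conv q)"
    unfolding continuous_on_iff
  proof (intro ballI allI impI)
    fix x e :: real assume x: "x \<in> torus" and e: "0 < e"
    obtain d where d: "0 < d" "\<And>q x y. q \<in> densities \<Longrightarrow> x \<in> {-1..1} \<Longrightarrow> y \<in> {-1..1} \<Longrightarrow> \<bar>x - y\<bar> < d \<Longrightarrow> \<bar>conv q x - conv q y\<bar> \<le> e/2"
      using conv_equicontinuous[of "e/2"] e by auto
    have "dist (conv q y) (conv q x) < e" if "y \<in> torus" "dist y x < d" for y
      using d(2)[OF q, of y x] x e that by (simp add: dist_real_def torus_def)
    then show "\<exists>d>0. \<forall>x'\<in>torus. dist x' x < d \<longrightarrow> dist (conv q x') (conv q x) < e"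
      using d(1) by auto
  qed
qed

lemma bil_summable:
  assumes p: "integrable torus_measure p" and q: "integrable torus_measure q"
  shows "summable (\<lambda>k. w k * (cosc p k * cosc q k + sinc p k * sinc q k))"
proof -
  let ?P = "integral\<^sup>L torus_measure (\<lambda>x. \<bar>p x\<bar>)" and ?Q = "integral\<^sup>L torus_measure (\<lambda>x. \<bar>q x\<bar>)"
  show ?thesis
  proof (rule summable_comparison_test'[OF summable_mult2[OF w_summable, of "2 * (?P * ?Q)"], of 0])
    fix k
    have "\<bar>cosc p k * cosc q k + sinc p k * sinc q k\<bar> \<le> \<bar>cosc p k\<bar> * \<bar>cosc q k\<bar> + \<bar>sinc p k\<bar> * \<bar>sinc q k\<bar>"
      by (rule order_trans[OF abs_triangle_ineq]) (simp add: abs_mult)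
    also have "\<dots> \<le> ?P * ?Q + ?P * ?Q"
      by (intro add_mono mult_mono abs_cosc_le abs_sinc_le p q) auto
    finally show "norm (w k * (cosc p k * cosc q k + sinc p k * sinc q k)) \<le> w k * (2 * (?P * ?Q))"
      using w_nonneg[of k] by (simp add: abs_mult mult_left_mono)
  qed
qed

lemma integral_conv:
  assumes p: "integrable torus_measure p" and q: "integrable torus_measure q"
  shows "integral\<^sup>L torus_measure (\<lambda>x. conv q x * p x) = bil p q"
    and "integrable torus_measure (\<lambda>x. conv q x * p x)"
proof -
  let ?Q = "integral\<^sup>L torus_measure (\<lambda>x. \<bar>q x\<bar>)"
  let ?\<phi> = "\<lambda>k x. w k * (cos (2 * pi * real k * x) * cosc q k + sin (2 * pi * real k * x) * sinc q k) * p x"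
  have m: "?\<phi> k \<in> borel_measurable torus_measure" for k
    by (rule borel_measurable_times[OF torus_measurable_cont borel_measurable_integrable[OF p]])
       (intro continuous_intros)
  have b: "norm (?\<phi> k x) \<le> w k * (2 * ?Q * \<bar>p x\<bar>)" for k x
  proof -
    have "\<bar>cos (2 * pi * real k * x) * cosc q k + sin (2 * pi * real k * x) * sinc q k\<bar>
      \<le> \<bar>cos (2 * pi * real k * x)\<bar> * \<bar>cosc q k\<bar> + \<bar>sin (2 * pi * real k * x)\<bar> * \<bar>sinc q k\<bar>"
      by (rule order_trans[OF abs_triangle_ineq]) (simp add: abs_mult)
    also have "\<dots> \<le> 1 * ?Q + 1 * ?Q"
      by (intro add_mono mult_mono abs_cosc_le abs_sinc_le q) auto
    finally have "\<bar>cos (2 * pi * real k * x) * cosc q k + sin (2 * pi * real k * x) * sinc q k\<bar> \<le> 2 * ?Q" by simp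
    from mult_right_mono[OF this, of "\<bar>p x\<bar>"] show ?thesis
      using w_nonneg[of k] by (simp add: abs_mult mult.assoc mult_left_mono)
  qed
  have eq: "(\<lambda>x. \<Sum>k. ?\<phi> k x) = (\<lambda>x. conv q x * p x)"
    using sums_unique[OF sums_mult2[OF conv_sums[OF q]]] by (intro ext) simp
  note s = sums_integral_torus[where \<phi>="?\<phi>" and B=w and g="\<lambda>x. 2 * ?Q * \<bar>p x\<bar>", OF m b _ w_summable, unfolded eq]
  show "integrable torus_measure (\<lambda>x. conv q x * p x)" using s(2) p by simp
  have "integral\<^sup>L torus_measure (?\<phi> k) = w k * (cosc p k * cosc q k + sinc p k * sinc q k)" for k
  proof -
    have "integral\<^sup>L torus_measure (?\<phi> k) = integral\<^sup>L torus_measure (\<lambda>x. w k * (cosc q k * (cos (2 * pi * real k * x) * p x) + sinc q k * (sin (2 * pi * real k * x) * p x)))"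
      by (intro Bochner_Integration.integral_cong refl) (simp add: algebra_simps)
    also have "\<dots> = w k * (cosc q k * cosc p k + sinc q k * sinc p k)"
      using p by (simp add: integrable_cos_mult integrable_sin_mult cosc_def sinc_def)
    finally show ?thesis by (simp add: mult.commute)
  qed
  then show "integral\<^sup>L torus_measure (\<lambda>x. conv q x * p x) = bil p q"
    using s(1) p unfolding bil_def by (simp add: sums_iff)
qed

lemma interaction_eq:
  assumes q: "integrable torus_measure q"
  shows "interaction W q = bil q q"
proof -
  have "integral\<^sup>L torus_measure (\<lambda>y. W (x - y) * q x * q y) = conv q x * q x" for x
  proof -
    have "integral\<^sup>L torus_measure (\<lambda>y. W (x - y) * q x * q y) = integral\<^sup>L torus_measure (\<lambda>y. q x * (W (x - y) * q y))"
      by (intro Bochner_Integration.integral_cong) auto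
    then show ?thesis by (simp add: conv_def mult.commute)
  qed
  then show ?thesis unfolding interaction_def using integral_conv(1)[OF q q] by simp
qed

text \<open>The quadratic form of \<open>p - q\<close> is nonnegative because all weights are: the
  interaction lies above its tangent at \<open>q\<close>.\<close>

lemma interaction_convex:
  assumes p: "integrable torus_measure p" and q: "integrable torus_measure q"
  shows "2 * bil p q - interaction W q \<le> interaction W p"
proof -
  have "(\<lambda>k. 2 * (w k * (cosc p k * cosc q k + sinc p k * sinc q k)) - w k * (cosc q k * cosc q k + sinc q k * sinc q k)) sums (2 * bil p q - bil q q)"
    unfolding bil_def by (intro sums_diff sums_mult summable_sums bil_summable p q)
  moreover have "(\<lambda>k. w k * (cosc p k * cosc p k + sinc p k * sinc p k)) sums bil p p"
    unfolding bil_def by (intro summable_sums bil_summable p)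
  ultimately have "2 * bil p q - bil q q \<le> bil p p"
  proof (rule sums_le[rotated])
    fix k
    have "2 * (cosc p k * cosc q k + sinc p k * sinc q k) - (cosc q k * cosc q k + sinc q k * sinc q k) \<le> cosc p k * cosc p k + sinc p k * sinc p k"
      using sum_squares_bound[of "cosc p k" "cosc q k"] sum_squares_bound[of "sinc p k" "sinc q k"]
      by (simp add: power2_eq_square)
    from mult_left_mono[OF this w_nonneg[of k]]
    show "2 * (w k * (cosc p k * cosc q k + sinc p k * sinc q k)) - w k * (cosc q k * cosc q k + sinc q k * sinc q k) \<le> w k * (cosc p k * cosc p k + sinc p k * sinc p k)"
      by (simp add: algebra_simps)
  qed
  then show ?thesis by (simp add: interaction_eq p q)
qed

text \<open>All densities have the same zero mode, which cancels; hence the shift to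
  \<open>Suc k\<close>.\<close>

lemma excess_sums:
  assumes q: "q \<in> densities"
  shows "(\<lambda>k. w (Suc k) * ((cosc q (Suc k))\<^sup>2 + (sinc q (Suc k))\<^sup>2)) sums (interaction W q - interaction W q_unif)"
proof -
  have i1: "integrable torus_measure q_unif" by (simp add: q_unif_def)
  have "(\<lambda>k. w k * (cosc q_unif k * cosc q_unif k + sinc q_unif k * sinc q_unif k)) = (\<lambda>k. if k = 0 then w 0 else 0)"
    by (auto simp: cosc_q_unif sinc_q_unif)
  then have "bil q_unif q_unif = w 0"
    unfolding bil_def using sums_single[of 0 "\<lambda>_. w 0"] by (simp add: sums_iff)
  moreover have "(\<lambda>k. w k * (cosc q k * cosc q k + sinc q k * sinc q k)) sums bil q q"
    unfolding bil_def by (intro summable_sums bil_summable densitiesD q)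
  ultimately show ?thesis
    using cosc_0[OF q] sinc_0
    by (subst sums_Suc_iff) (simp add: interaction_eq densitiesD[OF q] i1 power2_eq_square)
qed

end

section \<open>The self-consistency map and existence of minimisers\<close>

text \<open>The bounds depend on the exponent only through \<open>C\<close>: the numerator is at
  most \<open>exp C\<close> and \<open>Z\<close> at least \<open>exp (- C)\<close>. They supply the
  dominating functions for limits of such densities.\<close>

lemma gibbs_density:
  fixes f :: "real \<Rightarrow> real"
  assumes f: "f \<in> borel_measurable torus_measure" and "\<forall>x\<in>torus. \<bar>f x\<bar> \<le> C"
  defines "Z \<equiv> integral\<^sup>L torus_measure (\<lambda>x. exp (f x))"
  defines "g \<equiv> (\<lambda>x. exp (f x) / Z)"
  shows "exp (- C) \<le> Z" "\<And>x. x \<in> torus \<Longrightarrow> 0 \<le> g x \<and> g x \<le> exp (2 * C)"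
    and "fin_ent g" "ent g = integral\<^sup>L torus_measure (\<lambda>x. f x * g x) - ln Z"
proof -
  note C = \<open>\<forall>x\<in>torus. \<bar>f x\<bar> \<le> C\<close>[rule_format]
  have expm: "(\<lambda>x. exp (f x)) \<in> borel_measurable torus_measure" using f by simp
  have expi: "integrable torus_measure (\<lambda>x. exp (f x))"
    using expm C by (intro integrable_torus_bounded[where C="exp C"]) (force simp: abs_le_iff)+
  have "integral\<^sup>L torus_measure (\<lambda>x. exp (- C)) \<le> Z" unfolding Z_def
    using C expi by (intro integral_mono) (force simp: abs_le_iff)+
  then show ZC: "exp (- C) \<le> Z" by simp
  then have Z: "0 < Z" by (rule less_le_trans[OF exp_gt_zero])
  show bd: "0 \<le> g x \<and> g x \<le> exp (2 * C)" if "x \<in> torus" for x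
  proof
    show "0 \<le> g x" using Z by (simp add: g_def)
    have "g x \<le> exp C / exp (- C)"
      unfolding g_def using C[OF that] ZC Z by (intro frac_le) auto
    also have "\<dots> = exp (2 * C)" by (simp add: exp_minus field_simps flip: exp_add)
    finally show "g x \<le> exp (2 * C)" .
  qed
  have gm: "g \<in> borel_measurable torus_measure" unfolding g_def using expm by simp
  have gi: "integrable torus_measure g" unfolding g_def using expi by simp
  have gI: "integral\<^sup>L torus_measure g = 1" unfolding g_def using Z by (simp flip: Z_def)
  have fg: "integrable torus_measure (\<lambda>x. f x * g x)"
    by (rule integrable_torus_mult[OF f C gi])
  have eq: "g x * ln (g x) = f x * g x - ln Z * g x" for x
  proof -
    have "ln (g x) = f x - ln Z" unfolding g_def using Z by (simp add: ln_div)
    show ?thesis unfolding \<open>ln (g x) = f x - ln Z\<close> by (simp add: algebra_simps)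
  qed
  show "fin_ent g"
    unfolding fin_ent_def densities_def eq using gm gi gI bd fg by auto
  show "ent g = integral\<^sup>L torus_measure (\<lambda>x. f x * g x) - ln Z"
    unfolding ent_def eq using fg gi gI by simp
qed

text \<open>Pointwise convergence of exponents with a common bound \<open>C\<close> is enough:
  dominated convergence gives first the normalisations, then the densities and their
  entropies.\<close>

lemma gibbs_density_limit:
  fixes f :: "nat \<Rightarrow> real \<Rightarrow> real"
  assumes f: "\<And>n. f n \<in> borel_measurable torus_measure" and fC: "\<And>n. \<forall>x\<in>torus. \<bar>f n x\<bar> \<le> C"
    and f': "f' \<in> borel_measurable torus_measure"
    and flim: "\<forall>x\<in>torus. (\<lambda>n. f n x) \<longlonglongrightarrow> f' x"
  defines "Z \<equiv> (\<lambda>n. integral\<^sup>L torus_measure (\<lambda>x. exp (f n x)))"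
    and "Z' \<equiv> integral\<^sup>L torus_measure (\<lambda>x. exp (f' x))"
  defines "g \<equiv> (\<lambda>n x. exp (f n x) / Z n)" and "g' \<equiv> (\<lambda>x. exp (f' x) / Z')"
  shows "fin_ent g'" "(\<lambda>n. ent (g n)) \<longlonglongrightarrow> ent g'"
    "(\<lambda>n. integral\<^sup>L torus_measure (\<lambda>x. \<bar>g n x - g' x\<bar>)) \<longlonglongrightarrow> 0"
proof -
  note C = bspec[OF fC] and lim = flim[rule_format]
  have C': "\<forall>x\<in>torus. \<bar>f' x\<bar> \<le> C"
  proof
    fix x assume "x \<in> torus"
    then show "\<bar>f' x\<bar> \<le> C"
      by (intro LIMSEQ_le_const2[OF tendsto_rabs[OF lim]]) (use C in auto)
  qed
  have G2: "0 \<le> g n x \<and> g n x \<le> exp (2 * C)" if "x \<in> torus" for n x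
    using gibbs_density(2)[OF f fC that] by (simp add: g_def Z_def)
  have G4: "ent (g n) = integral\<^sup>L torus_measure (\<lambda>x. f n x * g n x) - ln (Z n)" for n
    using gibbs_density(4)[OF f fC, of n] by (simp add: g_def Z_def)
  note G' = gibbs_density[OF f' C', folded Z'_def, folded g'_def]
  have G'2: "0 \<le> g' x \<and> g' x \<le> exp (2 * C)" if "x \<in> torus" for x
    using gibbs_density(2)[OF f' C' that] by (simp add: g'_def Z'_def)
  have G'4: "ent g' = integral\<^sup>L torus_measure (\<lambda>x. f' x * g' x) - ln Z'"
    using gibbs_density(4)[OF f' C'] by (simp add: g'_def Z'_def)
  show "fin_ent g'" by (rule G'(3))
  have "Z \<longlonglongrightarrow> Z'"
    unfolding Z_def Z'_def
  proof (rule integral_dominated_convergence[where w="\<lambda>_. exp C"])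
    show "AE x in torus_measure. (\<lambda>n. exp (f n x)) \<longlonglongrightarrow> exp (f' x)"
      by (intro AE_I2 tendsto_exp lim) simp
    show "AE x in torus_measure. norm (exp (f n x)) \<le> exp C" for n
      using C by (intro AE_I2) (force simp: abs_le_iff)
  qed (use f f' in auto)
  moreover have "0 < Z'" using G'(1) exp_gt_zero less_le_trans by blast
  ultimately have g_lim: "(\<lambda>n. g n x) \<longlonglongrightarrow> g' x" if "x \<in> torus" for x
    unfolding g_def g'_def by (intro tendsto_divide tendsto_exp lim that) auto
  have gm: "g n \<in> borel_measurable torus_measure" and gm': "g' \<in> borel_measurable torus_measure" for n
    using f f' unfolding g_def g'_def by simp_all
  have "(\<lambda>n. integral\<^sup>L torus_measure (\<lambda>x. f n x * g n x)) \<longlonglongrightarrow> integral\<^sup>L torus_measure (\<lambda>x. f' x * g' x)"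
  proof (rule integral_dominated_convergence[where w="\<lambda>_. C * exp (2 * C)"])
    show "AE x in torus_measure. (\<lambda>n. f n x * g n x) \<longlonglongrightarrow> f' x * g' x"
      by (intro AE_I2 tendsto_mult lim g_lim) auto
    show "AE x in torus_measure. norm (f n x * g n x) \<le> C * exp (2 * C)" for n
    proof (rule AE_I2)
      fix x assume "x \<in> space torus_measure"
      then have x: "x \<in> torus" by simp
      show "norm (f n x * g n x) \<le> C * exp (2 * C)"
        using C[OF x, of n] G2[OF x, of n] by (auto simp: abs_mult intro!: mult_mono)
    qed
  qed (use f f' gm gm' in auto)
  then show "(\<lambda>n. ent (g n)) \<longlonglongrightarrow> ent g'"
    unfolding G4 G'4 using \<open>Z \<longlonglongrightarrow> Z'\<close> \<open>0 < Z'\<close>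
    by (intro tendsto_diff tendsto_ln) auto
  have "(\<lambda>n. integral\<^sup>L torus_measure (\<lambda>x. \<bar>g n x - g' x\<bar>)) \<longlonglongrightarrow> integral\<^sup>L torus_measure (\<lambda>x. 0)"
  proof (rule integral_dominated_convergence[where w="\<lambda>_. 2 * exp (2 * C)"])
    show "AE x in torus_measure. (\<lambda>n. \<bar>g n x - g' x\<bar>) \<longlonglongrightarrow> 0"
    proof (rule AE_I2)
      fix x assume "x \<in> space torus_measure"
      then have "(\<lambda>n. g n x - g' x) \<longlonglongrightarrow> 0" using g_lim by (simp add: LIM_zero)
      then show "(\<lambda>n. \<bar>g n x - g' x\<bar>) \<longlonglongrightarrow> 0" by (rule tendsto_rabs_zero)
    qed
    show "AE x in torus_measure. norm \<bar>g n x - g' x\<bar> \<le> 2 * exp (2 * C)" for n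
    proof (rule AE_I2)
      fix x assume "x \<in> space torus_measure"
      then have x: "x \<in> torus" by simp
      show "norm \<bar>g n x - g' x\<bar> \<le> 2 * exp (2 * C)"
        using G2[OF x, of n] G'2[OF x] by auto
    qed
  qed (use gm gm' in auto)
  then show "(\<lambda>n. integral\<^sup>L torus_measure (\<lambda>x. \<bar>g n x - g' x\<bar>)) \<longlonglongrightarrow> 0" by simp
qed

context cosine_kernel
begin

definition fe :: "real \<Rightarrow> (real \<Rightarrow> real) \<Rightarrow> real" where
  "fe K q = ent q - K * interaction W q"

lemma free_energy_eq:
  assumes "q \<in> densities"
  shows "free_energy W K q = (if fin_ent q then ereal (fe K q) else \<infinity>)"
  using assms by (auto simp: free_energy_def entropy_def fin_ent_def ent_def fe_def)

text \<open>A minimiser has finite entropy because the competitor \<open>q_unif\<close> has. This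
  removes the extended reals from all later comparisons.\<close>

lemma global_minimizer_iff:
  "global_minimizer W K q \<longleftrightarrow> fin_ent q \<and> (\<forall>p. fin_ent p \<longrightarrow> fe K q \<le> fe K p)"
proof
  assume min: "global_minimizer W K q"
  then have q: "q \<in> densities" and le: "\<And>p. p \<in> densities \<Longrightarrow> free_energy W K q \<le> free_energy W K p"
    by (auto simp: global_minimizer_def)
  have fq: "fin_ent q"
    using le[OF fin_entD(1)[OF q_unif_fin_ent]] q
    by (auto simp: free_energy_eq fin_entD(1)[OF q_unif_fin_ent] q_unif_fin_ent split: if_splits)
  then show "fin_ent q \<and> (\<forall>p. fin_ent p \<longrightarrow> fe K q \<le> fe K p)"
    using le[OF fin_entD(1)] q by (auto simp: free_energy_eq fin_entD(1))
next
  assume *: "fin_ent q \<and> (\<forall>p. fin_ent p \<longrightarrow> fe K q \<le> fe K p)"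
  then have "q \<in> densities" using fin_entD(1) by blast
  with * show "global_minimizer W K q"
    by (auto simp: global_minimizer_def free_energy_eq dest: fin_entD(1))
qed

text \<open>The factor \<open>2\<close> comes from differentiating the quadratic interaction, so
  fixed points solve the Euler-Lagrange equation of \<open>fe K\<close>.\<close>

definition selfc :: "real \<Rightarrow> (real \<Rightarrow> real) \<Rightarrow> real \<Rightarrow> real" where
  "selfc K q x = exp (2 * K * conv q x) / integral\<^sup>L torus_measure (\<lambda>x. exp (2 * K * conv q x))"

lemma w_sum_nonneg: "0 \<le> w_sum"
  unfolding w_sum_def by (intro suminf_nonneg w_summable w_nonneg)

lemma abs_tilt_le: "q \<in> densities \<Longrightarrow> \<bar>2 * K * conv q x\<bar> \<le> 2 * \<bar>K\<bar> * w_sum"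
  unfolding abs_mult using abs_conv_density[of q x] by (intro mult_mono) auto

lemma tilt_measurable: "q \<in> densities \<Longrightarrow> (\<lambda>x. 2 * K * conv q x) \<in> borel_measurable torus_measure"
  using conv_measurable by simp

text \<open>Since \<open>W\<close> is positive definite, the free energy is dominated by its linearisation at \<open>q\<close>
  in the interaction term, which \<open>selfc K q\<close> minimises.\<close>
lemma fe_selfc_le:
  assumes q: "fin_ent q" and K: "0 \<le> K"
  shows "fin_ent (selfc K q)" "fe K (selfc K q) \<le> fe K q"
    and "fe K q \<le> fe K (selfc K q) \<Longrightarrow> AE x in torus_measure. q x = selfc K q x"
proof -
  let ?p = "selfc K q"
  define f where "f = (\<lambda>x. 2 * K * conv q x)"
  define Z where "Z = integral\<^sup>L torus_measure (\<lambda>x. exp (f x))"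
  note q' = fin_entD[OF q]
  have f: "f \<in> borel_measurable torus_measure" "\<forall>x\<in>torus. \<bar>f x\<bar> \<le> 2 * \<bar>K\<bar> * w_sum"
    unfolding f_def using tilt_measurable abs_tilt_le q' by auto
  have p_eq: "exp (f x) / Z = ?p x" for x
    unfolding Z_def f_def by (simp add: selfc_def)
  note G = gibbs_density[OF f, folded Z_def, unfolded p_eq]
  show p: "fin_ent ?p" by (rule G(3))
  have "integral\<^sup>L torus_measure (\<lambda>x. f x * r x) = 2 * K * bil r q" if "fin_ent r" for r
    unfolding f_def mult.assoc using integral_conv(1)[OF fin_entD(2)[OF that] q'(2)] by simp
  note fr = this[OF q] this[OF p]
  have "ent ?p = 2 * K * bil ?p q - ln Z" by (simp only: G(4) fr)
  moreover have "2 * bil ?p q - interaction W q \<le> interaction W ?p"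
    by (rule interaction_convex) (use q' fin_entD[OF p] in auto)
  from mult_left_mono[OF this K] have "2 * K * bil ?p q - K * interaction W q \<le> K * interaction W ?p"
    by (simp add: algebra_simps)
  \<comment> \<open>\<open>K * interaction W q - ln Z\<close> is the minimum of the linearised
    functional and separates the two energies. Equal energies therefore give equality in the Gibbs
    principle.\<close>
  ultimately have 1: "fe K ?p \<le> K * interaction W q - ln Z" unfolding fe_def by linarith
  have bq: "bil q q = interaction W q" using interaction_eq q' by simp
  note H = gibbs[OF q f(1) bspec[OF f(2)], folded Z_def, unfolded fr bq p_eq]
  have 2: "K * interaction W q - ln Z \<le> fe K q"
    using H(2) unfolding fe_def by simp
  show "fe K ?p \<le> fe K q" using 1 2 by simp
  assume "fe K q \<le> fe K ?p"
  then have "ent q = 2 * K * interaction W q - ln Z" using 1 2 unfolding fe_def by simp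
  then show "AE x in torus_measure. q x = ?p x" by (intro H(3)) auto
qed

lemma minimizer_fixed_point:
  assumes "global_minimizer W K q" "0 \<le> K"
  shows "AE x in torus_measure. q x = selfc K q x"
  using assms fe_selfc_le[of q K] by (auto simp: global_minimizer_iff)

text \<open>Difference of squares: by symmetry of \<open>bil\<close> it is the integral of
  \<open>conv p + conv q\<close> against \<open>p - q\<close>, and each convolution is at most
  \<open>w_sum\<close> in modulus.\<close>

lemma interaction_diff_le:
  assumes p: "p \<in> densities" and q: "q \<in> densities"
  shows "\<bar>interaction W p - interaction W q\<bar> \<le> 2 * w_sum * integral\<^sup>L torus_measure (\<lambda>x. \<bar>p x - q x\<bar>)"
proof -
  note p' = densitiesD[OF p] and q' = densitiesD[OF q]
  have d: "integrable torus_measure (\<lambda>x. p x - q x)" using p' q' by simp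
  have i: "integrable torus_measure (\<lambda>x. conv r x * (p x - q x))"
    and b: "\<bar>integral\<^sup>L torus_measure (\<lambda>x. conv r x * (p x - q x))\<bar> \<le> w_sum * integral\<^sup>L torus_measure (\<lambda>x. \<bar>p x - q x\<bar>)"
    if "r \<in> densities" for r
  proof -
    show i: "integrable torus_measure (\<lambda>x. conv r x * (p x - q x))"
      by (rule integral_conv(2)[OF d]) (use densitiesD[OF that] in auto)
    have "\<bar>integral\<^sup>L torus_measure (\<lambda>x. conv r x * (p x - q x))\<bar> \<le> integral\<^sup>L torus_measure (\<lambda>x. \<bar>conv r x * (p x - q x)\<bar>)"
      by (rule integral_abs_bound)
    also have "\<dots> \<le> integral\<^sup>L torus_measure (\<lambda>x. w_sum * \<bar>p x - q x\<bar>)"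
      using d i abs_conv_density[OF that]
      by (intro integral_mono integrable_abs) (auto simp: abs_mult intro!: mult_right_mono)
    finally show "\<bar>integral\<^sup>L torus_measure (\<lambda>x. conv r x * (p x - q x))\<bar> \<le> w_sum * integral\<^sup>L torus_measure (\<lambda>x. \<bar>p x - q x\<bar>)"
      by simp
  qed
  have sym: "bil q p = bil p q" by (simp add: bil_def mult.commute)
  have "integral\<^sup>L torus_measure (\<lambda>x. conv r x * (p x - q x)) = bil p r - bil q r" if "r \<in> densities" for r
    unfolding right_diff_distrib
    using integral_conv[OF p'(1) densitiesD(1)[OF that]] integral_conv[OF q'(1) densitiesD(1)[OF that]] by simp
  from this[OF p] this[OF q]
  have "interaction W p - interaction W q = integral\<^sup>L torus_measure (\<lambda>x. conv p x * (p x - q x)) + integral\<^sup>L torus_measure (\<lambda>x. conv q x * (p x - q x))"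
    using sym p' q' by (simp add: interaction_eq)
  then show ?thesis using b[OF p] b[OF q] by linarith
qed

lemma abs_interaction_le: "q \<in> densities \<Longrightarrow> \<bar>interaction W q\<bar> \<le> w_sum"
proof -
  assume q: "q \<in> densities"
  note q' = densitiesD[OF q]
  have "\<bar>interaction W q\<bar> \<le> integral\<^sup>L torus_measure (\<lambda>x. \<bar>conv q x * q x\<bar>)"
    using integral_conv(1)[OF q'(1) q'(1)] integral_abs_bound[of torus_measure "\<lambda>x. conv q x * q x"]
    by (simp add: interaction_eq q')
  also have "\<dots> \<le> integral\<^sup>L torus_measure (\<lambda>x. w_sum * q x)"
    using q' integral_conv(2)[OF q'(1) q'(1)] abs_conv_density[OF q]
    by (intro integral_mono integrable_abs) (auto simp: abs_mult intro!: mult_right_mono)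
  finally show ?thesis using q' by simp
qed

text \<open>The functions \<open>conv (q n)\<close> are bounded and equicontinuous uniformly over
  all densities, so Arzela-Ascoli yields a uniform limit \<open>g\<close> along a subsequence, and
  the Gibbs densities of the converging exponents converge. A varying coupling is allowed for the
  approach to \<open>Kc\<close> from above.\<close>

lemma selfc_compact:
  assumes q: "\<And>n. fin_ent (q n)" and K: "\<And>n. 0 \<le> K n" "K \<longlonglongrightarrow> K'"
  shows "\<exists>r q'. strict_mono r \<and> fin_ent q'
    \<and> (\<lambda>n. fe (K (r n)) (selfc (K (r n)) (q (r n)))) \<longlonglongrightarrow> fe K' q'
    \<and> (\<lambda>n. integral\<^sup>L torus_measure (\<lambda>x. \<bar>selfc (K (r n)) (q (r n)) x - q' x\<bar>)) \<longlonglongrightarrow> 0"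
proof -
  have qd: "q n \<in> densities" for n using q fin_entD by auto
  obtain g r where g: "continuous_on {-1/2..1/2} g" and r: "strict_mono (r :: nat \<Rightarrow> nat)"
    and lim: "\<And>e. 0 < e \<Longrightarrow> \<exists>N. \<forall>n x. n \<ge> N \<and> x \<in> {-1/2..1/2} \<longrightarrow> norm (conv (q (r n)) x - g x) < e"
  proof (rule Arzela_Ascoli[of "{-1/2..1/2::real}" "\<lambda>n. conv (q n)" w_sum])
    show "norm (conv (q n) x) \<le> w_sum" for n x using abs_conv_density[OF qd] by simp
    show "\<exists>d>0. \<forall>n y. y \<in> {-1/2..1/2} \<and> norm (x - y) < d \<longrightarrow> norm (conv (q n) x - conv (q n) y) < e"
      if x: "x \<in> {-1/2..1/2}" and e: "0 < e" for x e :: real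
    proof -
      obtain d where d: "0 < d" "\<And>q x y. q \<in> densities \<Longrightarrow> x \<in> {-1..1} \<Longrightarrow> y \<in> {-1..1} \<Longrightarrow> \<bar>x - y\<bar> < d \<Longrightarrow> \<bar>conv q x - conv q y\<bar> \<le> e/2"
        using conv_equicontinuous[of "e/2"] e by auto
      show ?thesis
      proof (intro exI[of _ d] conjI allI impI d(1))
        fix n y assume "y \<in> {-1/2..1/2} \<and> norm (x - y) < d"
        then show "norm (conv (q n) x - conv (q n) y) < e"
          using d(2)[OF qd[of n], of x y] x e by simp
      qed
    qed
  qed auto
  have conv_lim: "(\<lambda>n. conv (q (r n)) x) \<longlonglongrightarrow> g x" if "x \<in> torus" for x
  proof (rule LIMSEQ_I)
    fix e :: real assume "0 < e"
    from lim[OF this] show "\<exists>N. \<forall>n\<ge>N. norm (conv (q (r n)) x - g x) < e"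
      using that by (fastforce simp: torus_def)
  qed
  have Kr: "(\<lambda>n. K (r n)) \<longlonglongrightarrow> K'" using LIMSEQ_subseq_LIMSEQ[OF K(2) r] by (simp add: o_def)
  obtain B where B: "\<forall>n. norm (K n) \<le> B"
    using convergent_imp_Bseq[OF convergentI[OF K(2)]] by (auto elim!: BseqE)
  let ?f = "\<lambda>n x. 2 * K (r n) * conv (q (r n)) x"
  have f_le: "\<forall>x\<in>torus. \<bar>?f n x\<bar> \<le> 2 * B * w_sum" for n
    by (intro ballI order_trans[OF abs_tilt_le[OF qd]]) (use B w_sum_nonneg in \<open>auto intro!: mult_right_mono\<close>)
  let ?q = "\<lambda>x. exp (2 * K' * g x) / integral\<^sup>L torus_measure (\<lambda>x. exp (2 * K' * g x))"
  have gm: "(\<lambda>x. 2 * K' * g x) \<in> borel_measurable torus_measure"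
    using borel_measurable_integrable[OF cont_imp_integrable_torus[OF g]] by simp
  have "\<forall>x\<in>torus. (\<lambda>n. ?f n x) \<longlonglongrightarrow> 2 * K' * g x"
    by (intro ballI tendsto_mult tendsto_const Kr conv_lim)
  note L = gibbs_density_limit[of ?f, OF tilt_measurable[OF qd] f_le gm this]
  let ?p = "\<lambda>n. selfc (K (r n)) (q (r n))"
  have p: "fin_ent (?p n)" for n by (rule fe_selfc_le(1)[OF q K(1)])
  have L1: "(\<lambda>n. integral\<^sup>L torus_measure (\<lambda>x. \<bar>?p n x - ?q x\<bar>)) \<longlonglongrightarrow> 0"
    using L(3) by (simp add: selfc_def)
  have Lent: "(\<lambda>n. ent (?p n)) \<longlonglongrightarrow> ent ?q"
    using L(2) by (simp add: selfc_def[abs_def])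
  have "(\<lambda>n. interaction W (?p n) - interaction W ?q) \<longlonglongrightarrow> 0"
  proof (rule Lim_null_comparison)
    show "\<forall>\<^sub>F n in sequentially. norm (interaction W (?p n) - interaction W ?q) \<le> 2 * w_sum * integral\<^sup>L torus_measure (\<lambda>x. \<bar>?p n x - ?q x\<bar>)"
      using interaction_diff_le[OF fin_entD(1)[OF p] fin_entD(1)[OF L(1)]] by (intro always_eventually allI) simp
    show "(\<lambda>n. 2 * w_sum * integral\<^sup>L torus_measure (\<lambda>x. \<bar>?p n x - ?q x\<bar>)) \<longlonglongrightarrow> 0"
      by (rule tendsto_mult_right_zero[OF L1])
  qed
  then have "(\<lambda>n. interaction W (?p n)) \<longlonglongrightarrow> interaction W ?q" by (simp add: LIM_zero_iff)
  then have "(\<lambda>n. fe (K (r n)) (?p n)) \<longlonglongrightarrow> fe K' ?q"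
    unfolding fe_def by (intro tendsto_diff tendsto_mult Kr Lent)
  then show ?thesis using r L(1) L1 by blast
qed

lemma ex_global_minimizer:
  assumes K: "0 \<le> K"
  shows "\<exists>q. global_minimizer W K q"
proof -
  define V where "V = fe K ` Collect fin_ent"
  \<comment> \<open>Entropy is nonnegative and the interaction is at most
    \<open>w_sum\<close>.\<close>
  have bdd: "bdd_below V"
  proof (rule bdd_belowI)
    fix v assume "v \<in> V"
    then obtain p where p: "fin_ent p" "v = fe K p" by (auto simp: V_def)
    have "K * interaction W p \<le> K * w_sum"
      using abs_interaction_le[OF fin_entD(1)[OF p(1)]] K by (intro mult_left_mono) auto
    then show "- K * w_sum \<le> v" using ent_nonneg[OF p(1)] by (simp add: p fe_def)
  qed
  have ne: "V \<noteq> {}" using q_unif_fin_ent by (auto simp: V_def)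
  have "\<exists>p. fin_ent p \<and> fe K p < Inf V + 1 / real (Suc n)" for n
  proof -
    have "\<exists>v\<in>V. v < Inf V + 1 / real (Suc n)"
      using cInf_less_iff[OF ne bdd, of "Inf V + 1 / real (Suc n)"] by simp
    then show ?thesis by (auto simp: V_def)
  qed
  then obtain p where p: "\<And>n. fin_ent (p n)" "\<And>n. fe K (p n) < Inf V + 1 / real (Suc n)" by metis
  obtain r q where r: "strict_mono r" and q: "fin_ent q" and lim: "(\<lambda>n. fe K (selfc K (p (r n)))) \<longlonglongrightarrow> fe K q"
    using selfc_compact[of p "\<lambda>_. K" K] p(1) K by auto
  have "(\<lambda>n. Inf V + 1 / real (Suc (r n))) \<longlonglongrightarrow> Inf V + 0"
    using LIMSEQ_subseq_LIMSEQ[OF LIMSEQ_inverse_real_of_nat r]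
    by (intro tendsto_add tendsto_const) (simp add: o_def inverse_eq_divide)
  then have "fe K q \<le> Inf V + 0"
  proof (rule LIMSEQ_le[OF lim])
    show "\<exists>N. \<forall>n\<ge>N. fe K (selfc K (p (r n))) \<le> Inf V + 1 / real (Suc (r n))"
      using order_trans[OF fe_selfc_le(2)[OF p(1) K] less_imp_le[OF p(2)]] by blast
  qed
  moreover have "Inf V \<le> fe K p'" if "fin_ent p'" for p'
    using that by (intro cInf_lower bdd) (auto simp: V_def)
  ultimately have "global_minimizer W K q"
    using q unfolding global_minimizer_iff by force
  then show ?thesis by blast
qed

end

section \<open>The critical coupling and the nature of the transition\<close>

lemma integrable_cos_torus: "integrable torus_measure (\<lambda>x. cos (c * x))"
  and integrable_sin_torus: "integrable torus_measure (\<lambda>x. sin (c * x))"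
  using integrable_cos_mult[of "\<lambda>_. 1" c] integrable_sin_mult[of "\<lambda>_. 1" c] by simp_all

lemma cosc_cos: "cosc (\<lambda>x. cos (2 * pi * real k * x)) j = (if j = k then if k = 0 then 1 else 1/2 else 0)"
proof -
  have "cosc (\<lambda>x. cos (2 * pi * real k * x)) j = integral\<^sup>L torus_measure (\<lambda>x. (cos (2 * pi * of_int (int j - int k) * x) + cos (2 * pi * of_int (int j + int k) * x)) / 2)"
    unfolding cosc_def
    by (intro Bochner_Integration.integral_cong refl, subst cos_times_cos) (simp add: algebra_simps)
  also have "\<dots> = ((if int j - int k = 0 then 1 else 0) + (if int j + int k = 0 then 1 else 0)) / 2"
    by (subst integral_divide_zero, subst Bochner_Integration.integral_add)
       (intro integrable_cos_torus, intro integrable_cos_torus, simp only: integral_cos_int)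
  finally show ?thesis by auto
qed

lemma sinc_cos: "sinc (\<lambda>x. cos (2 * pi * real k * x)) j = 0"
proof -
  have "sinc (\<lambda>x. cos (2 * pi * real k * x)) j = integral\<^sup>L torus_measure (\<lambda>x. (sin (2 * pi * of_int (int j + int k) * x) + sin (2 * pi * of_int (int j - int k) * x)) / 2)"
    unfolding sinc_def
    by (intro Bochner_Integration.integral_cong refl, subst sin_times_cos) (simp add: algebra_simps)
  also have "\<dots> = 0"
    by (subst integral_divide_zero, subst Bochner_Integration.integral_add)
       (intro integrable_sin_torus, intro integrable_sin_torus, simp only: integral_sin_int, simp)
  finally show ?thesis .
qed

lemma cosc_sin: "cosc (\<lambda>x. sin (2 * pi * real k * x)) j = 0"
  using sinc_cos[of j k] by (simp add: cosc_def sinc_def mult.commute)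

lemma sinc_sin: "sinc (\<lambda>x. sin (2 * pi * real k * x)) j = (if j = k \<and> k \<noteq> 0 then 1/2 else 0)"
proof -
  have "sinc (\<lambda>x. sin (2 * pi * real k * x)) j = integral\<^sup>L torus_measure (\<lambda>x. (cos (2 * pi * of_int (int j - int k) * x) - cos (2 * pi * of_int (int j + int k) * x)) / 2)"
    unfolding sinc_def
    by (intro Bochner_Integration.integral_cong refl, subst sin_times_sin) (simp add: algebra_simps)
  also have "\<dots> = ((if int j - int k = 0 then 1 else 0) - (if int j + int k = 0 then 1 else 0)) / 2"
    by (subst integral_divide_zero, subst Bochner_Integration.integral_diff)
       (intro integrable_cos_torus, intro integrable_cos_torus, simp only: integral_cos_int)
  finally show ?thesis by auto
qed

section \<open>Uniform minimality as a comparison of entropy with excess interaction\<close>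

context cosine_kernel
begin

definition excess :: "(real \<Rightarrow> real) \<Rightarrow> real" where
  "excess q = interaction W q - interaction W q_unif"

text \<open>Minimality of \<open>q_unif\<close> rewritten so that \<open>K\<close> enters linearly
  with a nonnegative coefficient: the admissible \<open>K \<ge> 0\<close> form an interval
  containing \<open>0\<close>.\<close>

definition unif_min :: "real \<Rightarrow> bool" where
  "unif_min K \<longleftrightarrow> (\<forall>p. fin_ent p \<longrightarrow> K * excess p \<le> ent p)"

lemma excess_nonneg: "q \<in> densities \<Longrightarrow> 0 \<le> excess q"
  unfolding excess_def by (rule sums_le[OF _ sums_zero excess_sums]) (simp_all add: w_nonneg)

lemma fe_diff: "fe K p - fe K q_unif = ent p - K * excess p"
  by (simp add: fe_def excess_def ent_q_unif algebra_simps)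

lemma global_minimizer_unif_iff: "global_minimizer W K q_unif \<longleftrightarrow> unif_min K"
proof -
  have "fe K q_unif \<le> fe K p \<longleftrightarrow> K * excess p \<le> ent p" for p
    using fe_diff[of K p] by linarith
  then show ?thesis by (simp add: global_minimizer_iff unif_min_def q_unif_fin_ent)
qed

lemma global_minimizer_ent_le: "global_minimizer W K q \<Longrightarrow> ent q \<le> K * excess q"
  using fe_diff[of K q] q_unif_fin_ent by (force simp: global_minimizer_iff)

text \<open>Uniqueness of minimisers is meant almost everywhere, so entropy and interaction must be
  seen not to depend on the representative.\<close>

lemma same_measure_unif:
  assumes q: "fin_ent q" and same: "same_measure q q_unif"
  shows "ent q = 0" "excess q = 0"
proof -
  note q' = fin_entD[OF q]
  have qm: "q \<in> borel_measurable torus_measure" using q'(2) by auto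
  have ae: "AE x in torus_measure. q x = 1" using same by (simp add: same_measure_def q_unif_def)
  have "ent q = integral\<^sup>L torus_measure (\<lambda>x. 0)"
    unfolding ent_def by (rule integral_cong_AE) (use q'(4) ae in auto)
  then show "ent q = 0" by simp
  have "cosc q k = cosc q_unif k" "sinc q k = sinc q_unif k" for k
    unfolding cosc_def sinc_def using ae qm
    by (auto intro!: integral_cong_AE borel_measurable_times cos_measurable sin_measurable simp: q_unif_def)
  then have "interaction W q = interaction W q_unif"
    using q'(2) fin_entD(2)[OF q_unif_fin_ent] by (simp add: interaction_eq bil_def)
  then show "excess q = 0" by (simp add: excess_def)
qed

lemma unif_minI:
  assumes q: "global_minimizer W K q" and same: "same_measure q q_unif"
  shows "unif_min K"
proof -
  have "fin_ent q" using q by (simp add: global_minimizer_iff)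
  then have "fe K q = fe K q_unif"
    using fe_diff[of K q] same_measure_unif[OF _ same] by simp
  then have "global_minimizer W K q_unif"
    using q q_unif_fin_ent by (simp add: global_minimizer_iff)
  then show ?thesis by (simp add: global_minimizer_unif_iff)
qed

lemma critical_couplingI:
  assumes "0 \<le> Kc" "unif_min Kc" "\<And>K. Kc < K \<Longrightarrow> \<not> unif_min K"
  shows "critical_coupling W Kc"
  unfolding critical_coupling_def
proof (intro conjI allI impI)
  fix K assume K: "0 \<le> K \<and> K < Kc"
  show "global_minimizer W K q_unif"
    unfolding global_minimizer_unif_iff unif_min_def
  proof (intro allI impI)
    fix p assume p: "fin_ent p"
    have "K * excess p \<le> Kc * excess p"
      using K excess_nonneg[OF fin_entD(1)[OF p]] by (intro mult_right_mono) auto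
    then show "K * excess p \<le> ent p" using assms(2) p unfolding unif_min_def by force
  qed
  fix q assume q: "global_minimizer W K q"
  then have fq: "fin_ent q" by (simp add: global_minimizer_iff)
  \<comment> \<open>\<open>ent q\<close> is bounded below by optimality of the uniform state at
    \<open>Kc\<close> and above by optimality of \<open>q\<close> at the smaller \<open>K\<close>.
    Hence the excess vanishes, and the entropy with it.\<close>
  have "Kc * excess q \<le> K * excess q"
    using assms(2) fq global_minimizer_ent_le[OF q] unfolding unif_min_def by force
  then have "(Kc - K) * excess q \<le> 0" by (simp add: algebra_simps)
  then have "excess q = 0"
    using excess_nonneg[OF fin_entD(1)[OF fq]] K by (simp add: mult_le_0_iff)
  then show "same_measure q q_unif"
    using global_minimizer_ent_le[OF q] ent_nonneg[OF fq] ent_eq_0[OF fq] by simp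
next
  show "global_minimizer W Kc q_unif" by (simp add: global_minimizer_unif_iff assms)
  fix K assume K: "Kc < K"
  obtain q where q: "global_minimizer W K q" using ex_global_minimizer[of K] K assms(1) by auto
  then have fq: "fin_ent q" by (simp add: global_minimizer_iff)
  have "\<not> same_measure q q_unif" using unif_minI[OF q] assms(3)[OF K] by blast
  then show "\<exists>q. global_minimizer W K q \<and> \<not> same_measure q q_unif" using q by blast
qed (use assms in auto)

text \<open>The threshold is the infimum of \<open>ent p / excess p\<close> over states of positive
  excess, reached as the supremum of admissible couplings. The defining inequalities are closed, so
  they persist at the supremum; a state violating them at \<open>K\<close> has a ratio below
  \<open>K\<close>, whence the strict bound.\<close>

lemma ex_unif_threshold:
  assumes K: "0 \<le> K" "\<not> unif_min K"
  obtains Kc where "0 \<le> Kc" "Kc < K" "unif_min Kc" "\<And>K. Kc < K \<Longrightarrow> \<not> unif_min K"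
proof -
  define G where "G = {K. 0 \<le> K \<and> unif_min K}"
  obtain p where p: "fin_ent p" "ent p < K * excess p" using K by (auto simp: unif_min_def not_le)
  have ex: "0 < excess p"
    using excess_nonneg[OF fin_entD(1)[OF p(1)]] p ent_nonneg[OF p(1)] by (cases "excess p = 0") auto
  have G_le: "L \<le> ent p / excess p" if "L \<in> G" for L
    using that p ex by (auto simp: G_def unif_min_def field_simps)
  then have bdd: "bdd_above G" by (rule bdd_aboveI)
  have 0: "0 \<in> G" using ent_nonneg by (auto simp: G_def unif_min_def)
  show ?thesis
  proof (rule that[of "Sup G"])
    show S0: "0 \<le> Sup G" by (rule cSup_upper[OF 0 bdd])
    have "Sup G \<le> ent p / excess p" using 0 G_le by (intro cSup_least) auto
    also have "\<dots> < K" using p ex by (simp add: field_simps)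
    finally show "Sup G < K" .
    show "unif_min (Sup G)"
      unfolding unif_min_def
    proof (intro allI impI)
      fix r assume r: "fin_ent r"
      show "Sup G * excess r \<le> ent r"
      proof (cases "excess r = 0")
        case True then show ?thesis using ent_nonneg[OF r] by simp
      next
        case False
        then have e: "0 < excess r" using excess_nonneg[OF fin_entD(1)[OF r]] by simp
        have "Sup G \<le> ent r / excess r"
          using 0 r e by (intro cSup_least) (auto simp: G_def unif_min_def field_simps)
        then show ?thesis using e by (simp add: field_simps)
      qed
    qed
    show "\<not> unif_min L" if "Sup G < L" for L
      using that S0 cSup_upper[OF _ bdd, of L] by (auto simp: G_def)
  qed
qed

text \<open>If convergence failed along couplings tending to \<open>Kc\<close> from above,
  compactness would produce a limit state at \<open>Kc\<close> with energy at most that of the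
  uniform state, hence uniform by \<open>uniq\<close>. Minimisers agree with their
  \<open>selfc\<close> images almost everywhere, so the limit of the images is a limit of the
  minimisers.\<close>

lemma continuous_transitionI:
  assumes Kc: "0 \<le> Kc"
    and uniq: "\<And>q. fin_ent q \<Longrightarrow> ent q \<le> Kc * excess q \<Longrightarrow> same_measure q q_unif"
  shows "continuous_transition W Kc"
  unfolding continuous_transition_def
proof (intro conjI allI impI)
  show "same_measure q q_unif" if "global_minimizer W Kc q" for q
    using that uniq[of q] global_minimizer_ent_le[OF that] by (simp add: global_minimizer_iff)
next
  fix qf :: "real \<Rightarrow> real \<Rightarrow> real" assume qf: "\<forall>K>Kc. global_minimizer W K (qf K)"
  define X where "X K = integral\<^sup>L torus_measure (\<lambda>x. \<bar>qf K x - q_unif x\<bar>)" for K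
  have "(X \<longlongrightarrow> 0) (at_right Kc)"
  proof (rule tendsto_at_right_sequentially)
    show "Kc < Kc + 1" by simp
    fix S :: "nat \<Rightarrow> real" assume S: "\<And>n. Kc < S n" "S \<longlonglongrightarrow> Kc"
    show "(\<lambda>n. X (S n)) \<longlonglongrightarrow> 0"
    proof (rule ccontr)
      assume "\<not> ?thesis"
      then obtain e where e: "0 < e" "\<not> (\<exists>N. \<forall>n\<ge>N. norm (X (S n)) < e)"
        unfolding LIMSEQ_iff by auto
      then have "infinite {n. e \<le> norm (X (S n))}"
        unfolding infinite_nat_iff_unbounded_le by (auto simp: not_less)
      then obtain s where s: "strict_mono (s :: nat \<Rightarrow> nat)" "\<And>n. e \<le> norm (X (S (s n)))"
        using infinite_enumerate[of "{n. e \<le> norm (X (S n))}"] by auto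
      define K where "K n = S (s n)" for n
      have K: "0 \<le> K n" "Kc < K n" for n using S(1)[of "s n"] Kc by (auto simp: K_def)
      have Klim: "K \<longlonglongrightarrow> Kc" using LIMSEQ_subseq_LIMSEQ[OF S(2) s(1)] by (simp add: K_def[abs_def] o_def)
      define q where "q n = qf (K n)" for n
      have min: "global_minimizer W (K n) (q n)" for n using qf K by (simp add: q_def)
      then have fq: "fin_ent (q n)" for n by (simp add: global_minimizer_iff)
      obtain r q' where r: "strict_mono r" and q': "fin_ent q'"
        and fl: "(\<lambda>n. fe (K (r n)) (selfc (K (r n)) (q (r n)))) \<longlonglongrightarrow> fe Kc q'"
        and L1: "(\<lambda>n. integral\<^sup>L torus_measure (\<lambda>x. \<bar>selfc (K (r n)) (q (r n)) x - q' x\<bar>)) \<longlonglongrightarrow> 0"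
        using selfc_compact[of q K Kc, OF fq K(1) Klim] by blast
      have "fe Kc q' \<le> fe Kc q_unif"
      proof (rule LIMSEQ_le[OF fl])
        show "(\<lambda>n. fe (K (r n)) q_unif) \<longlonglongrightarrow> fe Kc q_unif"
          unfolding fe_def using LIMSEQ_subseq_LIMSEQ[OF Klim r]
          by (intro tendsto_diff tendsto_mult tendsto_const) (simp add: o_def)
        have "fe (K n) (selfc (K n) (q n)) \<le> fe (K n) q_unif" for n
          using fe_selfc_le(2)[OF fq[of n] K(1)[of n]] min[of n] q_unif_fin_ent
          by (force simp: global_minimizer_iff)
        then show "\<exists>N. \<forall>n\<ge>N. fe (K (r n)) (selfc (K (r n)) (q (r n))) \<le> fe (K (r n)) q_unif" by blast
      qed
      then have same: "same_measure q' q_unif" using uniq[OF q'] fe_diff[of Kc q'] by simp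
      have "X (K n) = integral\<^sup>L torus_measure (\<lambda>x. \<bar>selfc (K n) (q n) x - q' x\<bar>)" for n
        unfolding X_def q_def[symmetric]
      proof (rule integral_cong_AE)
        show "AE x in torus_measure. \<bar>q n x - q_unif x\<bar> = \<bar>selfc (K n) (q n) x - q' x\<bar>"
          using minimizer_fixed_point[OF min K(1), of n] same unfolding same_measure_def
          by eventually_elim simp
      qed (use fin_entD(2)[OF fq] fin_entD(2)[OF q'] fin_entD(2)[OF q_unif_fin_ent]
          fin_entD(2)[OF fe_selfc_le(1)[OF fq K(1)]] in \<open>auto simp: q_unif_def\<close>)
      then have "(\<lambda>n. X (K (r n))) \<longlonglongrightarrow> 0" using L1 by simp
      then obtain n where "norm (X (K (r n))) < e"
        using e(1) unfolding LIMSEQ_iff by force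
      then show False using s(2)[of "r n"] by (simp add: K_def)
    qed
  qed
  then show "((\<lambda>K. integral\<^sup>L torus_measure (\<lambda>x. \<bar>qf K x - q_unif x\<bar>)) \<longlongrightarrow> 0) (at_right Kc)"
    by (simp add: X_def[abs_def])
qed

text \<open>The series \<open>V\<close> lies between the scaled excess and the entropy. If these
  agree, the comparison is tight in every term, which kills all modes \<open>k \<ge> 3\<close>. A
  tie at \<open>k = 2\<close> is permitted; the equality case of the two-mode entropy bound then
  settles the first two modes.\<close>

lemma sharp_uniqueness:
  assumes w1: "0 < w 1" and le: "\<And>k. 1 \<le> k \<Longrightarrow> real k * w k \<le> w 1"
    and less: "\<And>k. 3 \<le> k \<Longrightarrow> real k * w k < w 1" and q: "fin_ent q"
  shows "1 / w 1 * excess q \<le> ent q"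
    and "ent q \<le> 1 / w 1 * excess q \<Longrightarrow> same_measure q q_unif"
proof -
  define m where "m k = (cosc q k)\<^sup>2 + (sinc q k)\<^sup>2" for k
  have m0: "0 \<le> m k" for k by (simp add: m_def)
  have S: "(\<lambda>k. 1 / w 1 * (w (Suc k) * m (Suc k))) sums (1 / w 1 * excess q)"
    unfolding excess_def m_def by (intro sums_mult excess_sums fin_entD(1)[OF q])
  have E: "(\<Sum>k<N. m (Suc k) / real (Suc k)) \<le> ent q" for N
    using entropy_ge_sum_fourier(1)[OF q, of N] unfolding m_def[symmetric] by (simp add: sum.atLeast1_atMost_eq del: of_nat_Suc)
  have le': "1 / w 1 * (w (Suc k) * m (Suc k)) \<le> m (Suc k) / real (Suc k)" for k
  proof -
    have "w (Suc k) / w 1 \<le> 1 / real (Suc k)"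
      using le[of "Suc k"] w1 by (simp add: field_simps)
    from mult_right_mono[OF this m0[of "Suc k"]] show ?thesis by simp
  qed
  have summ: "summable (\<lambda>k. m (Suc k) / real (Suc k))"
    using E m0 by (intro summableI_nonneg_bounded[where x="ent q"]) auto
  define V where "V = (\<Sum>k. m (Suc k) / real (Suc k))"
  have V: "(\<lambda>k. m (Suc k) / real (Suc k)) sums V" unfolding V_def using summ by (rule summable_sums)
  have VE: "V \<le> ent q" unfolding V_def using E by (intro suminf_le_const summ) auto
  have SV: "1 / w 1 * excess q \<le> V" by (rule sums_le[OF le' S V])
  then show "1 / w 1 * excess q \<le> ent q" using VE by simp
  assume "ent q \<le> 1 / w 1 * excess q"
  then have eq: "1 / w 1 * excess q = V" "ent q = V" using VE SV by auto
  have "(\<lambda>k. m (Suc k) / real (Suc k) - 1 / w 1 * (w (Suc k) * m (Suc k))) sums 0"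
    using sums_diff[OF V S] eq by simp
  then have z: "m (Suc k) / real (Suc k) = 1 / w 1 * (w (Suc k) * m (Suc k))" for k
    using le' suminf_eq_zero_iff[of "\<lambda>k. m (Suc k) / real (Suc k) - 1 / w 1 * (w (Suc k) * m (Suc k))"]
    by (simp add: sums_iff)
  have m3: "m k = 0" if "3 \<le> k" for k
  proof (rule ccontr)
    assume "m k \<noteq> 0"
    obtain j where j: "k = Suc j" using \<open>3 \<le> k\<close> by (cases k) auto
    from z[of j] \<open>m k \<noteq> 0\<close> w1 have "real k * w k = w 1"
      unfolding j by (simp add: field_simps del: of_nat_Suc)
    then show False using less[OF that] by simp
  qed
  have "(\<lambda>k. m (Suc k) / real (Suc k)) sums (\<Sum>k<2. m (Suc k) / real (Suc k))"
    by (rule sums_finite) (auto simp: m3)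
  then have V2: "V = (\<Sum>k<2. m (Suc k) / real (Suc k))" using V sums_unique2 by blast
  then have "ent q = (\<Sum>k=1..2. m k / real k)"
    by (simp add: eq(2) sum.atLeast1_atMost_eq del: of_nat_Suc)
  then have "cosc q 1 = 0 \<and> sinc q 1 = 0 \<and> cosc q 2 = 0 \<and> sinc q 2 = 0"
    unfolding m_def by (intro entropy_ge_sum_fourier(2)[OF q, of 2]) auto
  then have "V = 0" using V2 by (simp add: m_def numeral_2_eq_2)
  then show "same_measure q q_unif" using ent_eq_0[OF q] eq by simp
qed

end

section \<open>Taylor bounds and small trial states\<close>

lemma exp_le_quadratic:
  fixes t :: real
  assumes "\<bar>t\<bar> \<le> 1"
  shows "exp t \<le> 1 + t + (1/2 + \<bar>t\<bar>) * t\<^sup>2"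
proof -
  obtain s where s: "\<bar>s\<bar> \<le> \<bar>t\<bar>" "exp t = (\<Sum>m<3. t ^ m / fact m) + exp s / fact 3 * t ^ 3"
    using Maclaurin_exp_le[of t 3] by auto
  have "exp s \<le> exp 1" using s assms by simp
  \<comment> \<open>Thus \<open>exp s / fact 3 \<le> 1\<close>, and the cubic remainder is absorbed
    into \<open>\<bar>t\<bar> * t^2\<close>.\<close>
  then have "exp s \<le> 3" using exp_le by linarith
  have "exp s / fact 3 * t ^ 3 \<le> exp s / fact 3 * (\<bar>t\<bar> * t\<^sup>2)"
    using mult_right_mono[OF abs_ge_self[of t], of "t\<^sup>2"]
    by (intro mult_left_mono) (simp_all add: power3_eq_cube power2_eq_square mult.assoc)
  also have "\<dots> \<le> 1 * (\<bar>t\<bar> * t\<^sup>2)"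
    using \<open>exp s \<le> 3\<close> by (intro mult_right_mono) (auto simp: fact_numeral)
  finally show ?thesis
    unfolding s(2) by (simp add: numeral_3_eq_3 algebra_simps power2_eq_square)
qed

text \<open>The difference of the two sides has derivative \<open>t^5 / (1 + t)\<close>, which has
  the sign of \<open>t\<close>, so its minimum is at \<open>0\<close>. An odd degree is what makes
  the Taylor polynomial an upper bound on both sides of \<open>0\<close>.\<close>

lemma ln_le_taylor5:
  fixes u :: real
  assumes "-1 < u"
  shows "ln (1 + u) \<le> u - u^2/2 + u^3/3 - u^4/4 + u^5/5"
proof -
  define \<phi> where "\<phi> u = u - u^2/2 + u^3/3 - u^4/4 + u^5/5 - ln (1 + u)" for u :: real
  have d: "(\<phi> has_real_derivative (t^5 / (1 + t))) (at t)" if "-1 < t" for t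
    unfolding \<phi>_def using that
    by (auto intro!: derivative_eq_intros simp: field_simps power_numeral_reduce)
  have "\<phi> 0 \<le> \<phi> u"
  proof (cases "0 \<le> u")
    case True
    then show ?thesis
    proof (rule DERIV_nonneg_imp_nondecreasing)
      fix t assume "0 \<le> t" "t \<le> u"
      then show "\<exists>y. (\<phi> has_real_derivative y) (at t) \<and> 0 \<le> y" using d[of t] by auto
    qed
  next
    case False
    then have "u \<le> 0" by simp
    then show ?thesis
    proof (rule DERIV_nonpos_imp_nonincreasing)
      fix t assume t: "u \<le> t" "t \<le> 0"
      then have "t^5 / (1 + t) \<le> 0" using assms by (intro divide_nonpos_pos) (auto simp: power_numeral_reduce mult_nonpos_nonneg mult_nonneg_nonpos split_mult_pos_le)
      then show "\<exists>y. (\<phi> has_real_derivative y) (at t) \<and> y \<le> 0" using d[of t] t assms by auto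
    qed
  qed
  then show ?thesis by (simp add: \<phi>_def)
qed

lemma xlnx_le_taylor:
  fixes u e :: real
  assumes "\<bar>u\<bar> \<le> e" "e \<le> 1/2"
  shows "(1 + u) * ln (1 + u) \<le> u + u^2/2 - u^3/6 + u^4/12 + e^5"
proof -
  have "(1 + u) * ln (1 + u) \<le> (1 + u) * (u - u^2/2 + u^3/3 - u^4/4 + u^5/5)"
    using assms by (intro mult_left_mono ln_le_taylor5) auto
  also have "\<dots> = u + u^2/2 - u^3/6 + u^4/12 + u^5 * (u/5 - 1/20)"
    by (simp add: field_simps power_numeral_reduce)
  \<comment> \<open>For \<open>\<bar>u\<bar> \<le> 1/2\<close> the bracket has modulus below
    \<open>1\<close>. A crude fifth order is enough, since the trial computation is decided at order
    four.\<close>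
  also have "u^5 * (u/5 - 1/20) \<le> e^5 * 1"
  proof -
    have "u^5 * (u/5 - 1/20) \<le> \<bar>u^5\<bar> * \<bar>u/5 - 1/20\<bar>" by (metis abs_ge_self abs_mult)
    also have "\<dots> \<le> e^5 * 1"
      using assms by (intro mult_mono) (auto simp: power_abs intro!: power_mono)
    finally show ?thesis .
  qed
  finally show ?thesis by simp
qed

text \<open>The Poisson kernel of radius \<open>\<gamma>\<close>, truncated after the second mode; Poisson kernels are the
  extremals of the logarithmic Hardy-Littlewood-Sobolev inequality.\<close>
definition trial :: "real \<Rightarrow> real \<Rightarrow> real" where
  "trial \<gamma> x = 1 + 2 * \<gamma> * cos (2 * pi * real 1 * x) + 2 * \<gamma>\<^sup>2 * cos (2 * pi * real 2 * x)"

text \<open>\<open>\<gamma>^2 + \<gamma>^4 / 2\<close> is the lower bound of the logarithmic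
  inequality for these two modes. The restriction \<open>\<gamma> \<le> 1/8\<close> keeps the
  perturbation within \<open>1/2\<close>, as the Taylor bound requires;
  \<open>1044 = 4^5 + 20\<close> collects the remainders.\<close>

lemma trial_properties:
  assumes \<gamma>: "0 < \<gamma>" "\<gamma> \<le> 1/8"
  shows "fin_ent (trial \<gamma>)" "cosc (trial \<gamma>) 1 = \<gamma>" "cosc (trial \<gamma>) 2 = \<gamma>\<^sup>2"
    "ent (trial \<gamma>) \<le> \<gamma>^2 + \<gamma>^4/2 + 1044 * \<gamma>^5"
proof -
  define C where "C k x = cos (2 * pi * real k * x)" for k x
  have Ci: "integrable torus_measure (C k)" for k
    unfolding C_def by (rule integrable_cos_torus)
  have CI: "integral\<^sup>L torus_measure (C k) = (if k = 0 then 1 else 0)" for k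
    unfolding C_def by (rule integral_cos_torus)
  \<comment> \<open>Chebyshev recursion; the conditional is the absolute difference of
    \<open>j\<close> and \<open>k\<close>, written so that subtraction on naturals never
    truncates.\<close>
  have CC: "C (j + k) x = 2 * C j x * C k x - C (if j \<le> k then k - j else j - k) x" for j k x
  proof -
    have "C (if j \<le> k then k - j else j - k) x = cos (2 * pi * real j * x - 2 * pi * real k * x)"
    proof (cases "j \<le> k")
      case True
      then have "2 * pi * real j * x - 2 * pi * real k * x = - (2 * pi * real (k - j) * x)"
        by (simp add: of_nat_diff algebra_simps)
      then show ?thesis using True by (simp only: cos_minus C_def if_True)
    qed (auto simp: C_def of_nat_diff algebra_simps)
    moreover have "C (j + k) x = cos (2 * pi * real j * x + 2 * pi * real k * x)"
      by (simp add: C_def algebra_simps)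
    ultimately show ?thesis by (simp add: C_def cos_add cos_diff)
  qed
  have C0: "C 0 x = 1" for x by (simp add: C_def)
  define c where "c = C 1"
  have C2: "C 2 x = 2 * c x ^ 2 - 1" for x using CC[of 1 1 x] by (simp add: c_def C0 power2_eq_square numeral_2_eq_2)
  have C3: "C 3 x = 4 * c x ^ 3 - 3 * c x" for x
    using CC[of 2 1 x] by (simp add: C2 c_def power_numeral_reduce numeral_3_eq_3 algebra_simps)
  have C4: "C 4 x = 8 * c x ^ 4 - 8 * c x ^ 2 + 1" for x
    using CC[of 2 2 x] by (simp add: C2 C0) (simp add: power_numeral_reduce algebra_simps)
  have C5: "C 5 x = 2 * C 4 x * c x - C 3 x" for x
    using CC[of 4 1 x] by (simp add: c_def)
  have C6: "C 6 x = 2 * C 4 x * C 2 x - C 2 x" for x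
    using CC[of 4 2 x] by simp
  define u where "u x = 2 * \<gamma> * c x + 2 * \<gamma>\<^sup>2 * C 2 x" for x
  have tr: "trial \<gamma> x = 1 + u x" for x by (simp add: trial_def u_def c_def C_def)
  have c1: "\<bar>C k x\<bar> \<le> 1" for k x by (simp add: C_def)
  have g2: "\<gamma>\<^sup>2 \<le> \<gamma>" using \<gamma> by (simp add: power2_eq_square mult_left_le)
  have u_le: "\<bar>u x\<bar> \<le> 4 * \<gamma>" for x
  proof -
    have "\<bar>u x\<bar> \<le> 2 * \<gamma> * \<bar>C 1 x\<bar> + 2 * \<gamma>\<^sup>2 * \<bar>C 2 x\<bar>"
      unfolding u_def c_def using \<gamma> by (intro order_trans[OF abs_triangle_ineq]) (simp add: abs_mult)
    also have "\<dots> \<le> 2 * \<gamma> * 1 + 2 * \<gamma> * 1"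
      using \<gamma> g2 c1 by (intro add_mono mult_mono) auto
    finally show ?thesis by simp
  qed
  have pos: "1/2 \<le> trial \<gamma> x" for x using u_le[of x] \<gamma> unfolding tr by (simp add: abs_le_iff)
  have cont: "continuous_on S (trial \<gamma>)" for S unfolding trial_def by (intro continuous_intros)
  have ti: "integrable torus_measure (trial \<gamma>)" by (rule cont_imp_integrable_torus[OF cont])
  have tli: "integrable torus_measure (\<lambda>x. trial \<gamma> x * ln (trial \<gamma> x))"
    using pos by (intro cont_imp_integrable_torus continuous_intros cont) (metis not_one_le_zero divide_le_0_1_iff zero_less_numeral not_less order_refl)
  have "trial \<gamma> = (\<lambda>x. C 0 x + (2 * \<gamma> * C 1 x + 2 * \<gamma>\<^sup>2 * C 2 x))"
    by (simp add: trial_def C_def fun_eq_iff)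
  then have "integral\<^sup>L torus_measure (trial \<gamma>) = 1"
    using Ci CI by (simp add: )
  moreover have "0 \<le> trial \<gamma> x" for x using pos[of x] by simp
  ultimately show "fin_ent (trial \<gamma>)"
    using ti tli by (auto simp: fin_ent_def densities_def)
  have "cosc (trial \<gamma>) j = cosc (C 0) j + (2 * \<gamma> * cosc (C 1) j + 2 * \<gamma>\<^sup>2 * cosc (C 2) j)" for j
  proof -
    have "cosc (trial \<gamma>) j = integral\<^sup>L torus_measure (\<lambda>x. cos (2 * pi * real j * x) * C 0 x + (2 * \<gamma> * (cos (2 * pi * real j * x) * C 1 x) + 2 * \<gamma>\<^sup>2 * (cos (2 * pi * real j * x) * C 2 x)))"
      unfolding cosc_def by (intro Bochner_Integration.integral_cong refl) (simp add: trial_def C_def algebra_simps)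
    also have "\<dots> = cosc (C 0) j + (2 * \<gamma> * cosc (C 1) j + 2 * \<gamma>\<^sup>2 * cosc (C 2) j)"
      using integrable_cos_mult[OF Ci] by (simp add: cosc_def)
    finally show ?thesis .
  qed
  then show "cosc (trial \<gamma>) 1 = \<gamma>" "cosc (trial \<gamma>) 2 = \<gamma>\<^sup>2"
    unfolding C_def cosc_cos by simp_all
  \<comment> \<open>The Taylor bound expanded in cosines; only the constant survives integration. In
    it, \<open>\<gamma>\<^sup>2 + \<gamma>^4\<close> comes from the quadratic term,
    \<open>- \<gamma>^4\<close> from the cubic and \<open>\<gamma>^4/2\<close> from the
    quartic.\<close>
  let ?P = "\<lambda>x. (\<gamma>\<^sup>2 + \<gamma>^4 - \<gamma>^4 + \<gamma>^4/2 + 1044 * \<gamma>^5) + (2 * \<gamma> + 2 * \<gamma>^3 - \<gamma>^3 - 2 * \<gamma>^5) * C 1 x + (2 * \<gamma>^2 + \<gamma>\<^sup>2 - 2 * \<gamma>^4 - \<gamma>^6 + 2/3 * \<gamma>^4) * C 2 x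
      + (2 * \<gamma>^3 - \<gamma>^3/3 - \<gamma>^5) * C 3 x + (\<gamma>^4 - \<gamma>^4 + \<gamma>^4/6) * C 4 x - \<gamma>^5 * C 5 x - \<gamma>^6/3 * C 6 x"
  have "trial \<gamma> x * ln (trial \<gamma> x) \<le> ?P x" for x
  proof -
    have "(1 + u x) * ln (1 + u x) \<le> u x + u x^2/2 - u x^3/6 + u x^4/12 + (4 * \<gamma>)^5"
      by (rule xlnx_le_taylor[OF u_le]) (use \<gamma> in simp)
    \<comment> \<open>Only the leading part of the quartic is kept exactly. The other binomial
      coefficients add up to 15, and 15 times 16/12 is 20.\<close>
    moreover have "u x ^ 4 / 12 \<le> 4/3 * \<gamma>^4 * c x ^ 4 + 20 * \<gamma>^5"
    proof -
      define d where "d = C 2 x"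
      have a: "\<bar>c x\<bar> \<le> 1" "\<bar>d\<bar> \<le> 1" using c1 by (auto simp: c_def d_def)
      have "\<bar>c x ^ i * d ^ j\<bar> \<le> 1" for i j
        using a by (simp add: abs_mult power_abs power_le_one mult_le_one)
      from mult_left_mono[OF this, of "\<gamma>^n" for n]
      have m: "\<gamma>^n * (c x ^ i * d ^ j) \<le> \<gamma>^n" for n i j
        using \<gamma> by (smt (verit) \<open>\<And>j i. \<bar>c x ^ i * d ^ j\<bar> \<le> 1\<close> mult_left_le zero_le_power)
      have p: "\<gamma>^n \<le> \<gamma>" if "1 \<le> n" for n using \<gamma> that power_decreasing[of 1 n \<gamma>] by simp
      have "(c x + \<gamma> * d)^4 = c x^4 + 4 * (\<gamma>^1 * (c x^3 * d^1)) + 6 * (\<gamma>^2 * (c x^2 * d^2)) + 4 * (\<gamma>^3 * (c x^1 * d^3)) + \<gamma>^4 * (c x^0 * d^4)"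
        by (simp add: power_numeral_reduce algebra_simps)
      also have "\<dots> \<le> c x^4 + 4 * \<gamma> + 6 * \<gamma> + 4 * \<gamma> + \<gamma>"
        by (intro add_mono mult_left_mono order_trans[OF m p]) auto
      finally have "(c x + \<gamma> * d)^4 \<le> c x ^ 4 + 15 * \<gamma>" by simp
      from mult_left_mono[OF this, of "16 * \<gamma>^4 / 12"]
      have "16 * \<gamma>^4 / 12 * (c x + \<gamma> * d)^4 \<le> 16 * \<gamma>^4 / 12 * (c x ^ 4 + 15 * \<gamma>)" using \<gamma> by simp
      moreover have "u x ^ 4 / 12 = 16 * \<gamma>^4 / 12 * (c x + \<gamma> * d)^4"
        unfolding u_def d_def[symmetric] by (simp add: power_numeral_reduce algebra_simps)
      ultimately show ?thesis by (simp add: power_numeral_reduce algebra_simps)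
    qed
    moreover have "u x + u x^2/2 - u x^3/6 + 4/3 * \<gamma>^4 * c x ^ 4 + 20 * \<gamma>^5 + (4 * \<gamma>)^5 = ?P x"
      unfolding u_def C5 C6 C4 C3 C2 c_def[symmetric] by (simp add: power_numeral_reduce field_simps)
    ultimately show ?thesis unfolding tr by linarith
  qed
  then have "ent (trial \<gamma>) \<le> integral\<^sup>L torus_measure ?P"
    unfolding ent_def using tli Ci by (intro integral_mono) auto
  also have "\<dots> = \<gamma>^2 + \<gamma>^4/2 + 1044 * \<gamma>^5"
    using Ci CI by simp
  finally show "ent (trial \<gamma>) \<le> \<gamma>^2 + \<gamma>^4/2 + 1044 * \<gamma>^5" .
qed

section \<open>Isolation of the uniform state below the stability threshold\<close>

context cosine_kernel
begin

text \<open>Subtracting \<open>q_unif\<close> removes the zero mode and leaves every other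
  coefficient unchanged.\<close>

lemma bil_mean_zero_sums:
  assumes q: "q \<in> densities" and p: "integrable torus_measure p"
  shows "(\<lambda>k. w (Suc k) * (cosc p (Suc k) * cosc q (Suc k) + sinc p (Suc k) * sinc q (Suc k)))
    sums bil p (\<lambda>x. q x - q_unif x)"
proof -
  let ?u = "\<lambda>x. q x - q_unif x"
  have i1: "integrable torus_measure q_unif" by (simp add: q_unif_def)
  have i: "integrable torus_measure ?u" using i1 densitiesD[OF q] by simp
  have c: "cosc ?u k = cosc q k - cosc q_unif k" "sinc ?u k = sinc q k - sinc q_unif k" for k
    unfolding cosc_def sinc_def right_diff_distrib using i1 densitiesD[OF q]
    by (auto intro!: Bochner_Integration.integral_diff integrable_cos_mult integrable_sin_mult)
  have "(\<lambda>k. w k * (cosc p k * cosc ?u k + sinc p k * sinc ?u k)) sums bil p ?u"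
    unfolding bil_def by (intro summable_sums bil_summable i p)
  then have "(\<lambda>k. w (Suc k) * (cosc p (Suc k) * cosc ?u (Suc k) + sinc p (Suc k) * sinc ?u (Suc k))) sums bil p ?u"
    by (subst sums_Suc_iff) (simp add: c cosc_0[OF q] cosc_q_unif sinc_q_unif sinc_0)
  then show ?thesis by (simp add: c cosc_q_unif sinc_q_unif)
qed

text \<open>The Gibbs principle tested with \<open>2 * K * v\<close>, where \<open>v\<close> is the
  convolution of the deviation from uniform, gives \<open>K * excess q \<le> ln Z\<close>. As
  \<open>v\<close> has mean zero, \<open>Z - 1\<close> is of second order and at most
  \<open>K * excess q\<close> times \<open>(1 + 2 * \<tau>) * (K * w 1)\<close>. A factor below
  \<open>1\<close> forces zero excess. Here \<open>\<tau>\<close> bounds the exponent through the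
  \<open>L^1\<close> distance.\<close>

lemma local_uniqueness:
  assumes w1: "\<And>k. 1 \<le> k \<Longrightarrow> w k \<le> w 1" and K: "0 < K"
    and q: "fin_ent q" "ent q \<le> K * excess q"
  defines "\<tau> \<equiv> 2 * K * w_sum * integral\<^sup>L torus_measure (\<lambda>x. \<bar>q x - q_unif x\<bar>)"
  assumes \<tau>: "\<tau> \<le> 1" "(1 + 2 * \<tau>) * (K * w 1) < 1"
  shows "same_measure q q_unif"
proof -
  let ?u = "\<lambda>x. q x - q_unif x"
  define v where "v = conv ?u"
  note q' = fin_entD[OF q(1)]
  have d1: "q_unif \<in> densities" using q_unif_fin_ent by (rule fin_entD)
  note i1 = densitiesD(1)[OF d1]
  have i: "integrable torus_measure ?u" using i1 q' by simp
  have v_eq: "v = (\<lambda>x. conv q x - conv q_unif x)"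
    unfolding v_def conv_def right_diff_distrib
    by (intro ext Bochner_Integration.integral_diff conv_integrable q' i1)
  have vm: "v \<in> borel_measurable torus_measure"
    unfolding v_eq using conv_measurable[OF q'(1)] conv_measurable[OF d1] by simp
  have vb: "\<bar>2 * K * v x\<bar> \<le> \<tau>" for x
    using abs_conv_le[OF i, of x] K unfolding v_def \<tau>_def by (simp add: abs_mult)
  have vi: "integrable torus_measure v"
    using integrable_torus_mult[OF vm _ i1, of "\<tau> / (2 * K)"] vb K
    by (simp add: q_unif_def abs_mult field_simps)
  have fm: "(\<lambda>x. 2 * K * v x) \<in> borel_measurable torus_measure" using vm by simp
  have bil_q: "bil q ?u = excess q"
    using sums_unique2[OF bil_mean_zero_sums[OF q'(1) q'(2)], unfolded power2_eq_square[symmetric], OF excess_sums[OF q'(1)]]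
    by (simp add: excess_def)
  have "bil q_unif ?u = 0"
    using sums_unique2[OF bil_mean_zero_sums[OF q'(1) i1] ] by (simp add: cosc_q_unif sinc_q_unif)
  then have v0: "integral\<^sup>L torus_measure v = 0"
    using integral_conv(1)[OF i1 i] by (simp add: v_def q_unif_def)
  \<comment> \<open>Convolution multiplies a mode by the Fourier coefficient of \<open>W\<close>,
    which is half the weight; pairing with a single cosine or sine isolates it.\<close>
  have cv: "cosc v (Suc k) = w (Suc k) * cosc q (Suc k) / 2" and sv: "sinc v (Suc k) = w (Suc k) * sinc q (Suc k) / 2" for k
  proof -
    let ?c = "\<lambda>x. cos (2 * pi * real (Suc k) * x)" and ?s = "\<lambda>x. sin (2 * pi * real (Suc k) * x)"
    have B: "(\<lambda>j. if j = k then w (Suc k) * cosc q (Suc k) / 2 else 0) sums bil ?c ?u"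
      using bil_mean_zero_sums[OF q'(1) integrable_cos_torus, of "2 * pi * real (Suc k)"]
      by (simp only: cosc_cos sinc_cos) (simp add: if_distrib[of "\<lambda>x. _ * x"] if_distrib[of "\<lambda>x. x * _"] cong: if_cong)
    have "cosc v (Suc k) = bil ?c ?u"
      unfolding cosc_def v_def integral_conv(1)[OF integrable_cos_torus i, of "2 * pi * real (Suc k)", symmetric]
      by (intro Bochner_Integration.integral_cong refl mult.commute)
    also have "bil ?c ?u = w (Suc k) * cosc q (Suc k) / 2"
      by (rule sums_unique2[OF B sums_single[of k "\<lambda>_. w (Suc k) * cosc q (Suc k) / 2"]])
    finally show "cosc v (Suc k) = w (Suc k) * cosc q (Suc k) / 2" .
    have B: "(\<lambda>j. if j = k then w (Suc k) * sinc q (Suc k) / 2 else 0) sums bil ?s ?u"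
      using bil_mean_zero_sums[OF q'(1) integrable_sin_torus, of "2 * pi * real (Suc k)"]
      by (simp only: cosc_sin sinc_sin) (simp add: if_distrib[of "\<lambda>x. _ * x"] if_distrib[of "\<lambda>x. x * _"] cong: if_cong)
    have "sinc v (Suc k) = bil ?s ?u"
      unfolding sinc_def v_def integral_conv(1)[OF integrable_sin_torus i, of "2 * pi * real (Suc k)", symmetric]
      by (intro Bochner_Integration.integral_cong refl mult.commute)
    also have "bil ?s ?u = w (Suc k) * sinc q (Suc k) / 2"
      by (rule sums_unique2[OF B sums_single[of k "\<lambda>_. w (Suc k) * sinc q (Suc k) / 2"]])
    finally show "sinc v (Suc k) = w (Suc k) * sinc q (Suc k) / 2" .
  qed
  \<comment> \<open>Each mode of \<open>v\<close> squared carries two weights: one is replaced by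
    the largest, \<open>w 1\<close>, the other builds the excess.\<close>
  have vv: "integral\<^sup>L torus_measure (\<lambda>x. v x * v x) \<le> w 1 / 2 * excess q"
  proof -
    have "(\<lambda>k. w (Suc k) * (cosc v (Suc k) * cosc q (Suc k) + sinc v (Suc k) * sinc q (Suc k))) sums integral\<^sup>L torus_measure (\<lambda>x. v x * v x)"
      using bil_mean_zero_sums[OF q'(1) vi] integral_conv(1)[OF vi i] by (simp add: v_def)
    moreover have "(\<lambda>k. w 1 / 2 * (w (Suc k) * ((cosc q (Suc k))\<^sup>2 + (sinc q (Suc k))\<^sup>2))) sums (w 1 / 2 * excess q)"
      unfolding excess_def by (intro sums_mult excess_sums q')
    ultimately show ?thesis
    proof (rule sums_le[rotated])
      fix k
      have "w (Suc k) * (w (Suc k) * ((cosc q (Suc k))\<^sup>2 + (sinc q (Suc k))\<^sup>2) / 2) \<le> w 1 * (w (Suc k) * ((cosc q (Suc k))\<^sup>2 + (sinc q (Suc k))\<^sup>2) / 2)"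
        using w1[of "Suc k"] w_nonneg[of "Suc k"] by (intro mult_right_mono) auto
      then show "w (Suc k) * (cosc v (Suc k) * cosc q (Suc k) + sinc v (Suc k) * sinc q (Suc k)) \<le> w 1 / 2 * (w (Suc k) * ((cosc q (Suc k))\<^sup>2 + (sinc q (Suc k))\<^sup>2))"
        unfolding cv sv by (simp add: power2_eq_square algebra_simps)
    qed
  qed
  have vvi: "integrable torus_measure (\<lambda>x. v x * v x)"
    using integral_conv(2)[OF vi i] by (simp add: v_def)
  have \<tau>0: "0 \<le> \<tau>" using vb[of 0] by linarith
  define Z where "Z = integral\<^sup>L torus_measure (\<lambda>x. exp (2 * K * v x))"
  have "Z \<le> integral\<^sup>L torus_measure (\<lambda>x. 1 + 2 * K * v x + (1/2 + \<tau>) * (4 * K\<^sup>2 * (v x * v x)))"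
    unfolding Z_def
  proof (rule integral_mono)
    show "integrable torus_measure (\<lambda>x. exp (2 * K * v x))"
    proof (rule integrable_torus_bounded)
      show "norm (exp (2 * K * v x)) \<le> exp \<tau>" for x using vb[of x] by (simp add: abs_le_iff)
    qed (use fm in simp)
    show "exp (2 * K * v x) \<le> 1 + 2 * K * v x + (1/2 + \<tau>) * (4 * K\<^sup>2 * (v x * v x))" for x
    proof -
      have "exp (2 * K * v x) \<le> 1 + 2 * K * v x + (1/2 + \<bar>2 * K * v x\<bar>) * (2 * K * v x)\<^sup>2"
        by (rule exp_le_quadratic) (use vb[of x] \<tau> in simp)
      also have "\<dots> \<le> 1 + 2 * K * v x + (1/2 + \<tau>) * (2 * K * v x)\<^sup>2"
        using vb[of x] by (intro add_left_mono mult_right_mono) auto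
      finally show ?thesis by (simp add: power2_eq_square mult_ac)
    qed
  qed (use vi vvi in simp)
  also have "\<dots> = 1 + (1/2 + \<tau>) * (4 * K\<^sup>2 * integral\<^sup>L torus_measure (\<lambda>x. v x * v x))"
    using vi vvi v0 by simp
  also have "\<dots> \<le> 1 + (1/2 + \<tau>) * (4 * K\<^sup>2 * (w 1 / 2 * excess q))"
    using vv \<tau>0 by (intro add_left_mono mult_left_mono) auto
  also have "\<dots> = 1 + K * excess q * ((1 + 2 * \<tau>) * (K * w 1))"
    by (simp add: power2_eq_square algebra_simps)
  finally have Z: "Z - 1 \<le> K * excess q * ((1 + 2 * \<tau>) * (K * w 1))" by simp
  note G = gibbs[OF q(1) fm vb, folded Z_def]
  have "integral\<^sup>L torus_measure (\<lambda>x. 2 * K * v x * q x) = 2 * K * excess q"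
    using integral_conv(1)[OF q'(2) i] bil_q by (simp add: v_def mult.assoc)
  then have "K * excess q \<le> ln Z" using G(2) q(2) by simp
  also have "\<dots> \<le> Z - 1" by (rule ln_le_minus_one[OF G(1)])
  finally have le: "K * excess q \<le> K * excess q * ((1 + 2 * \<tau>) * (K * w 1))" using Z by simp
  have "excess q = 0"
  proof (rule ccontr)
    assume "excess q \<noteq> 0"
    then have "0 < K * excess q" using excess_nonneg[OF q'(1)] K by simp
    then have "1 \<le> (1 + 2 * \<tau>) * (K * w 1)" using le by (simp add: mult_le_cancel_left1)
    then show False using \<tau> by simp
  qed
  then show ?thesis using q ent_nonneg[OF q(1)] ent_eq_0[OF q(1)] by simp
qed

text \<open>Under \<open>L^1\<close> convergence the factor in \<open>local_uniqueness\<close> tends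
  to \<open>Kc * w 1 < 1\<close>. Minimisers just above \<open>Kc\<close> would then be uniform,
  contradicting \<open>above\<close>.\<close>

lemma not_continuous_transitionI:
  assumes Kc: "0 \<le> Kc" and w1: "\<And>k. 1 \<le> k \<Longrightarrow> w k \<le> w 1" and less: "Kc * w 1 < 1"
    and above: "\<And>K. Kc < K \<Longrightarrow> \<not> unif_min K"
  shows "\<not> continuous_transition W Kc"
proof
  assume cont: "continuous_transition W Kc"
  define qf where "qf K = (SOME q. global_minimizer W K q)" for K
  have qf: "\<forall>K>Kc. global_minimizer W K (qf K)"
  proof (intro allI impI)
    fix K assume "Kc < K"
    then have "\<exists>q. global_minimizer W K q" using Kc by (intro ex_global_minimizer) simp
    then show "global_minimizer W K (qf K)" unfolding qf_def by (rule someI_ex)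
  qed
  define \<delta> where "\<delta> K = integral\<^sup>L torus_measure (\<lambda>x. \<bar>qf K x - q_unif x\<bar>)" for K
  have d: "(\<delta> \<longlongrightarrow> 0) (at_right Kc)"
    using cont qf unfolding continuous_transition_def \<delta>_def by blast
  have Kl: "((\<lambda>K. K) \<longlongrightarrow> Kc) (at_right Kc)" by (rule tendsto_ident_at)
  have t: "((\<lambda>K. 2 * K * w_sum * \<delta> K) \<longlongrightarrow> 2 * Kc * w_sum * 0) (at_right Kc)"
    by (intro tendsto_mult tendsto_const Kl d)
  have "((\<lambda>K. (1 + 2 * (2 * K * w_sum * \<delta> K)) * (K * w 1)) \<longlongrightarrow> (1 + 2 * (2 * Kc * w_sum * 0)) * (Kc * w 1)) (at_right Kc)"
    by (intro tendsto_mult tendsto_add tendsto_const Kl d)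
  then have "\<forall>\<^sub>F K in at_right Kc. (1 + 2 * (2 * K * w_sum * \<delta> K)) * (K * w 1) < 1"
    using less by (intro order_tendstoD) auto
  moreover have "\<forall>\<^sub>F K in at_right Kc. 2 * K * w_sum * \<delta> K < 1"
    using t by (intro order_tendstoD) auto
  moreover have "\<forall>\<^sub>F K in at_right Kc. Kc < K" by (rule eventually_at_right_less)
  ultimately have "\<forall>\<^sub>F K in at_right Kc. False"
  proof eventually_elim
    case (elim K)
    have min: "global_minimizer W K (qf K)" using qf elim by simp
    have "same_measure (qf K) q_unif"
      by (rule local_uniqueness[OF w1, where K=K])
         (use elim Kc min global_minimizer_ent_le[OF min] in \<open>auto simp: \<delta>_def global_minimizer_iff\<close>)
    then show False using unif_minI[OF min] above elim by blast
  qed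
  then show False by simp
qed

section \<open>Instability of the uniform state against trial states\<close>

lemma trial_excess_ge:
  assumes \<gamma>: "0 < \<gamma>" "\<gamma> \<le> 1/8"
  shows "w 1 * \<gamma>^2 + w 2 * \<gamma>^4 \<le> excess (trial \<gamma>)"
proof -
  note T = trial_properties[OF \<gamma>]
  note S = excess_sums[OF fin_entD(1)[OF T(1)]]
  let ?g = "\<lambda>k. w k * ((cosc (trial \<gamma>) k)\<^sup>2 + (sinc (trial \<gamma>) k)\<^sup>2)"
  have "w 1 * \<gamma>^2 \<le> ?g 1" "w 2 * \<gamma>^4 \<le> ?g 2"
    unfolding T(2,3) by (intro mult_left_mono w_nonneg, simp)+
  have sum2: "(\<Sum>k<2. g (Suc k)) = g 1 + g 2" for g :: "nat \<Rightarrow> real"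
    by (simp add: numeral_2_eq_2)
  have "w 1 * \<gamma>^2 + w 2 * \<gamma>^4 \<le> (\<Sum>k<2. ?g (Suc k))"
    unfolding sum2[of ?g] by (intro add_mono \<open>w 1 * \<gamma>^2 \<le> ?g 1\<close> \<open>w 2 * \<gamma>^4 \<le> ?g 2\<close>)
  also have "\<dots> \<le> excess (trial \<gamma>)"
    unfolding excess_def sums_unique[OF S]
    by (rule sum_le_suminf) (use S in \<open>auto simp: sums_iff w_nonneg\<close>)
  finally show ?thesis .
qed

lemma not_unif_min_trial:
  assumes K: "0 \<le> K" and \<gamma>: "0 < \<gamma>" "\<gamma> \<le> 1/8"
    and "\<gamma>^2 + \<gamma>^4/2 + 1044 * \<gamma>^5 < K * (w 1 * \<gamma>^2 + w 2 * \<gamma>^4)"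
  shows "\<not> unif_min K"
proof
  assume "unif_min K"
  then have "K * excess (trial \<gamma>) \<le> ent (trial \<gamma>)"
    using trial_properties(1)[OF \<gamma>] by (simp add: unif_min_def)
  moreover have "K * (w 1 * \<gamma>^2 + w 2 * \<gamma>^4) \<le> K * excess (trial \<gamma>)"
    by (intro mult_left_mono trial_excess_ge \<gamma> K)
  ultimately show False using assms(4) trial_properties(4)[OF \<gamma>] by linarith
qed

lemma not_unif_min_above:
  assumes w1: "0 < w 1" and K: "1 / w 1 < K"
  shows "\<not> unif_min K"
proof -
  have K0: "0 < K" using less_trans[OF _ K] w1 by simp
  define s where "s = K * w 1 - 1"
  have s: "0 < s" using K w1 by (simp add: s_def field_simps)
  \<comment> \<open>The terms beyond second order are at most \<open>1044.5 * \<gamma>^3\<close>, so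
    this radius leaves them below the surplus \<open>s * \<gamma>^2\<close>.\<close>
  define \<gamma> where "\<gamma> = min (1/8) (s / 2000)"
  have \<gamma>: "0 < \<gamma>" "\<gamma> \<le> 1/8" "\<gamma> \<le> s / 2000" using s by (auto simp: \<gamma>_def)
  have p: "\<gamma>^n \<le> \<gamma>" if "1 \<le> n" for n using \<gamma> that power_decreasing[of 1 n \<gamma>] by simp
  have "\<gamma>^2 * (\<gamma>^2/2 + 1044 * \<gamma>^3) < \<gamma>^2 * s"
    using p[of 2] p[of 3] \<gamma> by (intro mult_strict_left_mono) auto
  then have "\<gamma>^2 + \<gamma>^4/2 + 1044 * \<gamma>^5 < K * (w 1 * \<gamma>^2)"
    by (simp add: s_def power_numeral_reduce algebra_simps)
  also have "\<dots> \<le> K * (w 1 * \<gamma>^2 + w 2 * \<gamma>^4)"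
    using K0 w_nonneg[of 2] \<gamma> by (intro mult_left_mono) auto
  finally show ?thesis using not_unif_min_trial[of K \<gamma>] K0 \<gamma> by simp
qed

text \<open>At \<open>K = 1 / w 1\<close> the terms in \<open>\<gamma>^2\<close> cancel, and order
  four compares \<open>w 2 / w 1\<close> with \<open>1/2\<close>. The surplus \<open>s\<close> beats
  the fifth-order remainder once \<open>1044 * \<gamma> < s\<close>.\<close>

lemma not_unif_min_at:
  assumes w1: "0 < w 1" and w2: "w 1 < 2 * w 2"
  shows "\<not> unif_min (1 / w 1)"
proof -
  define s where "s = w 2 / w 1 - 1/2"
  have s: "0 < s" using w1 w2 by (simp add: s_def field_simps)
  define \<gamma> where "\<gamma> = min (1/8) (s / 2000)"
  have \<gamma>: "0 < \<gamma>" "\<gamma> \<le> 1/8" "\<gamma> \<le> s / 2000" using s by (auto simp: \<gamma>_def)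
  have "\<gamma>^4 * (1044 * \<gamma>) < \<gamma>^4 * s"
    using \<gamma> s by (intro mult_strict_left_mono) auto
  then have "\<gamma>^2 + \<gamma>^4/2 + 1044 * \<gamma>^5 < \<gamma>^2 + w 2 / w 1 * \<gamma>^4"
    by (simp add: s_def power_numeral_reduce algebra_simps)
  also have "\<dots> = 1 / w 1 * (w 1 * \<gamma>^2 + w 2 * \<gamma>^4)"
    using w1 by (simp add: field_simps)
  finally show ?thesis using not_unif_min_trial[of "1 / w 1" \<gamma>] w1 \<gamma> by simp
qed

end

section \<open>The Hegselmann-Krause interaction\<close>

text \<open>The substitution \<open>c = cos (2 * pi * x)\<close> turns an even function into a
  continuous function on \<open>{-1..1}\<close>, where polynomials are dense. Orthogonality to all
  polynomials in the cosine bounds the integral of the square by \<open>e * J\<close> for every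
  positive \<open>e\<close>.\<close>

lemma even_fun_eq_0_if_cos_integrals_0:
  fixes \<phi> :: "real \<Rightarrow> real"
  assumes cont: "continuous_on {-1/2..1/2} \<phi>" and even: "\<And>x. \<phi> (- x) = \<phi> x"
    and zero: "\<And>k. integral\<^sup>L torus_measure (\<lambda>x. cos (2 * pi * real k * x) * \<phi> x) = 0"
    and x: "x \<in> {-1/2..1/2}"
  shows "\<phi> x = 0"
proof -
  have i: "integrable torus_measure (\<lambda>x. g x * \<phi> x)" if "continuous_on UNIV g" for g
    by (intro cont_imp_integrable_torus continuous_on_mult cont continuous_on_subset[OF that]) auto
  \<comment> \<open>The extra factor of frequency \<open>k\<close> lets the induction close: the
    product formula trades one power of the cosine for the frequencies \<open>k + 1\<close> and
    \<open>k - 1\<close>.\<close>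
  have moment: "integral\<^sup>L torus_measure (\<lambda>x. (cos (2 * pi * real k * x) * cos (2 * pi * x) ^ n) * \<phi> x) = 0" for k n
  proof (induction n arbitrary: k)
    case 0
    then show ?case using zero[of k] by simp
  next
    case (Suc n)
    show ?case
    proof (cases k)
      case 0
      then show ?thesis using Suc.IH[of 1] by simp
    next
      case k: (Suc j)
      have A: "(cos (2 * pi * real k * x) * cos (2 * pi * x) ^ Suc n) * \<phi> x
        = 1/2 * ((cos (2 * pi * real (Suc k) * x) * cos (2 * pi * x) ^ n) * \<phi> x)
        + 1/2 * ((cos (2 * pi * real j * x) * cos (2 * pi * x) ^ n) * \<phi> x)" for x
      proof -
        have "2 * pi * real (Suc k) * x = 2 * pi * real k * x + 2 * pi * x"
          "2 * pi * real j * x = 2 * pi * real k * x - 2 * pi * x"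
          by (simp_all add: k algebra_simps)
        then show ?thesis by (simp only: cos_add cos_diff) (simp add: algebra_simps)
      qed
      have i1: "integrable torus_measure (\<lambda>x. (cos (2 * pi * real m * x) * cos (2 * pi * x) ^ n) * \<phi> x)" for m
        by (intro i continuous_intros)
      have "integral\<^sup>L torus_measure (\<lambda>x. (cos (2 * pi * real k * x) * cos (2 * pi * x) ^ Suc n) * \<phi> x)
        = integral\<^sup>L torus_measure (\<lambda>x. 1/2 * ((cos (2 * pi * real (Suc k) * x) * cos (2 * pi * x) ^ n) * \<phi> x)
        + 1/2 * ((cos (2 * pi * real j * x) * cos (2 * pi * x) ^ n) * \<phi> x))"
        by (rule Bochner_Integration.integral_cong[OF refl A])
      also have "\<dots> = 0"
        by (subst Bochner_Integration.integral_add[OF integrable_mult_right[OF i1] integrable_mult_right[OF i1]])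
           (simp only: integral_mult_right_zero Suc.IH mult_zero_right add_0)
      finally show ?thesis .
    qed
  qed
  define \<psi> where "\<psi> c = \<phi> (arccos c / (2 * pi))" for c
  have \<psi>_cont: "continuous_on {-1..1} \<psi>"
    unfolding \<psi>_def
  proof (rule continuous_on_compose2[OF cont])
    show "continuous_on {-1..1} (\<lambda>c. arccos c / (2 * pi))"
      by (intro continuous_intros) auto
    show "(\<lambda>c. arccos c / (2 * pi)) ` {-1..1} \<subseteq> {-1/2..1/2}"
    proof
      fix y assume "y \<in> (\<lambda>c. arccos c / (2 * pi)) ` {-1..1}"
      then obtain c where c: "c \<in> {-1..1}" "y = arccos c / (2 * pi)" by auto
      have "0 \<le> arccos c" "arccos c \<le> pi" using c by (auto intro: arccos_lbound arccos_ubound)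
      then show "y \<in> {-1/2..1/2}" unfolding c(2)
        by (auto simp: field_simps intro: order_trans[of _ 0])
    qed
  qed
  have \<psi>: "\<psi> (cos (2 * pi * x)) = \<phi> x" if "x \<in> {-1/2..1/2}" for x
  proof -
    have "cos (2 * pi * x) = cos (2 * pi * \<bar>x\<bar>)" by (cases "0 \<le> x") auto
    moreover have "arccos (cos (2 * pi * \<bar>x\<bar>)) = 2 * pi * \<bar>x\<bar>"
      using that by (intro arccos_cos) (auto simp: abs_le_iff)
    ultimately have "\<psi> (cos (2 * pi * x)) = \<phi> \<bar>x\<bar>" by (simp add: \<psi>_def)
    also have "\<dots> = \<phi> x" using even[of x] by (cases "0 \<le> x") auto
    finally show ?thesis .
  qed
  let ?I = "integral\<^sup>L torus_measure (\<lambda>x. \<phi> x * \<phi> x)"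
  define J where "J = integral\<^sup>L torus_measure (\<lambda>x. \<bar>\<phi> x\<bar>)"
  have \<phi>i: "integrable torus_measure \<phi>" "integrable torus_measure (\<lambda>x. \<phi> x * \<phi> x)"
    by (intro cont_imp_integrable_torus continuous_on_mult cont)+
  have I_le: "?I \<le> e * J" if e: "0 < e" for e
  proof -
    obtain g where g: "real_polynomial_function g" "\<And>c. c \<in> {-1..1} \<Longrightarrow> \<bar>\<psi> c - g c\<bar> < e"
      using Stone_Weierstrass_real_polynomial_function[OF _ \<psi>_cont e] by auto
    obtain a n where a: "g = (\<lambda>c. \<Sum>j\<le>n. a j * c ^ j)"
      using g(1) unfolding real_polynomial_function_iff_sum by blast
    have gi: "integrable torus_measure (\<lambda>x. g (cos (2 * pi * x)) * \<phi> x)"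
      unfolding a by (intro i continuous_intros)
    have "integral\<^sup>L torus_measure (\<lambda>x. g (cos (2 * pi * x)) * \<phi> x)
      = integral\<^sup>L torus_measure (\<lambda>x. \<Sum>j\<le>n. a j * ((cos (2 * pi * real 0 * x) * cos (2 * pi * x) ^ j) * \<phi> x))"
      unfolding a sum_distrib_right by (intro Bochner_Integration.integral_cong refl sum.cong) simp
    also have "\<dots> = (\<Sum>j\<le>n. a j * integral\<^sup>L torus_measure (\<lambda>x. (cos (2 * pi * real 0 * x) * cos (2 * pi * x) ^ j) * \<phi> x))"
      by (subst Bochner_Integration.integral_sum)
         (intro integrable_mult_right i continuous_intros, simp only: integral_mult_right_zero)
    also have "\<dots> = 0" by (simp only: moment) simp
    finally have "?I = integral\<^sup>L torus_measure (\<lambda>x. \<phi> x * \<phi> x - g (cos (2 * pi * x)) * \<phi> x)"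
      using \<phi>i gi by simp
    also have "\<dots> \<le> integral\<^sup>L torus_measure (\<lambda>x. e * \<bar>\<phi> x\<bar>)"
    proof (rule integral_mono)
      fix x assume "x \<in> space torus_measure"
      then have x: "x \<in> {-1/2..1/2}" by (simp add: torus_def)
      have "\<phi> x * \<phi> x - g (cos (2 * pi * x)) * \<phi> x = (\<psi> (cos (2 * pi * x)) - g (cos (2 * pi * x))) * \<phi> x"
        unfolding \<psi>[OF x] by (rule left_diff_distrib[symmetric])
      also have "\<dots> \<le> \<bar>\<psi> (cos (2 * pi * x)) - g (cos (2 * pi * x))\<bar> * \<bar>\<phi> x\<bar>"
        by (metis abs_ge_self abs_mult)
      also have "\<dots> \<le> e * \<bar>\<phi> x\<bar>"
        using g(2)[of "cos (2 * pi * x)"] by (intro mult_right_mono) auto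
      finally show "\<phi> x * \<phi> x - g (cos (2 * pi * x)) * \<phi> x \<le> e * \<bar>\<phi> x\<bar>" .
    qed (use \<phi>i gi in auto)
    finally show ?thesis by (simp add: J_def)
  qed
  have "?I \<le> 0"
  proof (rule field_le_epsilon)
    fix d :: real assume d: "0 < d"
    have J: "0 \<le> J" unfolding J_def by (rule integral_nonneg_AE) simp
    have "?I \<le> d / (J + 1) * J" using d J by (intro I_le) auto
    also have "\<dots> \<le> d" using d J by (simp add: field_simps)
    finally show "?I \<le> 0 + d" by simp
  qed
  moreover have "0 \<le> ?I" by (rule integral_nonneg_AE) simp
  ultimately have I0: "?I = 0" by simp
  have c2: "continuous_on {-1/2..1/2} (\<lambda>x. \<phi> x * \<phi> x)" by (intro continuous_on_mult cont)
  have "integral {-1/2..1/2} (\<lambda>x. \<phi> x * \<phi> x) = 0"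
    using integral_torus_eqI[OF c2 integrable_integral[OF integrable_continuous_real[OF c2]]] I0 by simp
  then have "\<forall>x\<in>{-1/2..1/2}. \<phi> x * \<phi> x = 0"
    using integral_eq_0_iff[OF c2] by simp
  then show ?thesis using x by simp
qed

text \<open>Mean and doubled cosine coefficients of the kernel, in the convention of
  \<open>cosine_kernel\<close>.\<close>

definition hk_weight :: "real \<Rightarrow> nat \<Rightarrow> real" where
  "hk_weight R k = (if k = 0 then R ^ 3 / (3 * pi)
     else 4 * (real k * R - sin (real k * R)) / (pi * real k ^ 3))"

lemma W_HK_eq_abs: "x \<in> {-1/2..1/2} \<Longrightarrow> W_HK R x = (max (R - 2 * pi * \<bar>x\<bar>) 0)\<^sup>2"
proof -
  assume x: "x \<in> {-1/2..1/2}"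
  have "dist_T x = \<bar>x\<bar>"
  proof (cases "0 \<le> x")
    case True
    then have "frac x = x" using x by (simp add: frac_eq)
    then show ?thesis using True x by (simp add: dist_T_def)
  next
    case False
    then have "frac x = x + 1" using x by (subst frac_unique_iff) auto
    then show ?thesis using False x by (simp add: dist_T_def)
  qed
  then show ?thesis by (simp add: W_HK_def)
qed

text \<open>For \<open>R \<le> pi\<close> the support
  \<open>\<bar>x\<bar> \<le> R / (2 * pi)\<close> fits in one period. On its right half
  \<open>F\<close> is an antiderivative found by parts; evenness doubles the result and the rest of
  the period contributes zero.\<close>

lemma hk_cos_integral:
  assumes R: "0 < R" "R \<le> pi"
  shows "integral\<^sup>L torus_measure (\<lambda>x. cos (2 * pi * real k * x) * (max (R - 2 * pi * \<bar>x\<bar>) 0)\<^sup>2)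
    = (if k = 0 then hk_weight R 0 else hk_weight R k / 2)"
proof -
  define r where "r = R / (2 * pi)"
  have r: "0 < r" "r \<le> 1/2" "2 * pi * r = R" using R by (auto simp: r_def field_simps)
  define f where "f x = cos (2 * pi * real k * x) * (max (R - 2 * pi * \<bar>x\<bar>) 0)\<^sup>2" for x
  define m where "m = 2 * pi * real k"
  define F where "F x = (if k = 0 then - ((R - 2 * pi * x) ^ 3 / (6 * pi))
     else (R - 2 * pi * x)\<^sup>2 * sin (m * x) / m - 4 * pi * (R - 2 * pi * x) * cos (m * x) / m\<^sup>2 - 8 * pi\<^sup>2 * sin (m * x) / m ^ 3)" for x
  have "(f has_integral (F r - F 0)) {0..r}"
  proof (rule fundamental_theorem_of_calculus)
    fix x assume x: "x \<in> {0..r}"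
    then have "2 * pi * x \<le> 2 * pi * r" by (intro mult_left_mono) auto
    then have fx: "f x = cos (m * x) * (R - 2 * pi * x)\<^sup>2" using x r by (simp add: f_def m_def)
    have "(F has_real_derivative f x) (at x within {0..r})"
    proof (cases "k = 0")
      case True
      then show ?thesis unfolding F_def fx m_def
        by (auto intro!: derivative_eq_intros simp: power2_eq_square field_simps)
    next
      case False
      then have m: "m \<noteq> 0" by (simp add: m_def)
      have "((\<lambda>x. (R - 2 * pi * x)\<^sup>2 * sin (m * x) / m - 4 * pi * (R - 2 * pi * x) * cos (m * x) / m\<^sup>2 - 8 * pi\<^sup>2 * sin (m * x) / m ^ 3)
        has_real_derivative f x) (at x within {0..r})"
        unfolding fx using m
        by (auto intro!: derivative_eq_intros simp: power2_eq_square power3_eq_cube field_simps)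
      then show ?thesis using False by (simp add: F_def[abs_def])
    qed
    then show "(F has_vector_derivative f x) (at x within {0..r})"
      by (simp add: has_real_derivative_iff_has_vector_derivative)
  qed (use r in simp)
  moreover have "(f has_integral (F r - F 0)) {-r..0}"
  proof -
    have "((\<lambda>x. f (- x)) has_integral (F r - F 0)) {-r..-0}"
      unfolding has_integral_reflect_real by fact
    moreover have "(\<lambda>x. f (- x)) = f" by (simp add: f_def fun_eq_iff)
    ultimately show ?thesis by simp
  qed
  ultimately have "(f has_integral ((F r - F 0) + (F r - F 0))) {-r..r}"
    using r by (intro has_integral_combine[of "-r" 0 r]) auto
  then have "(f has_integral ((F r - F 0) + (F r - F 0))) {-1/2..1/2}"
  proof (rule has_integral_on_superset)
    fix x assume "x \<notin> {-r..r}"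
    then have "2 * pi * r \<le> 2 * pi * \<bar>x\<bar>" by (intro mult_left_mono) auto
    then show "f x = 0" using r by (simp add: f_def)
  qed (use r in auto)
  then have "integral\<^sup>L torus_measure f = 2 * (F r - F 0)"
    unfolding f_def[abs_def] by (subst integral_torus_eqI) (auto intro!: continuous_intros)
  also have "\<dots> = (if k = 0 then hk_weight R 0 else hk_weight R k / 2)"
  proof (cases "k = 0")
    case True
    then show ?thesis using r by (simp add: F_def hk_weight_def field_simps)
  next
    case False
    have "m * r = real k * R" using r(3) by (simp add: m_def mult_ac flip: r(3))
    then have "2 * (F r - F 0) = 2 * (4 * pi * R / m\<^sup>2 - 8 * pi\<^sup>2 * sin (real k * R) / m ^ 3)"
      using False r(3) by (simp add: F_def)
    also have "\<dots> = hk_weight R k / 2"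
      using False by (simp add: hk_weight_def m_def field_simps power2_eq_square power3_eq_cube)
    finally show ?thesis using False by simp
  qed
  finally show ?thesis by (simp add: f_def[abs_def])
qed

lemma hk_weight_nonneg: "0 \<le> R \<Longrightarrow> 0 \<le> hk_weight R k"
  using sin_x_le_x[of "real k * R"] by (simp add: hk_weight_def)

lemma hk_weight_summable:
  assumes "0 \<le> R"
  shows "summable (hk_weight R)"
proof (rule summable_comparison_test')
  show "summable (\<lambda>k. 4 * (R + 1) / pi * inverse (real k ^ 2))"
    by (intro summable_mult inverse_power_summable) simp
  fix k :: nat assume k: "1 \<le> k"
  have "real k * R - sin (real k * R) \<le> real k * R + 1" using sin_ge_minus_one[of "real k * R"] by linarith
  also have "\<dots> \<le> real k * (R + 1)" using k by (simp add: algebra_simps)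
  finally have "4 * (real k * R - sin (real k * R)) / (pi * real k ^ 3) \<le> 4 * (real k * (R + 1)) / (pi * real k ^ 3)"
    using k by (intro divide_right_mono mult_left_mono) auto
  also have "\<dots> = 4 * (R + 1) / pi * inverse (real k ^ 2)"
    using k by (simp add: field_simps power2_eq_square power3_eq_cube)
  finally show "norm (hk_weight R k) \<le> 4 * (R + 1) / pi * inverse (real k ^ 2)"
    using k hk_weight_nonneg[OF assms, of k] by (simp add: hk_weight_def)
qed

text \<open>The series \<open>V\<close> with these weights converges absolutely and has the same
  cosine integrals as the kernel \<open>h\<close>. Both are even and continuous, so they agree on
  one period, and periodicity extends this to the line.\<close>

lemma W_HK_kernel:
  assumes R: "0 < R" "R \<le> pi"
  shows "cosine_kernel (W_HK R) (hk_weight R)"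
proof -
  let ?w = "hk_weight R"
  define V where "V x = (\<Sum>k. ?w k * cos (2 * pi * real k * x))" for x
  interpret V: cosine_kernel V ?w
    by unfold_locales (use R in \<open>auto simp: V_def hk_weight_nonneg hk_weight_summable\<close>)
  define h where "h x = (max (R - 2 * pi * \<bar>x\<bar>) 0)\<^sup>2" for x
  have hc: "continuous_on {-1/2..1/2} h" unfolding h_def by (intro continuous_intros)
  have Vc: "continuous_on {-1/2..1/2} V" by (rule continuous_on_subset[OF V.W_continuous]) simp
  have "integral\<^sup>L torus_measure (\<lambda>x. cos (2 * pi * real j * x) * V x) = (if j = 0 then ?w 0 else ?w j / 2)" for j
  proof -
    let ?\<phi> = "\<lambda>k x. ?w k * (cos (2 * pi * real j * x) * cos (2 * pi * real k * x))"
    have "(\<lambda>k. integral\<^sup>L torus_measure (?\<phi> k)) sums (integral\<^sup>L torus_measure (\<lambda>x. \<Sum>k. ?\<phi> k x))"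
    proof (rule sums_integral_torus(1)[where B="?w" and g="\<lambda>_. 1"])
      show "?\<phi> k \<in> borel_measurable torus_measure" for k
        by (rule torus_measurable_cont) (intro continuous_intros)
      show "norm (?\<phi> k x) \<le> ?w k * 1" for k x
        using V.w_nonneg[of k] by (auto simp: abs_mult intro!: mult_left_le mult_le_one)
    qed (auto simp: V.w_summable)
    also have "(\<lambda>x. \<Sum>k. ?\<phi> k x) = (\<lambda>x. cos (2 * pi * real j * x) * V x)"
    proof
      fix x
      have "(\<Sum>k. cos (2 * pi * real j * x) * (?w k * cos (2 * pi * real k * x))) = cos (2 * pi * real j * x) * V x"
        unfolding V_def by (rule suminf_mult[OF V.W_summable])
      then show "(\<Sum>k. ?\<phi> k x) = cos (2 * pi * real j * x) * V x"
        by (simp only: mult.left_commute)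
    qed
    also have "(\<lambda>k. integral\<^sup>L torus_measure (?\<phi> k)) = (\<lambda>k. if k = j then (if j = 0 then ?w 0 else ?w j / 2) else 0)"
    proof
      fix k
      have A: "integral\<^sup>L torus_measure (?\<phi> k) = ?w k * cosc (\<lambda>x. cos (2 * pi * real k * x)) j"
        by (simp only: integral_mult_right_zero cosc_def)
      show "integral\<^sup>L torus_measure (?\<phi> k) = (if k = j then (if j = 0 then ?w 0 else ?w j / 2) else 0)"
        unfolding A cosc_cos by auto
    qed
    finally have S: "(\<lambda>k. if k = j then (if j = 0 then ?w 0 else ?w j / 2) else 0) sums (integral\<^sup>L torus_measure (\<lambda>x. cos (2 * pi * real j * x) * V x))" .
    show ?thesis
      by (rule sums_unique2[OF S sums_single[of j "\<lambda>_. if j = 0 then ?w 0 else ?w j / 2"]])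
  qed
  moreover have "integrable torus_measure h" "integrable torus_measure V"
    by (intro cont_imp_integrable_torus hc Vc)+
  ultimately have "integral\<^sup>L torus_measure (\<lambda>x. cos (2 * pi * real j * x) * (h x - V x)) = 0" for j
    using hk_cos_integral[OF R, of j] integrable_cos_mult
    unfolding right_diff_distrib by (simp add: h_def[abs_def])
  then have hV: "h x - V x = 0" if "x \<in> {-1/2..1/2}" for x
    by (intro even_fun_eq_0_if_cos_integrals_0[of "\<lambda>x. h x - V x"] continuous_on_diff hc Vc that)
       (simp_all add: h_def V_def)
  have "W_HK R x = V x" for x
  proof -
    \<comment> \<open>Representative of \<open>x\<close> modulo \<open>1\<close> in the centred
      period, where \<open>dist_T\<close> is the absolute value.\<close>
    define y where "y = (if frac x < 1/2 then frac x else frac x - 1)"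
    have y: "y \<in> {-1/2..1/2}" "dist_T x = \<bar>y\<bar>"
    proof -
      obtain z where z: "frac x = z" "0 \<le> z" "z < 1" using frac_ge_0[of x] frac_lt_1[of x] by blast
      show "y \<in> {-1/2..1/2}" "dist_T x = \<bar>y\<bar>"
        using z(2,3) unfolding y_def dist_T_def z(1) by auto
    qed
    have "x - y \<in> \<int>" by (auto simp: y_def frac_def)
    then obtain n where n: "x = y + of_int n" by (auto elim!: Ints_cases simp: algebra_simps)
    have "cos (2 * pi * real k * x) = cos (2 * pi * real k * y)" for k
    proof -
      have "2 * pi * real k * x = 2 * pi * real k * y + 2 * pi * of_int (int k * n)"
        by (simp add: n algebra_simps)
      then show ?thesis by (simp only: cos_add cos_int_2pin sin_int_2pin mult_1_right mult_zero_right diff_zero)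
    qed
    then have "V x = V y" by (simp add: V_def)
    also have "\<dots> = h y" using hV[OF y(1)] by simp
    also have "\<dots> = W_HK R x" by (simp add: W_HK_def h_def y(2))
    finally show ?thesis ..
  qed
  then show ?thesis using V.cosine_kernel_axioms by (simp add: cosine_kernel_def)
qed

section \<open>Comparison of the weights of different modes\<close>

lemma sin_less_self:
  fixes x :: real
  assumes "0 < x" "x \<le> pi"
  shows "sin x < x"
proof -
  have "(\<lambda>x. x - sin x) 0 < (\<lambda>x. x - sin x) x"
  proof (rule DERIV_pos_imp_increasing_open[OF assms(1)])
    fix y assume y: "0 < y" "y < x"
    have "cos y < cos 0" using y assms by (intro cos_monotone_0_pi) auto
    then show "\<exists>d. ((\<lambda>x. x - sin x) has_real_derivative d) (at y) \<and> 0 < d"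
      by (intro exI[of _ "1 - cos y"]) (auto intro!: derivative_eq_intros)
  qed (intro continuous_intros)
  then show ?thesis by simp
qed

lemma abs_sin_mult_le: "\<bar>sin (real k * x)\<bar> \<le> real k * \<bar>sin x\<bar>"
proof (induction k)
  case (Suc k)
  have "sin (real (Suc k) * x) = sin (real k * x) * cos x + cos (real k * x) * sin x"
    by (simp add: algebra_simps sin_add)
  then have "\<bar>sin (real (Suc k) * x)\<bar> \<le> \<bar>sin (real k * x)\<bar> * \<bar>cos x\<bar> + \<bar>cos (real k * x)\<bar> * \<bar>sin x\<bar>"
    by (metis abs_mult abs_triangle_ineq)
  also have "\<dots> \<le> \<bar>sin (real k * x)\<bar> * 1 + 1 * \<bar>sin x\<bar>"
    by (intro add_mono mult_mono) auto
  finally show ?case using Suc by (simp add: algebra_simps)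
qed simp

text \<open>Differentiation in the radius reduces the claim to
  \<open>1 - cos (k * x) \<le> k^2 * (1 - cos x)\<close>, the square of
  \<open>abs_sin_mult_le\<close> at the half angle. Consequently the first mode determines the
  linear stability threshold.\<close>

lemma hk_weight_le_first:
  assumes R: "0 < R" and k: "1 \<le> k"
  shows "hk_weight R k \<le> hk_weight R 1"
proof -
  define g where "g x = real k ^ 3 * (x - sin x) - (real k * x - sin (real k * x))" for x
  have "g 0 \<le> g R"
  proof (rule DERIV_nonneg_imp_nondecreasing[of 0 R])
    fix x :: real
    have c: "1 - cos y = 2 * (sin (y/2))\<^sup>2" for y :: real
      using cos_double_sin[of "y/2"] by simp
    have "(sin (real k * (x/2)))\<^sup>2 \<le> (real k * \<bar>sin (x/2)\<bar>)\<^sup>2"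
      using abs_sin_mult_le[of k "x/2"] by (subst power2_abs[symmetric]) (intro power_mono, auto)
    then have "1 - cos (real k * x) \<le> real k ^ 2 * (1 - cos x)"
      unfolding c by (simp add: power_mult_distrib)
    from mult_left_mono[OF this, of "real k"]
    have "0 \<le> real k ^ 3 * (1 - cos x) - (real k - real k * cos (real k * x))"
      by (simp add: algebra_simps power2_eq_square power3_eq_cube)
    moreover have "(g has_real_derivative (real k ^ 3 * (1 - cos x) - (real k - real k * cos (real k * x)))) (at x)"
      unfolding g_def by (auto intro!: derivative_eq_intros)
    ultimately show "\<exists>y. (g has_real_derivative y) (at x) \<and> 0 \<le> y" by blast
  qed (use R in simp)
  then have "real k * R - sin (real k * R) \<le> real k ^ 3 * (R - sin R)" by (simp add: g_def)
  then have "4 * (real k * R - sin (real k * R)) / (pi * real k ^ 3) \<le> 4 * (real k ^ 3 * (R - sin R)) / (pi * real k ^ 3)"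
    by (intro divide_right_mono mult_left_mono) auto
  also have "\<dots> = hk_weight R 1" using k by (simp add: hk_weight_def)
  finally show ?thesis using k by (simp add: hk_weight_def)
qed

lemma hk_weight_first_pos: "0 < R \<Longrightarrow> R \<le> pi \<Longrightarrow> 0 < hk_weight R 1"
  using sin_less_self[of R] by (simp add: hk_weight_def)

text \<open>Its zero in the open interval from \<open>0\<close> to \<open>pi\<close> is the radius
  \<open>R_*\<close>; its sign decides whether the second mode satisfies
  \<open>2 * hk_weight R 2 \<le> hk_weight R 1\<close>.\<close>

definition hk_gap :: "real \<Rightarrow> real" where
  "hk_gap R = R - sin R * (2 - cos R)"

text \<open>The factored form shows the sign: starting from \<open>0\<close>, the gap decreases up
  to \<open>pi / 2\<close> and increases from there to \<open>pi\<close>.\<close>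

lemma hk_gap_deriv: "(hk_gap has_real_derivative 2 * cos x * (cos x - 1)) (at x)"
proof -
  have "(hk_gap has_real_derivative 1 - (cos x * (2 - cos x) + sin x * sin x)) (at x)"
    unfolding hk_gap_def by (auto intro!: derivative_eq_intros)
  also have "1 - (cos x * (2 - cos x) + sin x * sin x) = 2 * cos x * (cos x - 1)"
    using sin_cos_squared_add[of x] by (simp add: power2_eq_square algebra_simps)
  finally show ?thesis .
qed

lemma hk_gap_cont: "continuous_on S hk_gap"
  unfolding hk_gap_def by (intro continuous_intros)

lemma hk_gap_neg: "0 < R \<Longrightarrow> R \<le> pi / 2 \<Longrightarrow> hk_gap R < 0"
proof -
  assume R: "0 < R" "R \<le> pi / 2"
  have "hk_gap R < hk_gap 0"
  proof (rule DERIV_neg_imp_decreasing_open[OF R(1) _ hk_gap_cont])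
    fix x assume x: "0 < x" "x < R"
    have "0 < cos x" using x R by (intro cos_gt_zero_pi) auto
    moreover have "cos x < cos 0" using x R by (intro cos_monotone_0_pi) auto
    ultimately have "2 * cos x * (cos x - 1) < 0" by (simp add: mult_pos_neg)
    then show "\<exists>y. (hk_gap has_real_derivative y) (at x) \<and> y < 0" using hk_gap_deriv by blast
  qed
  then show ?thesis by (simp add: hk_gap_def)
qed

lemma hk_gap_strict_mono: "pi / 2 \<le> a \<Longrightarrow> a < b \<Longrightarrow> b \<le> pi \<Longrightarrow> hk_gap a < hk_gap b"
proof -
  assume a: "pi / 2 \<le> a" and ab: "a < b" and b: "b \<le> pi"
  show "hk_gap a < hk_gap b"
  proof (rule DERIV_pos_imp_increasing_open[OF ab _ hk_gap_cont])
    fix x assume x: "a < x" "x < b"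
    have "cos x < cos (pi / 2)" using x a b by (intro cos_monotone_0_pi) auto
    then have "0 < 2 * cos x * (cos x - 1)" by (simp add: mult_neg_neg)
    then show "\<exists>y. (hk_gap has_real_derivative y) (at x) \<and> 0 < y" using hk_gap_deriv by blast
  qed
qed

text \<open>The zero \<open>Rs\<close> cannot lie in the initial region where the gap is negative,
  so it lies on the increasing branch. The bound \<open>pi / 2 < R\<close> is recorded because the
  higher modes are treated with \<open>cos R < 0\<close>.\<close>

lemma hk_gap_sign:
  assumes "0 < Rs" "Rs < pi" "Rs = sin Rs * (2 - cos Rs)" "0 < R" "R \<le> pi"
  shows "R < Rs \<Longrightarrow> hk_gap R < 0" "Rs \<le> R \<Longrightarrow> 0 \<le> hk_gap R \<and> pi / 2 < R"
proof -
  have Rs0: "hk_gap Rs = 0" using assms(3) by (simp add: hk_gap_def)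
  have Rs: "pi / 2 < Rs" using Rs0 hk_gap_neg[OF assms(1)] by (intro not_le_imp_less notI) simp
  show "hk_gap R < 0" if "R < Rs"
    using hk_gap_neg[of R] hk_gap_strict_mono[of R Rs] Rs0 assms that by (cases "R \<le> pi / 2") auto
  show "0 \<le> hk_gap R \<and> pi / 2 < R" if "Rs \<le> R"
    using hk_gap_strict_mono[of Rs R] Rs0 Rs assms that by (cases "Rs = R") auto
qed

lemma hk_weight_second: "2 * hk_weight R 2 - hk_weight R 1 = - (2 / pi) * hk_gap R"
  using sin_double[of R] by (simp add: hk_weight_def hk_gap_def field_simps)

text \<open>A nonnegative gap and \<open>cos R < 0\<close> give
  \<open>R - sin R \<ge> R / 2\<close>. The crude bound \<open>sin \<ge> -1\<close> then suffices:
  \<open>k * R + 1 < k^2 * R / 2\<close>, because \<open>k * (k - 2) \<ge> 3\<close> and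
  \<open>3 * R / 2 > 1\<close>.\<close>

lemma hk_weight_higher:
  assumes R: "pi / 2 < R" "R \<le> pi" and gap: "0 \<le> hk_gap R" and k: "3 \<le> k"
  shows "real k * hk_weight R k < hk_weight R 1"
proof -
  have s: "0 \<le> sin R" using R by (intro sin_ge_zero) auto
  have c: "cos R < 0" using cos_monotone_0_pi[of "pi / 2" R] R by simp
  have "sin R * 2 \<le> sin R * (2 - cos R)" using s c by (intro mult_left_mono) auto
  then have "R / 2 \<le> R - sin R" using gap by (simp add: hk_gap_def)
  then have 1: "real k ^ 2 * (R / 2) \<le> real k ^ 2 * (R - sin R)" by (intro mult_left_mono) auto
  have "3 * 1 \<le> real k * (real k - 2)" using k by (intro mult_mono) auto
  then have "R / 2 * 3 \<le> R / 2 * (real k * (real k - 2))" using R pi_gt_zero by (intro mult_left_mono) auto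
  moreover have "1 < R / 2 * 3" using R pi_gt3 by simp
  ultimately have "real k * R + 1 < real k ^ 2 * (R / 2)"
    by (simp add: algebra_simps power2_eq_square)
  then have "real k * R - sin (real k * R) < real k ^ 2 * (R - sin R)"
    using 1 sin_ge_minus_one[of "real k * R"] by linarith
  then have "4 * (real k * R - sin (real k * R)) / (pi * real k ^ 2) < 4 * (real k ^ 2 * (R - sin R)) / (pi * real k ^ 2)"
    using k by (intro divide_strict_right_mono mult_strict_left_mono) auto
  also have "\<dots> = hk_weight R 1" using k by (simp add: hk_weight_def)
  also have "4 * (real k * R - sin (real k * R)) / (pi * real k ^ 2) = real k * hk_weight R k"
    using k by (simp add: hk_weight_def power2_eq_square power3_eq_cube)
  finally show ?thesis .
qed

text \<open>The Fourier coefficients are half the weights and are largest at \<open>k = 1\<close>;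
  the half cancels the factor \<open>2\<close> in \<open>K_sharp\<close>.\<close>

lemma K_sharp_W_HK:
  assumes R: "0 < R" "R \<le> pi"
  shows "K_sharp (W_HK R) = 1 / hk_weight R 1"
proof -
  interpret cosine_kernel "W_HK R" "hk_weight R" by (rule W_HK_kernel[OF R])
  have co: "Re (fourier_coeff (W_HK R) k) = hk_weight R (nat k) / 2" if k: "1 \<le> k" for k
  proof -
    let ?f = "\<lambda>\<theta>. complex_of_real (W_HK R \<theta>) * exp (- 2 * pi * \<i> * of_int k * of_real \<theta>)"
    have "integrable torus_measure ?f"
      by (intro cont_imp_integrable_torus continuous_intros continuous_on_subset[OF W_continuous]) auto
    then have "Re (fourier_coeff (W_HK R) k) = integral\<^sup>L torus_measure (\<lambda>x. Re (?f x))"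
      unfolding fourier_coeff_def by (rule integral_Re[symmetric])
    also have "\<dots> = integral\<^sup>L torus_measure (\<lambda>x. cos (2 * pi * real (nat k) * x) * (max (R - 2 * pi * \<bar>x\<bar>) 0)\<^sup>2)"
    proof (rule Bochner_Integration.integral_cong[OF refl])
      fix x assume "x \<in> space torus_measure"
      then have x: "x \<in> {-1/2..1/2}" by (simp add: torus_def)
      have "exp (- 2 * pi * \<i> * of_int k * of_real x) = cis (- (2 * pi * real (nat k) * x))"
        using k by (simp add: cis_conv_exp mult_ac)
      then show "Re (?f x) = cos (2 * pi * real (nat k) * x) * (max (R - 2 * pi * \<bar>x\<bar>) 0)\<^sup>2"
        by (simp add: W_HK_eq_abs[OF x])
    qed
    also have "\<dots> = hk_weight R (nat k) / 2" using k by (subst hk_cos_integral[OF R]) simp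
    finally show ?thesis .
  qed
  have "Sup {Re (fourier_coeff (W_HK R) k) | k. k \<ge> 1 \<and> Re (fourier_coeff (W_HK R) k) > 0} = hk_weight R 1 / 2"
  proof (rule cSup_eq_maximum)
    show "hk_weight R 1 / 2 \<in> {Re (fourier_coeff (W_HK R) k) | k. k \<ge> 1 \<and> Re (fourier_coeff (W_HK R) k) > 0}"
      using co[of 1] hk_weight_first_pos[OF R] by (intro CollectI exI[of _ 1]) auto
    show "x \<le> hk_weight R 1 / 2" if "x \<in> {Re (fourier_coeff (W_HK R) k) | k. k \<ge> 1 \<and> Re (fourier_coeff (W_HK R) k) > 0}" for x
      using that co hk_weight_le_first[OF R(1)] by (auto simp del: One_nat_def)
  qed
  then show ?thesis by (simp add: K_sharp_def)
qed

theorem theorem1p10: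
  fixes R Rs :: real
  assumes "0 < R" and "R \<le> pi"
    and "0 < Rs" and "Rs < pi" and "Rs = sin Rs * (2 - cos Rs)"
  shows "(R < Rs \<longrightarrow> (\<exists>Kc. critical_coupling (W_HK R) Kc
                \<and> \<not> continuous_transition (W_HK R) Kc \<and> Kc < K_sharp (W_HK R)))
       \<and> (Rs \<le> R \<longrightarrow> (\<exists>Kc. critical_coupling (W_HK R) Kc
                \<and> continuous_transition (W_HK R) Kc \<and> Kc = K_sharp (W_HK R)))"
proof (intro conjI impI)
  interpret cosine_kernel "W_HK R" "hk_weight R" using assms by (intro W_HK_kernel)
  let ?w = "hk_weight R"
  have w1: "0 < ?w 1" using assms by (intro hk_weight_first_pos)
  have sharp: "K_sharp (W_HK R) = 1 / ?w 1" using assms by (intro K_sharp_W_HK)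
  note sign = hk_gap_sign[OF assms(3,4,5,1,2)]
  {
    assume "R < Rs"
    then have "hk_gap R < 0" by (rule sign)
    then have "0 < 2 * ?w 2 - ?w 1" unfolding hk_weight_second by (simp add: divide_neg_pos)
    \<comment> \<open>Failure at the stability threshold itself is what places \<open>Kc\<close>
      strictly below it; strictness then gives the margin \<open>Kc * ?w 1 < 1\<close> for
      isolation.\<close>
    then have "\<not> unif_min (1 / ?w 1)" using w1 by (intro not_unif_min_at) auto
    then obtain Kc where Kc: "0 \<le> Kc" "Kc < 1 / ?w 1" "unif_min Kc" "\<And>K. Kc < K \<Longrightarrow> \<not> unif_min K"
      using ex_unif_threshold[of "1 / ?w 1"] w1 by auto
    have "\<not> continuous_transition (W_HK R) Kc"
      using Kc w1 hk_weight_le_first[OF assms(1)]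
      by (intro not_continuous_transitionI) (auto simp: field_simps)
    then show "\<exists>Kc. critical_coupling (W_HK R) Kc
                \<and> \<not> continuous_transition (W_HK R) Kc \<and> Kc < K_sharp (W_HK R)"
      using critical_couplingI[OF Kc(1,3,4)] Kc(2) sharp by auto
  next
    assume "Rs \<le> R"
    then have gap: "0 \<le> hk_gap R" "pi / 2 < R" using sign(2) by auto
    have three: "real k * ?w k < ?w 1" if "3 \<le> k" for k
      by (rule hk_weight_higher[OF gap(2) assms(2) gap(1) that])
    have "real k * ?w k \<le> ?w 1" if "1 \<le> k" for k
    proof -
      consider "k = 1" | "k = 2" | "3 \<le> k" using \<open>1 \<le> k\<close> by linarith
      then show ?thesis
      proof cases
        case 2
        \<comment> \<open>The only mode that can tie, which happens at
          \<open>R = Rs\<close>.\<close>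
        have "2 * ?w 2 - ?w 1 \<le> 0"
          unfolding hk_weight_second using gap(1) by (intro mult_nonpos_nonneg) auto
        then show ?thesis using 2 by simp
      qed (use three in \<open>auto simp: less_imp_le\<close>)
    qed
    note U = sharp_uniqueness[OF w1 this three]
    have "critical_coupling (W_HK R) (1 / ?w 1)"
      using w1 U(1) not_unif_min_above[OF w1] by (intro critical_couplingI) (auto simp: unif_min_def)
    moreover have "continuous_transition (W_HK R) (1 / ?w 1)"
      using w1 U(2) by (intro continuous_transitionI) auto
    ultimately show "\<exists>Kc. critical_coupling (W_HK R) Kc
                \<and> continuous_transition (W_HK R) Kc \<and> Kc = K_sharp (W_HK R)"
      using sharp by auto
  }
qed

end
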